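(* Let $\kappa>0$. The only strongly stable compact two-sided surfaces of constant mean curvature immersed in $\mathbb{S}^2(\kappa)\times\mathbb{R}$ are the horizontal slices $\mathbb{S}^2(\kappa)\times\{t\}$, $t\in\mathbb{R}$.
   Context: $\mathbb{S}^2(\kappa)$ is the round 2-sphere of constant Gaussian curvature $\kappa>0$, and $\mathbb{S}^2(\kappa)\times\mathbb{R}$ has the product metric. Surfaces are connected, orientable and without boundary, with the metric induced by the immersion; an immersed surface is identified with a slice if its image is that slice. Two-sided means there is a globally defined unit normal vector field $N$ along the immersion. $A$ is the shape operator with respect to $N$ and $H=\frac12\mathrm{tr}(A)$ is the mean curvature. The Jacobi (stability) operator is $J=\Delta+|A|^2+\overline{\mathrm{Ric}}(N,N)$, where $\Delta$ is the Laplacian of $\Sigma$ (with $\int_\Sigma f\Delta f=-\int_\Sigma|\nabla f|^2$) and $\overline{\mathrm{Ric}}$ is the Ricci curvature of the ambient space. A constant mean curvature surface $\Sigma$ is strongly stable if $-\int_\Sigma fJf\geq0$ for every $f\in\mathcal{C}^\infty(\Sigma)$. *)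

theory Defs
  imports "HOL-Analysis.Analysis"
begin

section \<open>Smooth maps\<close>

text \<open>Iterated Frechet differentiability on an open set: in finite dimension, continuity of all
  directional derivatives up to order \<open>n\<close> is the usual \<open>C\<^sup>n\<close> condition.\<close>

primrec Ck_on :: "nat \<Rightarrow> 'a::real_normed_vector set \<Rightarrow> ('a \<Rightarrow> 'b::real_normed_vector) \<Rightarrow> bool" where
  "Ck_on 0 S f \<longleftrightarrow> continuous_on S f"
| "Ck_on (Suc n) S f \<longleftrightarrow>
     (\<forall>x\<in>S. f differentiable (at x)) \<and>
     (\<forall>v. Ck_on n S (\<lambda>x. frechet_derivative f (at x) v))"

definition smooth_on :: "'a::real_normed_vector set \<Rightarrow> ('a \<Rightarrow> 'b::real_normed_vector) \<Rightarrow> bool" where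
  "smooth_on S f \<longleftrightarrow> (\<forall>n. Ck_on n S f)"

definition partial_deriv :: "'n::finite \<Rightarrow> (real^'n \<Rightarrow> 'b::real_normed_vector) \<Rightarrow> real^'n \<Rightarrow> 'b" where
  "partial_deriv i F x = frechet_derivative F (at x) (axis i 1)"

section \<open>Abstract smooth surfaces\<close>

text \<open>A chart is a pair \<open>(U, \<psi>)\<close> of a coordinate domain and a coordinate map. The atlas need not be
  maximal; it only serves to determine the smooth structure.\<close>

type_synonym 'a chart = "'a set \<times> ('a \<Rightarrow> real^2)"

definition is_chart :: "'a topology \<Rightarrow> 'a chart \<Rightarrow> bool" where
  "is_chart X c \<longleftrightarrow> openin X (fst c) \<and> open (snd c ` fst c) \<and>
     homeomorphic_map (subtopology X (fst c)) (top_of_set (snd c ` fst c)) (snd c)"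

definition in_chart :: "'a chart \<Rightarrow> ('a \<Rightarrow> 'b) \<Rightarrow> real^2 \<Rightarrow> 'b" where
  "in_chart c f = f \<circ> inv_into (fst c) (snd c)"

definition smooth_atlas :: "'a topology \<Rightarrow> 'a chart set \<Rightarrow> bool" where
  "smooth_atlas X \<A> \<longleftrightarrow>
     (\<forall>c\<in>\<A>. is_chart X c) \<and> \<Union>(fst ` \<A>) = topspace X \<and>
     (\<forall>c\<in>\<A>. \<forall>d\<in>\<A>. smooth_on (snd c ` (fst c \<inter> fst d)) (in_chart c (snd d)))"

definition orientable :: "'a topology \<Rightarrow> 'a chart set \<Rightarrow> bool" where
  "orientable X \<A> \<longleftrightarrow> (\<exists>\<B>. smooth_atlas X \<B> \<and> smooth_atlas X (\<A> \<union> \<B>) \<and>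
     (\<forall>c\<in>\<B>. \<forall>d\<in>\<B>. \<forall>x\<in>snd c ` (fst c \<inter> fst d).
        det (matrix (frechet_derivative (in_chart c (snd d)) (at x))) > 0))"

definition second_countable_space :: "'a topology \<Rightarrow> bool" where
  "second_countable_space X \<longleftrightarrow> (\<exists>\<V>. countable \<V> \<and> (\<forall>V\<in>\<V>. openin X V) \<and>
     (\<forall>U x. openin X U \<and> x \<in> U \<longrightarrow> (\<exists>V\<in>\<V>. x \<in> V \<and> V \<subseteq> U)))"

definition surface :: "'a topology \<Rightarrow> 'a chart set \<Rightarrow> bool" where
  "surface X \<A> \<longleftrightarrow> Hausdorff_space X \<and> second_countable_space X \<and>
     topspace X \<noteq> {} \<and> connected_space X \<and> smooth_atlas X \<A> \<and> orientable X \<A>"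

definition smooth_map :: "'a chart set \<Rightarrow> ('a \<Rightarrow> 'b::real_normed_vector) \<Rightarrow> bool" where
  "smooth_map \<A> f \<longleftrightarrow> (\<forall>c\<in>\<A>. smooth_on (snd c ` fst c) (in_chart c f))"

text \<open>Pointwise geometric quantities below are computed in this chart; none of them depends on
  the choice.\<close>

definition chart_at :: "'a chart set \<Rightarrow> 'a \<Rightarrow> 'a chart" where
  "chart_at \<A> p = (SOME c. c \<in> \<A> \<and> p \<in> fst c)"

section \<open>The ambient space\<close>

text \<open>The round sphere of curvature \<open>\<kappa>\<close> is the sphere of radius \<open>1 / sqrt \<kappa>\<close> in \<open>real^3\<close>, so the
  ambient Riemannian product is a hypersurface of the Euclidean space \<open>real^3 \<times> real\<close> carrying the
  induced metric.\<close>

type_synonym E4 = "(real^3) \<times> real"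

definition ambient :: "real \<Rightarrow> E4 set" where
  "ambient \<kappa> = sphere 0 (1 / sqrt \<kappa>) \<times> UNIV"

definition slice :: "real \<Rightarrow> real \<Rightarrow> E4 set" where
  "slice \<kappa> t = sphere 0 (1 / sqrt \<kappa>) \<times> {t}"

text \<open>For \<open>q \<in> ambient \<kappa>\<close> this is the orthogonal projection onto the tangent space at \<open>q\<close>
  (note that \<open>norm (fst q) ^ 2 = 1 / \<kappa>\<close> there).\<close>

definition tproj :: "real \<Rightarrow> E4 \<Rightarrow> E4 \<Rightarrow> E4" where
  "tproj \<kappa> q v = (fst v - (\<kappa> * (fst q \<bullet> fst v)) *\<^sub>R fst q, snd v)"

text \<open>Levi-Civita connection, Lie bracket and curvature of the ambient space. The vector fields
  live on \<open>E4\<close> and are tangent along the ambient space, at whose points only their values along it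
  matter. The Levi-Civita connection of a submanifold of Euclidean space is the tangential part
  of the directional derivative.\<close>

definition conn :: "real \<Rightarrow> (E4 \<Rightarrow> E4) \<Rightarrow> (E4 \<Rightarrow> E4) \<Rightarrow> E4 \<Rightarrow> E4" where
  "conn \<kappa> V W q = tproj \<kappa> q (frechet_derivative W (at q) (V q))"

definition lie_bracket :: "(E4 \<Rightarrow> E4) \<Rightarrow> (E4 \<Rightarrow> E4) \<Rightarrow> E4 \<Rightarrow> E4" where
  "lie_bracket V W q = frechet_derivative W (at q) (V q) - frechet_derivative V (at q) (W q)"

definition curvature_op ::
    "real \<Rightarrow> (E4 \<Rightarrow> E4) \<Rightarrow> (E4 \<Rightarrow> E4) \<Rightarrow> (E4 \<Rightarrow> E4) \<Rightarrow> E4 \<Rightarrow> E4" where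
  "curvature_op \<kappa> U V W q =
     conn \<kappa> U (conn \<kappa> V W) q - conn \<kappa> V (conn \<kappa> U W) q - conn \<kappa> (lie_bracket U V) W q"

text \<open>By tensoriality tangent vectors may be extended to arbitrary tangent fields; here
  \<open>v\<close> is extended by \<open>\<lambda>x. tproj \<kappa> x v\<close>.\<close>

definition riemann :: "real \<Rightarrow> E4 \<Rightarrow> E4 \<Rightarrow> E4 \<Rightarrow> E4 \<Rightarrow> E4" where
  "riemann \<kappa> q u v w =
     curvature_op \<kappa> (\<lambda>x. tproj \<kappa> x u) (\<lambda>x. tproj \<kappa> x v) (\<lambda>x. tproj \<kappa> x w) q"

text \<open>\<open>Ric(v, w)\<close> is the trace of \<open>u \<mapsto> R(u, v) w\<close> on the tangent space. Since \<open>riemann\<close> takes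
  tangential values and only sees the tangential part of \<open>u\<close>, this trace can be taken
  over an orthonormal basis of \<open>E4\<close>.\<close>

definition ambient_ric :: "real \<Rightarrow> E4 \<Rightarrow> E4 \<Rightarrow> E4 \<Rightarrow> real" where
  "ambient_ric \<kappa> q v w = (\<Sum>b\<in>Basis. riemann \<kappa> q b v w \<bullet> b)"

section \<open>Immersed two-sided surfaces\<close>

definition immersion :: "real \<Rightarrow> 'a topology \<Rightarrow> 'a chart set \<Rightarrow> ('a \<Rightarrow> E4) \<Rightarrow> bool" where
  "immersion \<kappa> X \<A> \<phi> \<longleftrightarrow> \<phi> ` topspace X \<subseteq> ambient \<kappa> \<and> smooth_map \<A> \<phi> \<and>
     (\<forall>c\<in>\<A>. \<forall>x\<in>snd c ` fst c. inj (frechet_derivative (in_chart c \<phi>) (at x)))"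

definition unit_normal_field ::
    "real \<Rightarrow> 'a topology \<Rightarrow> 'a chart set \<Rightarrow> ('a \<Rightarrow> E4) \<Rightarrow> ('a \<Rightarrow> E4) \<Rightarrow> bool" where
  "unit_normal_field \<kappa> X \<A> \<phi> N \<longleftrightarrow> smooth_map \<A> N \<and>
     (\<forall>p\<in>topspace X. norm (N p) = 1 \<and> tproj \<kappa> (\<phi> p) (N p) = N p) \<and>
     (\<forall>c\<in>\<A>. \<forall>p\<in>fst c. \<forall>v. N p \<bullet> frechet_derivative (in_chart c \<phi>) (at (snd c p)) v = 0)"

definition two_sided_surface ::
    "real \<Rightarrow> 'a topology \<Rightarrow> 'a chart set \<Rightarrow> ('a \<Rightarrow> E4) \<Rightarrow> ('a \<Rightarrow> E4) \<Rightarrow> bool" where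
  "two_sided_surface \<kappa> X \<A> \<phi> N \<longleftrightarrow>
     surface X \<A> \<and> immersion \<kappa> X \<A> \<phi> \<and> unit_normal_field \<kappa> X \<A> \<phi> N"

definition metric :: "'a chart \<Rightarrow> ('a \<Rightarrow> E4) \<Rightarrow> real^2 \<Rightarrow> real^2^2" where
  "metric c \<phi> x =
     (\<chi> i j. partial_deriv i (in_chart c \<phi>) x \<bullet> partial_deriv j (in_chart c \<phi>) x)"

text \<open>The shape operator \<open>A v = - \<nabla>\<^sub>v N\<close>, acting on coordinate vectors; tangent vectors of the
  surface are identified with their images under the differential of the immersion.\<close>

definition shape_operator ::
    "real \<Rightarrow> 'a chart \<Rightarrow> ('a \<Rightarrow> E4) \<Rightarrow> ('a \<Rightarrow> E4) \<Rightarrow> real^2 \<Rightarrow> real^2 \<Rightarrow> real^2" where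
  "shape_operator \<kappa> c \<phi> N x v =
     (THE w. frechet_derivative (in_chart c \<phi>) (at x) w =
        - tproj \<kappa> (in_chart c \<phi> x) (frechet_derivative (in_chart c N) (at x) v))"

definition mean_curvature ::
    "real \<Rightarrow> 'a chart set \<Rightarrow> ('a \<Rightarrow> E4) \<Rightarrow> ('a \<Rightarrow> E4) \<Rightarrow> 'a \<Rightarrow> real" where
  "mean_curvature \<kappa> \<A> \<phi> N p =
     (let c = chart_at \<A> p in trace (matrix (shape_operator \<kappa> c \<phi> N (snd c p))) / 2)"

definition constant_mean_curvature ::
    "real \<Rightarrow> 'a topology \<Rightarrow> 'a chart set \<Rightarrow> ('a \<Rightarrow> E4) \<Rightarrow> ('a \<Rightarrow> E4) \<Rightarrow> bool" where
  "constant_mean_curvature \<kappa> X \<A> \<phi> N \<longleftrightarrow> (\<exists>H. \<forall>p\<in>topspace X. mean_curvature \<kappa> \<A> \<phi> N p = H)"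

text \<open>\<open>|A|\<^sup>2 = \<Sum> g\<^sup>i\<^sup>j g(A \<partial>\<^sub>i, A \<partial>\<^sub>j)\<close>, the squared norm with respect to the induced metric.\<close>

definition shape_norm_sq ::
    "real \<Rightarrow> 'a chart set \<Rightarrow> ('a \<Rightarrow> E4) \<Rightarrow> ('a \<Rightarrow> E4) \<Rightarrow> 'a \<Rightarrow> real" where
  "shape_norm_sq \<kappa> \<A> \<phi> N p =
     (let c = chart_at \<A> p; x = snd c p; S = (\<lambda>i. shape_operator \<kappa> c \<phi> N x (axis i 1)) in
      \<Sum>i\<in>UNIV. \<Sum>j\<in>UNIV. matrix_inv (metric c \<phi> x) $ i $ j * (S i \<bullet> (metric c \<phi> x *v S j)))"

text \<open>\<open>\<Delta> f = (det g)\<^sup>-\<^sup>1\<^sup>/\<^sup>2 \<Sum> \<partial>\<^sub>i ((det g)\<^sup>1\<^sup>/\<^sup>2 g\<^sup>i\<^sup>j \<partial>\<^sub>j f)\<close>.\<close>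

definition laplacian :: "'a chart set \<Rightarrow> ('a \<Rightarrow> E4) \<Rightarrow> ('a \<Rightarrow> real) \<Rightarrow> 'a \<Rightarrow> real" where
  "laplacian \<A> \<phi> f p =
     (let c = chart_at \<A> p; x = snd c p in
      (\<Sum>i\<in>UNIV. partial_deriv i (\<lambda>y. sqrt (det (metric c \<phi> y)) *
          (\<Sum>j\<in>UNIV. matrix_inv (metric c \<phi> y) $ i $ j * partial_deriv j (in_chart c f) y)) x)
      / sqrt (det (metric c \<phi> x)))"

definition jacobi_op ::
    "real \<Rightarrow> 'a chart set \<Rightarrow> ('a \<Rightarrow> E4) \<Rightarrow> ('a \<Rightarrow> E4) \<Rightarrow> ('a \<Rightarrow> real) \<Rightarrow> 'a \<Rightarrow> real" where
  "jacobi_op \<kappa> \<A> \<phi> N f p = laplacian \<A> \<phi> f p + shape_norm_sq \<kappa> \<A> \<phi> N p * f p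
     + ambient_ric \<kappa> (\<phi> p) (N p) (N p) * f p"

text \<open>The Riemannian area: the unique Borel measure given by \<open>(det g)\<^sup>1\<^sup>/\<^sup>2 dx\<close> in each chart.\<close>

definition area_measure ::
    "'a topology \<Rightarrow> 'a chart set \<Rightarrow> ('a \<Rightarrow> E4) \<Rightarrow> 'a measure" where
  "area_measure X \<A> \<phi> =
     (THE \<mu>. sets \<mu> = sets (sigma (topspace X) {U. openin X U}) \<and>
        (\<forall>c\<in>\<A>. \<forall>B\<in>sets \<mu>. B \<subseteq> fst c \<longrightarrow>
           emeasure \<mu> B =
             (\<integral>\<^sup>+x. ennreal (sqrt (det (metric c \<phi> x))) * indicator (snd c ` B) x \<partial>lborel)))"

definition strongly_stable ::
    "real \<Rightarrow> 'a topology \<Rightarrow> 'a chart set \<Rightarrow> ('a \<Rightarrow> E4) \<Rightarrow> ('a \<Rightarrow> E4) \<Rightarrow> bool" where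
  "strongly_stable \<kappa> X \<A> \<phi> N \<longleftrightarrow>
     (\<forall>f. smooth_map \<A> f \<longrightarrow>
        - (\<integral>p. f p * jacobi_op \<kappa> \<A> \<phi> N f p \<partial>area_measure X \<A> \<phi>) \<ge> 0)"

end

theory Submission
  imports Defs
begin

text \<open>For a unit normal \<open>N\<close> of the product one has \<open>Ric(N, N) = \<kappa> |N\<^sub>1|\<^sup>2 \<ge> 0\<close>, where \<open>N\<^sub>1\<close> is the
  component tangent to the sphere. Testing strong stability with the constant function \<open>1\<close> gives
  \<open>\<integral> |A|\<^sup>2 + Ric(N, N) \<le> 0\<close>, so \<open>N\<close> is vertical, the height is constant, and the image of the
  compact surface is open and closed in a slice. Conversely, over a slice \<open>N\<close> is vertical and parallel,
  so the Jacobi operator is the Laplacian and stability is \<open>- \<integral> f \<Delta>f = \<integral> |\<nabla>f|\<^sup>2 \<ge> 0\<close>.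

  Green's formula is obtained in a single chart, for \<open>C\<^sup>1\<close> test functions with compact support, from
  the fact that the integral of a partial derivative vanishes. Since the Dirichlet form and the area
  measure do not depend on the chart, this weak formula also yields the chart independence of the
  Laplacian without any computation with second derivatives of transition maps.\<close>

section \<open>Calculus of \<open>C\<^sup>n\<close> maps\<close>

text \<open>Two definitions make regularity the obstacle. \<open>laplacian\<close> is evaluated at
  each point in the chart picked by \<open>chart_at\<close>, so nothing is known a priori about its
  dependence on the point, not even measurability, and a Bochner integral of a non-integrable
  function is 0; chart independence has to come before integrals of it can be split.
  \<open>area_measure\<close> is a definite description, so existence and uniqueness come before any
  statement about its values. In the weak formula the test function is differentiated only once,
  hence C^1 bumps built from \<open>(max 0 t)\<^sup>2\<close> suffice, and the calculus is organised
  by the finite order n. The image of the surface is compared with a slice only as a set, so it is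
  enough that the immersion is open onto the slice near each point; this comes from coning the
  surface into R^3 and an open mapping theorem at a single point. The stereographic atlas turns the
  slices themselves into instances of the theory, since the surfaces of the equivalence live on an
  arbitrary type \<open>'a\<close>.\<close>

lemma frechet_derivative_eq:
  "(f has_derivative f') (at x) \<Longrightarrow> frechet_derivative f (at x) = f'"
  by (metis frechet_derivative_at)

lemma differentiable_has_frechet:
  "f differentiable (at x) \<Longrightarrow> (f has_derivative frechet_derivative f (at x)) (at x)"
  using frechet_derivative_works by blast

text \<open>The two functions have the same derivatives at x, so the choice operator is applied to
  one and the same predicate; this also covers points where no derivative exists.\<close>

lemma frechet_derivative_cong:
  assumes "open S" "x \<in> S" "\<And>y. y \<in> S \<Longrightarrow> f y = g y"
  shows "frechet_derivative f (at x) = frechet_derivative g (at x)"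
proof -
  have "(f has_derivative D) (at x) = (g has_derivative D) (at x)" for D
    using assms has_derivative_transform_within_open[of f D x UNIV S g]
      has_derivative_transform_within_open[of g D x UNIV S f] by auto
  then show ?thesis unfolding frechet_derivative_def by simp
qed

lemma Ck_on_cong:
  assumes "open S" "\<And>x. x \<in> S \<Longrightarrow> f x = g x"
  shows "Ck_on n S f \<longleftrightarrow> Ck_on n S g"
  using assms(2)
proof (induction n arbitrary: f g)
  case 0
  then show ?case by (simp cong: continuous_on_cong)
next
  case (Suc n)
  have "f differentiable (at x) \<longleftrightarrow> g differentiable (at x)" if "x \<in> S" for x
  proof -
    have "(f has_derivative D) (at x) \<longleftrightarrow> (g has_derivative D) (at x)" for D
      using Suc.prems that assms(1) has_derivative_transform_within_open[of f D x UNIV S g]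
        has_derivative_transform_within_open[of g D x UNIV S f] by auto
    then show ?thesis unfolding differentiable_def by simp
  qed
  moreover have "Ck_on n S (\<lambda>x. frechet_derivative f (at x) v) \<longleftrightarrow>
      Ck_on n S (\<lambda>x. frechet_derivative g (at x) v)" for v
    using Suc.prems by (intro Suc.IH) (metis frechet_derivative_cong[OF assms(1)])
  ultimately show ?case by simp
qed

text \<open>\<open>Ck_on\<close> refers to the chosen \<open>frechet_derivative\<close>; on an open
  set an explicit formula may take its place. Most inductions below run through this rule, with a
  formula that is again built from C^n pieces.\<close>

lemma Ck_on_SucI:
  assumes "open S" "\<And>x. x \<in> S \<Longrightarrow> (f has_derivative f' x) (at x)" "\<And>v. Ck_on n S (\<lambda>x. f' x v)"
  shows "Ck_on (Suc n) S f"
proof -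
  have "Ck_on n S (\<lambda>x. frechet_derivative f (at x) v)" for v
    using assms(3)[of v] Ck_on_cong[OF assms(1), of "\<lambda>x. frechet_derivative f (at x) v" "\<lambda>x. f' x v" n]
      frechet_derivative_eq[OF assms(2)] by simp
  then show ?thesis using assms(2) by (auto simp: differentiable_def)
qed

lemma Ck_on_Suc_imp: "Ck_on (Suc n) S f \<Longrightarrow> Ck_on n S f"
proof (induction n arbitrary: f)
  case 0
  then show ?case
    by (auto intro!: continuous_at_imp_continuous_on differentiable_imp_continuous_within)
next
  case (Suc n)
  show ?case
    unfolding Ck_on.simps(2)[of n]
  proof (intro conjI ballI allI)
    show "f differentiable (at x)" if "x \<in> S" for x using Suc.prems that by simp
    show "Ck_on n S (\<lambda>x. frechet_derivative f (at x) v)" for v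
      using Suc.prems unfolding Ck_on.simps(2)[of "Suc n"] by (intro Suc.IH) blast
  qed
qed

lemma Ck_on_mono: "Ck_on n S f \<Longrightarrow> m \<le> n \<Longrightarrow> Ck_on m S f"
proof (induction n)
  case (Suc n)
  then show ?case using Ck_on_Suc_imp le_Suc_eq by blast
qed simp

lemma Ck_on_subset: "Ck_on n S f \<Longrightarrow> T \<subseteq> S \<Longrightarrow> Ck_on n T f"
  by (induction n arbitrary: f) (auto intro: continuous_on_subset)

lemma Ck_on_imp_continuous_on: "Ck_on n S f \<Longrightarrow> continuous_on S f"
  using Ck_on_mono[of n S f 0] by simp

lemma Ck_on_Suc_has_derivative:
  "Ck_on (Suc n) S f \<Longrightarrow> x \<in> S \<Longrightarrow> (f has_derivative frechet_derivative f (at x)) (at x)"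
  by (simp add: differentiable_has_frechet)

lemma Ck_on_const: "Ck_on n S (\<lambda>x. c)"
proof (induction n arbitrary: c)
  case (Suc n)
  have "frechet_derivative (\<lambda>x::'a. c) (at x) = (\<lambda>v. 0)" for x
    by (rule frechet_derivative_eq) auto
  then show ?case using Suc by simp
qed simp

lemma Ck_on_linear:
  assumes "bounded_linear f"
  shows "Ck_on n S f"
proof (cases n)
  case 0
  then show ?thesis using assms by (simp add: linear_continuous_on)
next
  case (Suc m)
  have d: "(f has_derivative f) (at x)" for x
    using assms bounded_linear_imp_has_derivative by blast
  show ?thesis
    unfolding Suc Ck_on.simps(2) frechet_derivative_eq[OF d] using d Ck_on_const by (auto simp: differentiable_def)
qed

lemma Ck_on_add:
  assumes "open S" "Ck_on n S f" "Ck_on n S g"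
  shows "Ck_on n S (\<lambda>x. f x + g x)"
  using assms(2,3)
proof (induction n arbitrary: f g)
  case 0
  then show ?case by (simp add: continuous_on_add)
next
  case (Suc n)
  show ?case
    by (rule Ck_on_SucI[OF assms(1), where f'="\<lambda>x v. frechet_derivative f (at x) v + frechet_derivative g (at x) v"])
       (use Suc in \<open>auto intro!: has_derivative_add Ck_on_Suc_has_derivative\<close>)
qed

lemma Ck_on_sum:
  assumes "open S" "\<And>i. i \<in> I \<Longrightarrow> Ck_on n S (f i)"
  shows "Ck_on n S (\<lambda>x. \<Sum>i\<in>I. f i x)"
proof (cases "finite I")
  case True
  then show ?thesis using assms(2)
    by (induction I rule: finite_induct) (auto intro: Ck_on_const Ck_on_add[OF assms(1)])
qed (simp add: Ck_on_const)

text \<open>Leibniz' rule turns the derivative into a sum of two products of the same kind, one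
  factor being a derivative of order n and the other lowered by \<open>Ck_on_Suc_imp\<close>; hence
  the induction over arbitrary f and g. Multiplication, scaling and inner product are
  instances.\<close>

lemma (in bounded_bilinear) Ck_on:
  assumes "open S" "Ck_on n S f" "Ck_on n S g"
  shows "Ck_on n S (\<lambda>x. prod (f x) (g x))"
  using assms(2,3)
proof (induction n arbitrary: f g)
  case 0
  then show ?case by (simp add: continuous_on)
next
  case (Suc n)
  show ?case
  proof (rule Ck_on_SucI[OF assms(1)])
    show "((\<lambda>x. prod (f x) (g x)) has_derivative
        (\<lambda>v. prod (f x) (frechet_derivative g (at x) v) + prod (frechet_derivative f (at x) v) (g x))) (at x)"
      if "x \<in> S" for x
      using Suc.prems that by (intro FDERIV Ck_on_Suc_has_derivative)
    show "Ck_on n S (\<lambda>x. prod (f x) (frechet_derivative g (at x) v)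
        + prod (frechet_derivative f (at x) v) (g x))" for v
      using Suc.prems by (intro Ck_on_add[OF assms(1)] Suc.IH Ck_on_Suc_imp[OF Suc.prems(1)] Ck_on_Suc_imp[OF Suc.prems(2)]) simp_all
  qed
qed

lemmas Ck_on_mult = bounded_bilinear.Ck_on[OF bounded_bilinear_mult]
lemmas Ck_on_scaleR = bounded_bilinear.Ck_on[OF bounded_bilinear_scaleR]
lemmas Ck_on_inner = bounded_bilinear.Ck_on[OF bounded_bilinear_inner]

lemma Ck_on_compose:
  fixes f :: "'a::real_normed_vector \<Rightarrow> 'b::euclidean_space"
  assumes "open S" "open T" "f ` S \<subseteq> T" "Ck_on n S f" "Ck_on n T g"
  shows "Ck_on n S (\<lambda>x. g (f x))"
  using assms(4,5)
proof (induction n arbitrary: g)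
  case 0
  then show ?case using assms(3) continuous_on_compose2[of T g S f] by simp
next
  case (Suc n)
  let ?Df = "\<lambda>x. frechet_derivative f (at x)" and ?Dg = "\<lambda>y. frechet_derivative g (at y)"
  have Dg: "(g has_derivative ?Dg y) (at y)" if "y \<in> T" for y
    using Ck_on_Suc_has_derivative[OF Suc.prems(2) that] .
  show ?case
  proof (rule Ck_on_SucI[OF assms(1)])
    \<comment> \<open>\<open>Ck_on\<close> controls y \<mapsto> Dg(y) w only for a fixed direction
      w, whereas the chain rule feeds in the moving direction Df(x) v. Expanding that direction in
      \<open>Basis\<close> leaves fixed directions with scalar coefficients.\<close>
    show "((\<lambda>x. g (f x)) has_derivative (\<lambda>v. \<Sum>b\<in>Basis. (?Df x v \<bullet> b) *\<^sub>R ?Dg (f x) b)) (at x)"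
      if "x \<in> S" for x
    proof -
      have d: "(g has_derivative ?Dg (f x)) (at (f x))" using Dg that assms(3) by blast
      have "(\<lambda>v. ?Dg (f x) (?Df x v)) = (\<lambda>v. \<Sum>b\<in>Basis. (?Df x v \<bullet> b) *\<^sub>R ?Dg (f x) b)"
      proof
        fix v
        have lin: "linear (?Dg (f x))" by (rule has_derivative_linear[OF d])
        have "?Dg (f x) (\<Sum>b\<in>Basis. (?Df x v \<bullet> b) *\<^sub>R b) = (\<Sum>b\<in>Basis. (?Df x v \<bullet> b) *\<^sub>R ?Dg (f x) b)"
          unfolding linear_sum[OF lin] linear_scale[OF lin] ..
        then show "?Dg (f x) (?Df x v) = (\<Sum>b\<in>Basis. (?Df x v \<bullet> b) *\<^sub>R ?Dg (f x) b)"
          by (simp add: euclidean_representation)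
      qed
      then show ?thesis
        using diff_chain_at[OF Ck_on_Suc_has_derivative[OF Suc.prems(1) that] d] by (simp only: o_def)
    qed
    show "Ck_on n S (\<lambda>x. \<Sum>b\<in>Basis. (?Df x v \<bullet> b) *\<^sub>R ?Dg (f x) b)" for v
    proof (rule Ck_on_sum[OF assms(1)], rule Ck_on_scaleR[OF assms(1)], rule Ck_on_inner[OF assms(1)])
      show "Ck_on n S (\<lambda>x. b)" for b :: 'b by (rule Ck_on_const)
      show "Ck_on n S (\<lambda>x. ?Df x v)" using Suc.prems(1) by simp
      show "Ck_on n S (\<lambda>x. ?Dg (f x) b)" for b
        using Suc.prems(2) by (intro Suc.IH[of "\<lambda>y. ?Dg y b", OF Ck_on_Suc_imp[OF Suc.prems(1)]]) simp
    qed
  qed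
qed

lemma Ck_on_linear_compose:
  fixes f :: "'a::real_normed_vector \<Rightarrow> 'b::euclidean_space"
  assumes "bounded_linear L" "open S" "Ck_on n S f"
  shows "Ck_on n S (\<lambda>x. L (f x))"
  by (rule Ck_on_compose[OF assms(2) open_UNIV subset_UNIV assms(3) Ck_on_linear[OF assms(1)]])

lemma Ck_on_diff:
  fixes f g :: "'a::real_normed_vector \<Rightarrow> 'b::euclidean_space"
  assumes "open S" "Ck_on n S f" "Ck_on n S g"
  shows "Ck_on n S (\<lambda>x. f x - g x)"
  using Ck_on_add[OF assms(1,2) Ck_on_linear_compose[OF bounded_linear_minus[OF bounded_linear_ident] assms(1,3)]]
  by simp

text \<open>The derivative of 1/f is a polynomial in 1/f and Df, so order n of 1/f itself gives
  order n + 1. The factor \<open>-1\<close> stands for negation so that the product rule covers it.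
  The same bootstrap handles \<open>sqrt\<close> below.\<close>

lemma Ck_on_inverse:
  fixes f :: "'a::real_normed_vector \<Rightarrow> real"
  assumes "open S" "Ck_on n S f" "\<And>x. x \<in> S \<Longrightarrow> f x \<noteq> 0"
  shows "Ck_on n S (\<lambda>x. inverse (f x))"
  using assms(2)
proof (induction n)
  case 0
  then show ?case using assms(3) by (simp add: continuous_on_inverse)
next
  case (Suc n)
  have IH: "Ck_on n S (\<lambda>x. inverse (f x))" using Suc Ck_on_Suc_imp by blast
  show ?case
  proof (rule Ck_on_SucI[OF assms(1)])
    show "((\<lambda>x. inverse (f x)) has_derivative
       (\<lambda>v. (-1) * (inverse (f x) * frechet_derivative f (at x) v * inverse (f x)))) (at x)" if "x \<in> S" for x
      using Deriv.has_derivative_inverse[OF assms(3)[OF that] Ck_on_Suc_has_derivative[OF Suc.prems that]] by simp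
    show "Ck_on n S (\<lambda>x. (-1) * (inverse (f x) * frechet_derivative f (at x) v * inverse (f x)))" for v
      using Suc.prems by (intro Ck_on_mult[OF assms(1)] IH Ck_on_const) simp
  qed
qed

lemma Ck_on_sqrt:
  fixes f :: "'a::real_normed_vector \<Rightarrow> real"
  assumes "open S" "Ck_on n S f" "\<And>x. x \<in> S \<Longrightarrow> f x > 0"
  shows "Ck_on n S (\<lambda>x. sqrt (f x))"
  using assms(2)
proof (induction n)
  case 0
  then show ?case by (simp add: continuous_on_real_sqrt)
next
  case (Suc n)
  have IH: "Ck_on n S (\<lambda>x. sqrt (f x))" using Suc Ck_on_Suc_imp by blast
  show ?case
  proof (rule Ck_on_SucI[OF assms(1)])
    show "((\<lambda>x. sqrt (f x)) has_derivative
       (\<lambda>v. frechet_derivative f (at x) v * ((1/2) * inverse (sqrt (f x))))) (at x)" if "x \<in> S" for x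
      using has_derivative_real_sqrt[OF assms(3)[OF that] Ck_on_Suc_has_derivative[OF Suc.prems that]]
      by (simp add: field_simps)
    show "Ck_on n S (\<lambda>x. frechet_derivative f (at x) v * ((1/2) * inverse (sqrt (f x))))" for v
      using Suc.prems assms(3) by (intro Ck_on_mult[OF assms(1)] Ck_on_inverse[OF assms(1)] IH Ck_on_const) (auto dest: less_imp_neq[symmetric])
  qed
qed

lemma Ck_on_Un:
  assumes "Ck_on n S f" "Ck_on n T f" "open S" "open T"
  shows "Ck_on n (S \<union> T) f"
  using assms(1,2)
proof (induction n arbitrary: f)
  case 0
  then show ?case using continuous_on_open_Un[OF assms(3,4)] by simp
next
  case (Suc n)
  then show ?case by (simp add: ball_Un)
qed

lemma smooth_onD: "smooth_on S f \<Longrightarrow> Ck_on n S f"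
  by (simp add: smooth_on_def)

section \<open>Charts\<close>

lemma chart_openin: "is_chart X c \<Longrightarrow> openin X (fst c)"
  and chart_open: "is_chart X c \<Longrightarrow> open (snd c ` fst c)"
  by (simp_all add: is_chart_def)

lemma chart_topspace:
  assumes "is_chart X c"
  shows "topspace (subtopology X (fst c)) = fst c"
  using openin_subset[OF chart_openin[OF assms]] by auto

lemma chart_homeo:
  "is_chart X c \<Longrightarrow> homeomorphic_map (subtopology X (fst c)) (top_of_set (snd c ` fst c)) (snd c)"
  by (simp add: is_chart_def)

lemma chart_inj: "is_chart X c \<Longrightarrow> inj_on (snd c) (fst c)"
  using homeomorphic_imp_injective_map[OF chart_homeo] chart_topspace by metis

lemma chart_inv [simp]: "is_chart X c \<Longrightarrow> p \<in> fst c \<Longrightarrow> inv_into (fst c) (snd c) (snd c p) = p"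
  by (simp add: chart_inj)

lemma in_chart_apply: "is_chart X c \<Longrightarrow> p \<in> fst c \<Longrightarrow> in_chart c f (snd c p) = f p"
  by (simp add: in_chart_def)

lemma in_chart_image:
  assumes "is_chart X c" "V \<subseteq> fst c"
  shows "in_chart c f ` snd c ` V = f ` V"
  unfolding image_image using assms by (intro image_cong) (auto simp: in_chart_apply)

lemma chart_continuous_inv:
  assumes "is_chart X c"
  shows "continuous_map (top_of_set (snd c ` fst c)) X (inv_into (fst c) (snd c))"
proof -
  obtain g where g: "homeomorphic_maps (subtopology X (fst c)) (top_of_set (snd c ` fst c)) (snd c) g"
    using chart_homeo[OF assms] homeomorphic_map_maps by blast
  then have "continuous_map (top_of_set (snd c ` fst c)) X g"
    by (simp add: homeomorphic_maps_def continuous_map_in_subtopology)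
  moreover have "g x = inv_into (fst c) (snd c) x" if "x \<in> snd c ` fst c" for x
    using that g chart_topspace[OF assms] chart_inj[OF assms]
    by (auto simp: homeomorphic_maps_def)
  ultimately show ?thesis
    by (rule continuous_map_eq) simp
qed

lemma chart_open_image:
  assumes "is_chart X c" "openin X V" "V \<subseteq> fst c"
  shows "open (snd c ` V)"
proof -
  have "openin (subtopology X (fst c)) V"
    using assms by (simp add: openin_open_subtopology[OF chart_openin])
  then have "openin (top_of_set (snd c ` fst c)) (snd c ` V)"
    using homeomorphic_imp_open_map[OF chart_homeo[OF assms(1)]] by (simp add: open_map_def)
  then show ?thesis using openin_open_trans chart_open[OF assms(1)] by blast
qed

lemma chart_openin_preimage:
  assumes "is_chart X c" "open S"
  shows "openin X {p \<in> fst c. snd c p \<in> S}"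
proof -
  have "openin (subtopology X (fst c)) {p \<in> topspace (subtopology X (fst c)). snd c p \<in> S}"
    using homeomorphic_imp_continuous_map[OF chart_homeo[OF assms(1)]] assms(2)
    by (intro openin_continuous_map_preimage[where Y=euclidean]) (auto simp: continuous_map_in_subtopology)
  then show ?thesis
    unfolding chart_topspace[OF assms(1)] openin_open_subtopology[OF chart_openin[OF assms(1)]] by blast
qed

lemma chart_compactin:
  assumes "is_chart X c" "compact K" "K \<subseteq> snd c ` fst c"
  shows "compactin X {p \<in> fst c. snd c p \<in> K}"
proof -
  have "compactin X (inv_into (fst c) (snd c) ` K)"
    using assms by (intro image_compactin[OF _ chart_continuous_inv]) (auto simp: compactin_subtopology)
  moreover have "inv_into (fst c) (snd c) ` K = {p \<in> fst c. snd c p \<in> K}"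
  proof (intro equalityI subsetI)
    fix p assume "p \<in> inv_into (fst c) (snd c) ` K"
    then obtain x where "x \<in> K" "p = inv_into (fst c) (snd c) x" by blast
    then show "p \<in> {p \<in> fst c. snd c p \<in> K}"
      using assms(3) by (auto simp: f_inv_into_f inv_into_into subset_iff)
  next
    fix p assume "p \<in> {p \<in> fst c. snd c p \<in> K}"
    then show "p \<in> inv_into (fst c) (snd c) ` K"
      using chart_inv[OF assms(1), of p] image_eqI[of p "inv_into (fst c) (snd c)" "snd c p" K] by simp
  qed
  ultimately show ?thesis by simp
qed

lemma in_chart_continuous_on:
  assumes "is_chart X c" "continuous_map X euclidean h"
  shows "continuous_on (snd c ` fst c) (in_chart c h)"
  using continuous_map_compose[OF chart_continuous_inv[OF assms(1)] assms(2)]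
  by (simp add: in_chart_def)

section \<open>Differentials and finite differentiability on an atlas\<close>

definition dmap :: "'a chart \<Rightarrow> ('a \<Rightarrow> 'b::real_normed_vector) \<Rightarrow> 'a \<Rightarrow> real^2 \<Rightarrow> 'b" where
  "dmap c f p = frechet_derivative (in_chart c f) (at (snd c p))"

text \<open>Finite order alongside \<open>smooth_map\<close>: the bumps and partitions of unity
  constructed below are only C^1.\<close>

definition Ck_map :: "nat \<Rightarrow> 'a chart set \<Rightarrow> ('a \<Rightarrow> 'b::real_normed_vector) \<Rightarrow> bool" where
  "Ck_map n \<A> f \<longleftrightarrow> (\<forall>c\<in>\<A>. Ck_on n (snd c ` fst c) (in_chart c f))"

lemma smooth_map_imp_Ck_map: "smooth_map \<A> f \<Longrightarrow> Ck_map n \<A> f"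
  by (simp add: smooth_map_def Ck_map_def smooth_onD)

lemma Ck_map_mono: "Ck_map n \<A> f \<Longrightarrow> m \<le> n \<Longrightarrow> Ck_map m \<A> f"
  unfolding Ck_map_def by (blast dest: Ck_on_mono[of n _ _ m])

locale atlas =
  fixes X :: "'a topology" and \<A> :: "'a chart set"
  assumes smooth_atlas: "smooth_atlas X \<A>"
begin

lemma chart: "c \<in> \<A> \<Longrightarrow> is_chart X c"
  using smooth_atlas by (simp add: smooth_atlas_def)

lemma chart_subset: "c \<in> \<A> \<Longrightarrow> fst c \<subseteq> topspace X"
  using openin_subset chart_openin[OF chart] by blast

lemma chart_exists: "p \<in> topspace X \<Longrightarrow> \<exists>c\<in>\<A>. p \<in> fst c"
proof -
  assume "p \<in> topspace X"
  moreover have "\<Union>(fst ` \<A>) = topspace X" using smooth_atlas by (simp add: smooth_atlas_def)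
  ultimately show ?thesis by blast
qed

lemma chart_at: "p \<in> topspace X \<Longrightarrow> chart_at \<A> p \<in> \<A> \<and> p \<in> fst (chart_at \<A> p)"
  unfolding chart_at_def using chart_exists[of p] someI_ex[of "\<lambda>c. c \<in> \<A> \<and> p \<in> fst c"] by blast

lemma Ck_transition:
  "c \<in> \<A> \<Longrightarrow> d \<in> \<A> \<Longrightarrow> Ck_on n (snd c ` (fst c \<inter> fst d)) (in_chart c (snd d))"
  using smooth_atlas by (simp add: smooth_atlas_def smooth_onD)

lemma open_overlap: "c \<in> \<A> \<Longrightarrow> d \<in> \<A> \<Longrightarrow> open (snd c ` (fst c \<inter> fst d))"
  by (intro chart_open_image[OF chart] openin_Int chart_openin[OF chart]) auto

lemma in_chart_transition:
  assumes "c \<in> \<A>" "d \<in> \<A>" "x \<in> snd c ` (fst c \<inter> fst d)"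
  shows "in_chart d f (in_chart c (snd d) x) = in_chart c f x"
  using assms by (auto simp: in_chart_def chart_inv[OF chart])

lemma continuous_mapI:
  assumes "\<And>c. c \<in> \<A> \<Longrightarrow> continuous_on (snd c ` fst c) (in_chart c h)"
  shows "continuous_map X euclidean h"
  unfolding continuous_map_alt
proof (intro conjI allI impI)
  fix S :: "'b set" assume "openin euclidean S"
  then have S: "open S" by simp
  define V where "V c = {p \<in> fst c. snd c p \<in> in_chart c h -` S \<inter> snd c ` fst c}" for c :: "'a chart"
  have "openin X (V c)" if "c \<in> \<A>" for c
  proof -
    have "open (in_chart c h -` S \<inter> snd c ` fst c)"
      using continuous_on_open_vimage[OF chart_open[OF chart[OF that]]] assms[OF that] S by blast
    then show ?thesis unfolding V_def by (rule chart_openin_preimage[OF chart[OF that]])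
  qed
  then have "openin X (\<Union>c\<in>\<A>. V c)" by blast
  moreover have "p \<in> V c \<longleftrightarrow> p \<in> fst c \<and> h p \<in> S" if "c \<in> \<A>" for c p
  proof (cases "p \<in> fst c")
    case True
    then have "snd c p \<in> snd c ` fst c" by (rule imageI)
    then show ?thesis using True by (simp add: V_def in_chart_apply[OF chart[OF that]])
  qed (simp add: V_def)
  then have "(\<Union>c\<in>\<A>. V c) = (\<Union>c\<in>\<A>. fst c) \<inter> h -` S" by auto
  moreover have "(\<Union>c\<in>\<A>. fst c) = topspace X"
    using smooth_atlas by (simp add: smooth_atlas_def)
  ultimately show "openin X (h -` S \<inter> topspace X)" by (simp add: Int_commute)
qed simp

lemma Ck_map_continuous: "Ck_map n \<A> f \<Longrightarrow> continuous_map X euclidean f"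
  by (auto intro!: continuous_mapI Ck_on_imp_continuous_on simp: Ck_map_def)

lemma Ck_map_has_derivative:
  assumes "Ck_map (Suc n) \<A> f" "c \<in> \<A>" "p \<in> fst c"
  shows "(in_chart c f has_derivative dmap c f p) (at (snd c p))"
  using assms unfolding dmap_def by (intro Ck_on_Suc_has_derivative[of n "snd c ` fst c"]) (auto simp: Ck_map_def simp del: Ck_on.simps)

lemma dmap_self:
  assumes "c \<in> \<A>" "p \<in> fst c"
  shows "dmap c (snd c) p = id"
proof -
  have "dmap c (snd c) p = frechet_derivative (\<lambda>x. x) (at (snd c p))"
    unfolding dmap_def
    using assms in_chart_apply[OF chart[OF assms(1)], of _ "snd c"]
    by (intro frechet_derivative_cong[OF chart_open[OF chart[OF assms(1)]]]) auto
  then show ?thesis by (simp add: frechet_derivative_eq[OF has_derivative_ident] id_def)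
qed

lemma transition_has_derivative:
  assumes "c \<in> \<A>" "d \<in> \<A>" "p \<in> fst c" "p \<in> fst d"
  shows "(in_chart c (snd d) has_derivative dmap c (snd d) p) (at (snd c p))"
  using Ck_on_Suc_has_derivative[OF Ck_transition[OF assms(1,2), of "Suc 0"]] assms(3,4)
  by (auto simp: dmap_def)

lemma has_derivative_change_chart:
  assumes cd: "c \<in> \<A>" "d \<in> \<A>" "p \<in> fst c" "p \<in> fst d"
    and f: "(in_chart d f has_derivative D) (at (snd d p))"
  shows "(in_chart c f has_derivative D \<circ> dmap c (snd d) p) (at (snd c p))"
proof (rule has_derivative_transform_within_open[OF _ open_overlap[OF cd(1,2)]])
  have "in_chart c (snd d) (snd c p) = snd d p" using cd by (simp add: in_chart_apply[OF chart])
  then show "(in_chart d f \<circ> in_chart c (snd d) has_derivative D \<circ> dmap c (snd d) p) (at (snd c p))"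
    using diff_chain_at[OF transition_has_derivative[OF cd]] f by simp
qed (use cd in \<open>auto simp: in_chart_transition\<close>)

lemma dmap_change_chart:
  assumes "c \<in> \<A>" "d \<in> \<A>" "p \<in> fst c" "p \<in> fst d" "Ck_map (Suc n) \<A> f"
  shows "dmap c f p = dmap d f p \<circ> dmap c (snd d) p"
  using has_derivative_change_chart[OF assms(1-4) Ck_map_has_derivative[OF assms(5,2,4)]]
  by (simp add: dmap_def frechet_derivative_eq)

text \<open>The chain rule of \<open>has_derivative_change_chart\<close>, applied to the coordinate
  map of \<open>c\<close> itself.\<close>

lemma dmap_transition_inverse:
  assumes "c \<in> \<A>" "d \<in> \<A>" "p \<in> fst c" "p \<in> fst d"
  shows "dmap d (snd c) p \<circ> dmap c (snd d) p = id"
  using has_derivative_change_chart[OF assms transition_has_derivative[OF assms(2,1,4,3)]]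
  by (metis dmap_self[OF assms(1,3)] dmap_def frechet_derivative_eq)

lemma linear_transition:
  assumes "c \<in> \<A>" "d \<in> \<A>" "p \<in> fst c" "p \<in> fst d"
  shows "linear (dmap c (snd d) p)"
  by (rule has_derivative_linear[OF transition_has_derivative[OF assms]])

lemma inj_transition:
  assumes "c \<in> \<A>" "d \<in> \<A>" "p \<in> fst c" "p \<in> fst d"
  shows "inj (dmap c (snd d) p)"
  by (rule inj_on_imageI2[of "dmap d (snd c) p"]) (simp add: dmap_transition_inverse[OF assms])

text \<open>This makes functions built in one chart global. The domain of any other chart d is the
  union of two open sets: the overlap with c, where u is C^n through the transition map, and the
  complement of K, where u vanishes.\<close>

lemma Ck_map_zero_extension:
  assumes c: "c \<in> \<A>" and u: "Ck_on n (snd c ` fst c) (in_chart c u)"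
    and K: "closedin X K" "K \<subseteq> fst c" "\<And>p. p \<in> topspace X - K \<Longrightarrow> u p = 0"
  shows "Ck_map n \<A> u"
  unfolding Ck_map_def
proof
  fix d assume d: "d \<in> \<A>"
  let ?S = "snd d ` (fst d \<inter> fst c)" and ?T = "snd d ` (fst d - K)"
  have S: "open ?S" by (rule open_overlap[OF d c])
  have T: "open ?T"
    using chart_openin[OF chart[OF d]] K(1) by (intro chart_open_image[OF chart[OF d]] openin_diff) auto
  have "Ck_on n ?S (\<lambda>x. in_chart c u (in_chart d (snd c) x))"
  proof (rule Ck_on_compose[OF S chart_open[OF chart[OF c]]])
    show "in_chart d (snd c) ` ?S \<subseteq> snd c ` fst c"
      using in_chart_image[OF chart[OF d], of "fst d \<inter> fst c" "snd c"] by auto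
  qed (use u Ck_transition[OF d c] in auto)
  then have "Ck_on n ?S (in_chart d u)"
    by (rule Ck_on_cong[OF S, THEN iffD1, rotated]) (rule in_chart_transition[OF d c])
  moreover have "Ck_on n ?T (in_chart d u)"
  proof -
    have "in_chart d u x = 0" if "x \<in> ?T" for x
      using that K(3) chart_subset[OF d] by (auto simp: in_chart_apply[OF chart[OF d]])
    then show ?thesis using Ck_on_cong[OF T, of "in_chart d u" "\<lambda>x. 0" n] by (simp add: Ck_on_const)
  qed
  ultimately have "Ck_on n (?S \<union> ?T) (in_chart d u)"
    by (rule Ck_on_Un) (rule S T)+
  moreover have "?S \<union> ?T = snd d ` fst d" using K(2) by auto
  ultimately show "Ck_on n (snd d ` fst d) (in_chart d u)" by simp
qed

end

section \<open>Traces with respect to a Gram matrix\<close>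

text \<open>For \<Phi> the differential of the immersion in a chart this is det g. Working with
  linear maps \<Phi> reduces every change of chart to composition with a linear map of the
  plane.\<close>

definition gram_det :: "(real^2 \<Rightarrow> 'e::real_inner) \<Rightarrow> real" where
  "gram_det \<Phi> = (\<Phi> (axis 1 1) \<bullet> \<Phi> (axis 1 1)) * (\<Phi> (axis 2 1) \<bullet> \<Phi> (axis 2 1)) - (\<Phi> (axis 1 1) \<bullet> \<Phi> (axis 2 1))\<^sup>2"

text \<open>This is \<open>\<Sum> g\<^sup>i\<^sup>j \<langle>\<alpha> \<partial>\<^sub>i, \<beta> \<partial>\<^sub>j\<rangle>\<close> for the metric \<open>g\<close> pulled back by \<open>\<Phi>\<close>.\<close>

definition gram_trace ::
    "(real^2 \<Rightarrow> 'e::real_inner) \<Rightarrow> (real^2 \<Rightarrow> 'b::real_inner) \<Rightarrow> (real^2 \<Rightarrow> 'b) \<Rightarrow> real" where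
  "gram_trace \<Phi> \<alpha> \<beta> =
    ((\<Phi> (axis 2 1) \<bullet> \<Phi> (axis 2 1)) * (\<alpha> (axis 1 1) \<bullet> \<beta> (axis 1 1))
     - (\<Phi> (axis 1 1) \<bullet> \<Phi> (axis 2 1)) * (\<alpha> (axis 1 1) \<bullet> \<beta> (axis 2 1) + \<alpha> (axis 2 1) \<bullet> \<beta> (axis 1 1))
     + (\<Phi> (axis 1 1) \<bullet> \<Phi> (axis 1 1)) * (\<alpha> (axis 2 1) \<bullet> \<beta> (axis 2 1))) / gram_det \<Phi>"

lemma linear_real2:
  fixes L :: "real^2 \<Rightarrow> 'e::real_vector"
  assumes "linear L"
  shows "L v = (v$1) *\<^sub>R L (axis 1 1) + (v$2) *\<^sub>R L (axis 2 1)"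
proof -
  have "v = (v$1) *\<^sub>R axis 1 1 + (v$2) *\<^sub>R axis 2 1"
    by (simp add: vec_eq_iff forall_2 axis_def)
  then have "L v = L ((v$1) *\<^sub>R axis 1 1 + (v$2) *\<^sub>R axis 2 1)" by simp
  then show ?thesis by (simp only: linear_add[OF assms] linear_scale[OF assms])
qed

lemma gram_det_pos:
  assumes "linear \<Phi>" "inj \<Phi>"
  shows "gram_det \<Phi> > 0"
proof -
  define a b where "a = \<Phi> (axis 1 1)" and "b = \<Phi> (axis 2 1)"
  have nz: "\<Phi> v \<noteq> 0" if "v \<noteq> 0" for v
    using that assms linear_injective_0 by blast
  have b: "b \<bullet> b > 0" using nz[of "axis 2 1"] by (simp add: b_def axis_eq_0_iff)
  \<comment> \<open>\<Phi> v is b . b times the component of a orthogonal to b, so |\<Phi> v|^2 is b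
    . b times the Gram determinant.\<close>
  define v :: "real^2" where "v = (b \<bullet> b) *\<^sub>R axis 1 1 - (a \<bullet> b) *\<^sub>R axis 2 1"
  have "v $ 1 = b \<bullet> b" by (simp add: v_def axis_def)
  then have "v \<noteq> 0" using b by (metis less_irrefl zero_index)
  then have "\<Phi> v \<bullet> \<Phi> v > 0" using nz by simp
  moreover have "\<Phi> v = (b \<bullet> b) *\<^sub>R a - (a \<bullet> b) *\<^sub>R b"
    unfolding v_def a_def b_def by (simp only: linear_diff[OF assms(1)] linear_scale[OF assms(1)])
  ultimately have "(b \<bullet> b) * ((a \<bullet> a) * (b \<bullet> b) - (a \<bullet> b)\<^sup>2) > 0"
    by (simp add: inner_diff_left inner_diff_right inner_commute[of b a] power2_eq_square algebra_simps)
  then show ?thesis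
    using b unfolding gram_det_def a_def[symmetric] b_def[symmetric] by (simp add: zero_less_mult_iff)
qed

lemma det_matrix_2:
  fixes M :: "real^2 \<Rightarrow> real^2"
  shows "det (matrix M) = M (axis 1 1) $ 1 * M (axis 2 1) $ 2 - M (axis 2 1) $ 1 * M (axis 1 1) $ 2"
  by (simp add: det_2 matrix_def)

lemma gram_det_compose:
  assumes "linear \<Phi>"
  shows "gram_det (\<Phi> \<circ> M) = (det (matrix M))\<^sup>2 * gram_det \<Phi>"
  unfolding gram_det_def det_matrix_2 o_def linear_real2[OF assms, of "M _"]
  by (simp add: inner_add_left inner_add_right inner_commute power2_eq_square algebra_simps)

text \<open>Numerator and denominator both pick up the factor (det M)^2, which cancels. This is the
  coordinate invariance of a trace with respect to the metric.\<close>

lemma gram_trace_compose: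
  assumes "linear \<Phi>" "linear \<alpha>" "linear \<beta>" "det (matrix M) \<noteq> 0"
  shows "gram_trace (\<Phi> \<circ> M) (\<alpha> \<circ> M) (\<beta> \<circ> M) = gram_trace \<Phi> \<alpha> \<beta>"
proof -
  define num where "num \<Phi> \<alpha> \<beta> = (\<Phi> (axis 2 1) \<bullet> \<Phi> (axis 2 1)) * (\<alpha> (axis 1 1) \<bullet> \<beta> (axis 1 1))
     - (\<Phi> (axis 1 1) \<bullet> \<Phi> (axis 2 1)) * (\<alpha> (axis 1 1) \<bullet> \<beta> (axis 2 1) + \<alpha> (axis 2 1) \<bullet> \<beta> (axis 1 1))
     + (\<Phi> (axis 1 1) \<bullet> \<Phi> (axis 1 1)) * (\<alpha> (axis 2 1) \<bullet> \<beta> (axis 2 1))"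
    for \<Phi> :: "real^2 \<Rightarrow> 'a" and \<alpha> \<beta> :: "real^2 \<Rightarrow> 'b"
  have "num (\<Phi> \<circ> M) (\<alpha> \<circ> M) (\<beta> \<circ> M) = (det (matrix M))\<^sup>2 * num \<Phi> \<alpha> \<beta>"
    unfolding num_def det_matrix_2 o_def linear_real2[OF assms(1), of "M _"]
      linear_real2[OF assms(2), of "M _"] linear_real2[OF assms(3), of "M _"]
    by (simp add: inner_add_left inner_add_right inner_commute[of "\<Phi> (axis 2 1)" "\<Phi> (axis 1 1)"]
        power2_eq_square algebra_simps)
  then show ?thesis
    using assms(4) unfolding gram_trace_def num_def[symmetric] gram_det_compose[OF assms(1)] by simp
qed

lemma gram_trace_nonneg:
  assumes "gram_det \<Phi> > 0"
  shows "gram_trace \<Phi> \<alpha> \<alpha> \<ge> 0"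
proof -
  define a b where "a = \<Phi> (axis 1 1)" and "b = \<Phi> (axis 2 1)"
  define x y where "x = \<alpha> (axis 1 1)" and "y = \<alpha> (axis 2 1)"
  have D: "(a \<bullet> a) * (b \<bullet> b) - (a \<bullet> b)\<^sup>2 > 0" using assms by (simp add: gram_det_def a_def b_def)
  then have "a \<noteq> 0" by auto
  then have a: "a \<bullet> a > 0" by simp
  \<comment> \<open>Completing the square in y after multiplication by a . a; the remainder is the
    Gram determinant times x . x.\<close>
  have "(a \<bullet> a) * ((b \<bullet> b) * (x \<bullet> x) - (a \<bullet> b) * (x \<bullet> y + y \<bullet> x) + (a \<bullet> a) * (y \<bullet> y))
      = ((a \<bullet> a) *\<^sub>R y - (a \<bullet> b) *\<^sub>R x) \<bullet> ((a \<bullet> a) *\<^sub>R y - (a \<bullet> b) *\<^sub>R x)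
        + ((a \<bullet> a) * (b \<bullet> b) - (a \<bullet> b)\<^sup>2) * (x \<bullet> x)"
    by (simp add: inner_diff_left inner_diff_right inner_commute[of y x] power2_eq_square algebra_simps)
  also have "\<dots> \<ge> 0" using D by simp
  finally have "(b \<bullet> b) * (x \<bullet> x) - (a \<bullet> b) * (x \<bullet> y + y \<bullet> x) + (a \<bullet> a) * (y \<bullet> y) \<ge> 0"
    using a by (simp add: zero_le_mult_iff)
  then show ?thesis using assms unfolding gram_trace_def a_def b_def x_def y_def by simp
qed

lemma gram_trace_zero: "gram_trace \<Phi> (\<lambda>v. 0) \<beta> = 0"
  by (simp add: gram_trace_def)

lemma gram_trace_add: "gram_trace \<Phi> (\<lambda>v. \<alpha> v + \<alpha>' v) \<beta> = gram_trace \<Phi> \<alpha> \<beta> + gram_trace \<Phi> \<alpha>' \<beta>"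
  by (simp add: gram_trace_def inner_add_left inner_add_right add_divide_distrib[symmetric] algebra_simps)

lemma gram_trace_sum: "gram_trace \<Phi> (\<lambda>v. \<Sum>i\<in>I. \<alpha> i v) \<beta> = (\<Sum>i\<in>I. gram_trace \<Phi> (\<alpha> i) \<beta>)"
proof (cases "finite I")
  case True
  then show ?thesis by (induction I) (simp_all add: gram_trace_zero gram_trace_add)
qed (simp add: gram_trace_zero)

lemma matrix_inv_2:
  fixes G :: "real^2^2"
  assumes "det G \<noteq> 0"
  shows "matrix_inv G $ 1 $ 1 = G$2$2 / det G" "matrix_inv G $ 1 $ 2 = - G$1$2 / det G"
    "matrix_inv G $ 2 $ 1 = - G$2$1 / det G" "matrix_inv G $ 2 $ 2 = G$1$1 / det G"
proof -
  define H :: "real^2^2" where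
    "H = (\<chi> i j. (if i = 1 then (if j = 1 then G$2$2 else - G$1$2) else (if j = 1 then - G$2$1 else G$1$1)) / det G)"
  have 12: "(2::2) \<noteq> 1" by simp
  have "G ** H = mat 1" "H ** G = mat 1"
    using assms
    by (simp_all add: H_def vec_eq_iff matrix_matrix_mult_def forall_2 sum_2 mat_def)
       (simp_all add: field_simps, simp_all add: det_2)
  then have "matrix_inv G = H"
    unfolding matrix_inv_def by (intro some_equality) (auto, metis matrix_mul_assoc matrix_mul_lid matrix_mul_rid)
  then show "matrix_inv G $ 1 $ 1 = G$2$2 / det G" "matrix_inv G $ 1 $ 2 = - G$1$2 / det G"
    "matrix_inv G $ 2 $ 1 = - G$2$1 / det G" "matrix_inv G $ 2 $ 2 = G$1$1 / det G"
    by (simp_all add: H_def)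
qed

lemma metric_nth:
  "metric c \<phi> x $ i $ j = frechet_derivative (in_chart c \<phi>) (at x) (axis i 1) \<bullet>
     frechet_derivative (in_chart c \<phi>) (at x) (axis j 1)"
  by (simp add: metric_def partial_deriv_def)

lemma det_metric: "det (metric c \<phi> x) = gram_det (frechet_derivative (in_chart c \<phi>) (at x))"
  by (simp add: det_2 metric_nth gram_det_def inner_commute power2_eq_square)

text \<open>Replaces the inverse matrix of the definitions by \<open>gram_trace\<close>; it serves
  both |A|^2 and the flux of the gradient.\<close>

lemma metric_inv_trace:
  assumes "gram_det (frechet_derivative (in_chart c \<phi>) (at x)) \<noteq> 0"
  shows "(\<Sum>i\<in>UNIV. \<Sum>j\<in>UNIV. matrix_inv (metric c \<phi> x) $ i $ j * (\<alpha> (axis i 1) \<bullet> \<beta> (axis j 1)))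
    = gram_trace (frechet_derivative (in_chart c \<phi>) (at x)) \<alpha> \<beta>"
  using assms unfolding sum_2
  by (simp add: matrix_inv_2 det_metric metric_nth gram_trace_def inner_commute field_simps)

section \<open>The area measure\<close>

text \<open>Translates between the nonnegative integral in the definition of the area and the gauge
  integral of the change of variables theorem. The value \<infinity> is kept, so the substitution
  rule below can be stated for all nonnegative densities.\<close>

lemma nn_integral_set_eq_integral:
  fixes h :: "'a::euclidean_space \<Rightarrow> real"
  assumes "\<And>x. x \<in> T \<Longrightarrow> h x \<ge> 0" "(\<lambda>x. h x * indicator T x) \<in> borel_measurable borel"
  shows "(\<integral>\<^sup>+x. ennreal (h x) * indicator T x \<partial>lborel) =
    (if h integrable_on T then ennreal (integral T h) else \<infinity>)"
proof (cases "h integrable_on T")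
  case True
  then show ?thesis using nn_integral_has_integral_lebesgue'[OF assms(1) integrable_integral] by simp
next
  case False
  have eq: "ennreal (h x) * indicator T x = ennreal (h x * indicator T x)" for x
    by (simp add: indicator_def)
  have "\<not> (\<integral>\<^sup>+x. ennreal (h x * indicator T x) \<partial>lborel) < \<infinity>"
  proof
    assume "(\<integral>\<^sup>+x. ennreal (h x * indicator T x) \<partial>lborel) < \<infinity>"
    then have "(\<lambda>x. h x * indicator T x) integrable_on UNIV"
      using assms by (intro nn_integral_integrable_on) (auto simp: indicator_def)
    moreover have "(\<lambda>x. h x * indicator T x) = (\<lambda>x. if x \<in> T then h x else 0)" by (auto simp: indicator_def)
    ultimately show False using False by (simp add: integrable_restrict_UNIV)
  qed
  then show ?thesis using False by (simp add: eq less_top[symmetric])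
qed

lemma nn_integral_change_of_variables:
  fixes f :: "real^'n::{finite,wellorder} \<Rightarrow> real" and g :: "real^'n::_ \<Rightarrow> real^'n::_"
  assumes S: "S \<in> sets borel" and g: "\<And>x. x \<in> S \<Longrightarrow> (g has_derivative g' x) (at x)" "inj_on g S"
    and f: "\<And>y. y \<in> g ` S \<Longrightarrow> f y \<ge> 0" "(\<lambda>y. f y * indicator (g ` S) y) \<in> borel_measurable borel"
    and m: "(\<lambda>x. \<bar>det (matrix (g' x))\<bar> * f (g x) * indicator S x) \<in> borel_measurable borel"
  shows "(\<integral>\<^sup>+y. ennreal (f y) * indicator (g ` S) y \<partial>lborel) =
    (\<integral>\<^sup>+x. ennreal (\<bar>det (matrix (g' x))\<bar> * f (g x)) * indicator S x \<partial>lborel)"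
proof -
  let ?h = "\<lambda>x. \<bar>det (matrix (g' x))\<bar> * f (g x)"
  \<comment> \<open>The change of variables theorem is for vector-valued integrands; scalars are
    embedded in \<open>real^1\<close> by \<open>vec\<close> and recovered by
    \<open>absolutely_integrable_on_1_iff\<close>. For nonnegative integrands absolute integrability
    is integrability, so both sides are finite together.\<close>
  have "(\<lambda>x. \<bar>det (matrix (g' x))\<bar> *\<^sub>R (vec (f (g x)) :: real^1)) absolutely_integrable_on S \<and>
      integral S (\<lambda>x. \<bar>det (matrix (g' x))\<bar> *\<^sub>R (vec (f (g x)) :: real^1)) = b
    \<longleftrightarrow> (\<lambda>x. vec (f x) :: real^1) absolutely_integrable_on (g ` S) \<and> integral (g ` S) (\<lambda>x. vec (f x)) = b" for b
    using S g by (intro has_absolute_integral_change_of_variables) (auto intro: has_derivative_at_withinI)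
  from this[of "vec b" for b] have *: "?h absolutely_integrable_on S \<and> integral S ?h = b
    \<longleftrightarrow> f absolutely_integrable_on (g ` S) \<and> integral (g ` S) f = b" for b
    by (simp add: absolutely_integrable_on_1_iff integral_on_1_eq)
  have h: "?h x \<ge> 0" if "x \<in> S" for x using f(1) that by simp
  have "?h integrable_on S \<and> integral S ?h = b \<longleftrightarrow> f integrable_on (g ` S) \<and> integral (g ` S) f = b" for b
    using *[of b] absolutely_integrable_on_iff_nonneg[of S ?h] absolutely_integrable_on_iff_nonneg[of "g ` S" f] h f(1)
    by blast
  then have "?h integrable_on S \<longleftrightarrow> f integrable_on (g ` S)"
    "f integrable_on (g ` S) \<Longrightarrow> integral S ?h = integral (g ` S) f" by blast+
  moreover have "(\<integral>\<^sup>+y. ennreal (f y) * indicator (g ` S) y \<partial>lborel) =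
      (if f integrable_on (g ` S) then ennreal (integral (g ` S) f) else \<infinity>)"
    by (rule nn_integral_set_eq_integral[OF f])
  moreover have "(\<integral>\<^sup>+x. ennreal (?h x) * indicator S x \<partial>lborel) =
      (if ?h integrable_on S then ennreal (integral S ?h) else \<infinity>)"
    by (rule nn_integral_set_eq_integral[OF h m])
  ultimately show ?thesis by simp
qed

text \<open>The intrinsic part of the theory: neither the normal field nor \<kappa> appears, only
  the induced metric of a compact immersed surface.\<close>

locale immersed = atlas X \<A> for X :: "'a topology" and \<A> +
  fixes \<phi> :: "'a \<Rightarrow> E4"
  assumes compact: "compact_space X" and Hausdorff: "Hausdorff_space X"
    and smooth: "smooth_map \<A> \<phi>"
    and inj: "\<And>c x. c \<in> \<A> \<Longrightarrow> x \<in> snd c ` fst c \<Longrightarrow> inj (frechet_derivative (in_chart c \<phi>) (at x))"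
begin

lemma Ck: "Ck_map n \<A> \<phi>"
  by (rule smooth_map_imp_Ck_map[OF smooth])

lemma inj_dmap: "c \<in> \<A> \<Longrightarrow> p \<in> fst c \<Longrightarrow> inj (dmap c \<phi> p)"
  unfolding dmap_def by (rule inj) auto

lemma linear_dmap: "c \<in> \<A> \<Longrightarrow> p \<in> fst c \<Longrightarrow> Ck_map (Suc n) \<A> f \<Longrightarrow> linear (dmap c f p)"
  by (rule has_derivative_linear[OF Ck_map_has_derivative])

lemma gram_pos: "c \<in> \<A> \<Longrightarrow> p \<in> fst c \<Longrightarrow> gram_det (dmap c \<phi> p) > 0"
  by (rule gram_det_pos[OF linear_dmap[OF _ _ Ck] inj_dmap])

abbreviation dens :: "'a chart \<Rightarrow> real^2 \<Rightarrow> real" where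
  "dens c x \<equiv> sqrt (det (metric c \<phi> x))"

lemma det_metric_pos: "c \<in> \<A> \<Longrightarrow> x \<in> snd c ` fst c \<Longrightarrow> det (metric c \<phi> x) > 0"
  unfolding det_metric using gram_pos[of c] by (elim imageE) (simp add: dmap_def)

text \<open>The square root of the factor in \<open>gram_det_compose\<close>, which is exactly the
  Jacobian that a substitution along the transition map produces.\<close>

lemma dens_transition:
  assumes "c \<in> \<A>" "d \<in> \<A>" "p \<in> fst c" "p \<in> fst d"
  shows "dens c (snd c p) = \<bar>det (matrix (dmap c (snd d) p))\<bar> * dens d (snd d p)"
proof -
  have "gram_det (dmap c \<phi> p) = (det (matrix (dmap c (snd d) p)))\<^sup>2 * gram_det (dmap d \<phi> p)"
    unfolding dmap_change_chart[OF assms Ck]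
    by (rule gram_det_compose[OF linear_dmap[OF assms(2,4) Ck]])
  then show ?thesis by (simp add: det_metric dmap_def[symmetric] real_sqrt_mult)
qed

lemma Ck_partial: "c \<in> \<A> \<Longrightarrow> Ck_map (Suc n) \<A> f \<Longrightarrow> Ck_on n (snd c ` fst c) (\<lambda>x. frechet_derivative (in_chart c f) (at x) v)"
  by (simp add: Ck_map_def)

lemma Ck_metric: "c \<in> \<A> \<Longrightarrow> Ck_on n (snd c ` fst c) (\<lambda>x. metric c \<phi> x $ i $ j)"
  unfolding metric_nth by (intro Ck_on_inner chart_open[OF chart] Ck_partial Ck)

lemma Ck_det_metric: "c \<in> \<A> \<Longrightarrow> Ck_on n (snd c ` fst c) (\<lambda>x. det (metric c \<phi> x))"
  unfolding det_2 by (intro Ck_on_diff Ck_on_mult chart_open[OF chart] Ck_metric)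

lemma Ck_dens: "c \<in> \<A> \<Longrightarrow> Ck_on n (snd c ` fst c) (dens c)"
  by (intro Ck_on_sqrt chart_open[OF chart] Ck_det_metric det_metric_pos)

lemma continuous_on_dens: "c \<in> \<A> \<Longrightarrow> continuous_on (snd c ` fst c) (dens c)"
  by (rule Ck_on_imp_continuous_on[OF Ck_dens])

section \<open>Chart measures and their compatibility\<close>

abbreviation BM :: "'a measure" where
  "BM \<equiv> sigma (topspace X) {U. openin X U}"

lemma space_BM: "space BM = topspace X"
  by (rule space_measure_of) (use openin_subset in auto)

lemma openin_BM: "openin X U \<Longrightarrow> U \<in> sets BM"
  using openin_subset by (auto simp: sets_measure_of_conv)

lemma fst_BM: "c \<in> \<A> \<Longrightarrow> fst c \<in> sets BM"
  by (intro openin_BM chart_openin[OF chart])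

lemma continuous_map_BM: "continuous_map X euclidean h \<Longrightarrow> h \<in> borel_measurable BM"
  by (rule borel_measurableI)
     (auto intro!: openin_BM simp: continuous_map_alt space_BM)

lemma inv_measurable:
  assumes "c \<in> \<A>"
  shows "inv_into (fst c) (snd c) \<in> restrict_space lborel (snd c ` fst c) \<rightarrow>\<^sub>M BM"
proof (rule measurable_measure_of)
  show "{U. openin X U} \<subseteq> Pow (topspace X)" using openin_subset by auto
  show "inv_into (fst c) (snd c) \<in> space (restrict_space lborel (snd c ` fst c)) \<rightarrow> topspace X"
    using chart_subset[OF assms] by (auto simp: space_restrict_space chart_inv[OF chart[OF assms]])
  fix U assume "U \<in> {U. openin X U}"
  then have "open (snd c ` (fst c \<inter> U))"
    by (intro chart_open_image[OF chart[OF assms]] openin_Int chart_openin[OF chart[OF assms]]) auto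
  moreover have "inv_into (fst c) (snd c) -` U \<inter> snd c ` fst c = snd c ` (fst c \<inter> U)"
    by (auto simp: chart_inv[OF chart[OF assms]])
  ultimately show "inv_into (fst c) (snd c) -` U \<inter> space (restrict_space lborel (snd c ` fst c))
      \<in> sets (restrict_space lborel (snd c ` fst c))"
    by (auto simp: space_restrict_space sets_restrict_space_iff chart_open[OF chart[OF assms]] borel_open)
qed

lemma vimage_inv:
  assumes "c \<in> \<A>"
  shows "inv_into (fst c) (snd c) -` B \<inter> snd c ` fst c = snd c ` (B \<inter> fst c)"
  by (auto simp: chart_inv[OF chart[OF assms]])

lemma chart_image_borel:
  assumes "c \<in> \<A>" "B \<in> sets BM"
  shows "snd c ` (B \<inter> fst c) \<in> sets borel"
  using measurable_sets[OF inv_measurable[OF assms(1)] assms(2)] chart_open[OF chart[OF assms(1)]]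
  by (simp add: space_restrict_space sets_restrict_space_iff borel_open vimage_inv[OF assms(1)])

lemma dens_measurable:
  assumes "c \<in> \<A>" "S \<in> sets borel" "S \<subseteq> snd c ` fst c"
  shows "(\<lambda>x. dens c x * indicator S x) \<in> borel_measurable borel"
  using borel_measurable_continuous_on_indicator[OF assms(2) continuous_on_subset[OF continuous_on_dens[OF assms(1)] assms(3)]]
  by (simp add: mult.commute)

text \<open>The area of the part of a set that lies in the chart domain, as a measure on the whole
  of X, so that contributions of different charts can be added.\<close>

definition chart_measure :: "'a chart \<Rightarrow> 'a measure" where
  "chart_measure c = distr (density (restrict_space lborel (snd c ` fst c)) (\<lambda>x. ennreal (dens c x)))
     BM (inv_into (fst c) (snd c))"

lemma dens_measurable_restrict:
  assumes "c \<in> \<A>"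
  shows "dens c \<in> borel_measurable (restrict_space lborel (snd c ` fst c))"
  using borel_measurable_continuous_on_restrict[OF continuous_on_dens[OF assms]]
  by (simp cong: measurable_cong_sets add: sets_restrict_space_cong[of borel lborel])

lemma emeasure_chart_measure:
  assumes c: "c \<in> \<A>" and B: "B \<in> sets BM"
  shows "emeasure (chart_measure c) B = (\<integral>\<^sup>+x. ennreal (dens c x) * indicator (snd c ` (B \<inter> fst c)) x \<partial>lborel)"
proof -
  let ?R = "restrict_space lborel (snd c ` fst c)"
  have S: "snd c ` (B \<inter> fst c) \<in> sets ?R"
    using chart_image_borel[OF assms] chart_open[OF chart[OF c]]
    by (auto simp: sets_restrict_space_iff borel_open)
  have "emeasure (chart_measure c) B = emeasure (density ?R (\<lambda>x. ennreal (dens c x))) (snd c ` (B \<inter> fst c))"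
    unfolding chart_measure_def using inv_measurable[OF c] B vimage_inv[OF c, of B]
    by (subst emeasure_distr) (auto simp: space_restrict_space)
  also have "\<dots> = (\<integral>\<^sup>+x. ennreal (dens c x) * indicator (snd c ` (B \<inter> fst c)) x \<partial>?R)"
    using S dens_measurable_restrict[OF c] by (intro emeasure_density) auto
  also have "\<dots> = (\<integral>\<^sup>+x. ennreal (dens c x) * indicator (snd c ` (B \<inter> fst c)) x * indicator (snd c ` fst c) x \<partial>lborel)"
    using chart_open[OF chart[OF c]] by (intro nn_integral_restrict_space) (auto simp: borel_open)
  also have "\<dots> = (\<integral>\<^sup>+x. ennreal (dens c x) * indicator (snd c ` (B \<inter> fst c)) x \<partial>lborel)"
    by (intro nn_integral_cong) (auto simp: indicator_def)
  finally show ?thesis .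
qed

text \<open>Substitution along the transition map; its Jacobian is absorbed by the densities through
  \<open>dens_transition\<close>.\<close>

lemma chart_measure_eq:
  assumes c: "c \<in> \<A>" and d: "d \<in> \<A>" and B: "B \<in> sets BM" "B \<subseteq> fst c" "B \<subseteq> fst d"
  shows "emeasure (chart_measure c) B = emeasure (chart_measure d) B"
proof -
  let ?T = "in_chart c (snd d)" and ?T' = "\<lambda>x. frechet_derivative (in_chart c (snd d)) (at x)"
  have S: "snd c ` B \<in> sets borel" "snd d ` B \<in> sets borel"
    using chart_image_borel[OF c B(1)] chart_image_borel[OF d B(1)] B by (simp_all add: Int_absorb2)
  have im: "?T ` snd c ` B = snd d ` B" by (rule in_chart_image[OF chart[OF c] B(2)])
  have t: "dens c x = \<bar>det (matrix (?T' x))\<bar> * dens d (?T x)" if x: "x \<in> snd c ` B" for x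
  proof -
    obtain p where p: "p \<in> B" "x = snd c p" using x by blast
    then show ?thesis
      using dens_transition[OF c d, of p] B in_chart_apply[OF chart[OF c], of p "snd d"]
      by (simp add: dmap_def subset_iff)
  qed
  have "(\<integral>\<^sup>+y. ennreal (dens d y) * indicator (?T ` snd c ` B) y \<partial>lborel) =
    (\<integral>\<^sup>+x. ennreal (\<bar>det (matrix (?T' x))\<bar> * dens d (?T x)) * indicator (snd c ` B) x \<partial>lborel)"
  proof (rule nn_integral_change_of_variables[OF S(1)])
    fix x assume "x \<in> snd c ` B"
    then show "(?T has_derivative ?T' x) (at x)"
      using B by (intro Ck_on_Suc_has_derivative[OF Ck_transition[OF c d]]) auto
  next
    show "inj_on ?T (snd c ` B)"
      using B inj_on_subset[OF chart_inj[OF chart[OF d]], of B]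
      by (auto simp: inj_on_def in_chart_apply[OF chart[OF c]] subset_iff)
  next
    show "dens d y \<ge> 0" if "y \<in> ?T ` snd c ` B" for y
      using that det_metric_pos[OF d, of y] B unfolding im by (auto simp: less_imp_le)
    show "(\<lambda>y. dens d y * indicator (?T ` snd c ` B) y) \<in> borel_measurable borel"
      unfolding im using S B by (intro dens_measurable[OF d]) auto
    have "(\<lambda>x. dens c x * indicator (snd c ` B) x) = (\<lambda>x. \<bar>det (matrix (?T' x))\<bar> * dens d (?T x) * indicator (snd c ` B) x)"
      using t by (auto simp: indicator_def)
    then show "(\<lambda>x. \<bar>det (matrix (?T' x))\<bar> * dens d (?T x) * indicator (snd c ` B) x) \<in> borel_measurable borel"
      using dens_measurable[OF c S(1)] B by auto
  qed
  also have "\<dots> = (\<integral>\<^sup>+x. ennreal (dens c x) * indicator (snd c ` B) x \<partial>lborel)"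
    using t by (intro nn_integral_cong) (auto simp: indicator_def)
  finally show ?thesis
    using B by (simp add: emeasure_chart_measure[OF c] emeasure_chart_measure[OF d] im Int_absorb2)
qed

section \<open>Existence and uniqueness of the area measure\<close>

lemma chart_partition:
  "\<exists>(n::nat) c D. (\<forall>i<n. c i \<in> \<A> \<and> D i \<in> sets BM \<and> D i \<subseteq> fst (c i)) \<and>
     disjoint_family_on D {..<n} \<and> (\<Union>i<n. D i) = topspace X"
proof -
  have "compactin X (topspace X)" using compact by (simp add: compact_space_def)
  moreover have "\<forall>U\<in>fst ` \<A>. openin X U" "topspace X \<subseteq> \<Union>(fst ` \<A>)"
    using chart_openin[OF chart] smooth_atlas by (auto simp: smooth_atlas_def)
  ultimately obtain \<F> where \<F>: "finite \<F>" "\<F> \<subseteq> fst ` \<A>" "topspace X \<subseteq> \<Union>\<F>"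
    unfolding compactin_def by meson
  then obtain C where C: "finite C" "C \<subseteq> \<A>" "\<F> = fst ` C" using finite_subset_image by meson
  obtain n and c :: "nat \<Rightarrow> 'a chart" where c: "C = c ` {i. i < n}"
    using C(1) finite_imp_nat_seg_image_inj_on by blast
  \<comment> \<open>\<open>disjointed\<close> works on sequences indexed by all naturals; from n on
    the sets are empty, so the first n pieces already exhaust X.\<close>
  define F where "F i = (if i < n then fst (c i) else {})" for i
  have cA: "c i \<in> \<A>" if "i < n" for i using that c C by auto
  have F: "F i \<in> sets BM" for i using fst_BM[OF cA] by (simp add: F_def)
  have D: "disjointed F i \<subseteq> F i" for i by (rule disjointed_subset)
  have DF: "disjointed F i \<subseteq> fst (c i)" if "i < n" for i using D[of i] that by (simp add: F_def)
  have "(\<Union>i. disjointed F i) = (\<Union>i<n. disjointed F i)"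
    using D by (fastforce simp: F_def split: if_splits)
  moreover have "(\<Union>i. F i) = \<Union>\<F>" using c C by (auto simp: F_def split: if_splits)
  moreover have "\<Union>\<F> = topspace X" using \<F> chart_subset by blast
  ultimately have U: "(\<Union>i<n. disjointed F i) = topspace X" using UN_disjointed_eq[of F] by simp
  have "disjoint_family_on (disjointed F) {..<n}"
    by (rule disjoint_family_on_mono[OF subset_UNIV disjoint_family_disjointed])
  moreover have "disjointed F i \<in> sets BM" for i
    using sets.range_disjointed_sets[of F BM] F by (auto simp: image_subset_iff)
  ultimately show ?thesis using cA DF U by (intro exI[of _ n] exI[of _ c] exI[of _ "disjointed F"]) simp
qed

text \<open>The predicate under the definite description in \<open>area_measure\<close>.\<close>

definition is_area :: "'a measure \<Rightarrow> bool" where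
  "is_area \<mu> \<longleftrightarrow> sets \<mu> = sets BM \<and> (\<forall>c\<in>\<A>. \<forall>B\<in>sets \<mu>. B \<subseteq> fst c \<longrightarrow> emeasure \<mu> B =
     (\<integral>\<^sup>+x. ennreal (dens c x) * indicator (snd c ` B) x \<partial>lborel))"

lemma is_area_chart: "is_area \<mu> \<Longrightarrow> c \<in> \<A> \<Longrightarrow> B \<in> sets BM \<Longrightarrow> B \<subseteq> fst c \<Longrightarrow>
    emeasure \<mu> B = emeasure (chart_measure c) B"
  by (simp add: is_area_def emeasure_chart_measure Int_absorb2)

text \<open>A Borel set is cut along \<open>chart_partition\<close>; on each piece the value is
  prescribed by a chart.\<close>

lemma is_area_unique:
  assumes "is_area \<mu>" "is_area \<nu>"
  shows "\<mu> = \<nu>"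
proof (rule measure_eqI)
  show "sets \<mu> = sets \<nu>" using assms by (simp add: is_area_def)
  fix B assume "B \<in> sets \<mu>"
  then have B: "B \<in> sets BM" using assms by (simp add: is_area_def)
  obtain n :: nat and c D where nD: "\<forall>i<n. c i \<in> \<A> \<and> D i \<in> sets BM \<and> D i \<subseteq> fst (c i)"
    "disjoint_family_on D {..<n}" "(\<Union>i<n. D i) = topspace X"
    using chart_partition by auto
  then have D: "\<And>i. i < n \<Longrightarrow> c i \<in> \<A>" "\<And>i. i < n \<Longrightarrow> D i \<in> sets BM"
    "\<And>i. i < n \<Longrightarrow> D i \<subseteq> fst (c i)" "disjoint_family_on D {..<n}" "(\<Union>i<n. D i) = topspace X"
    by auto
  have dis: "disjoint_family_on (\<lambda>i. B \<inter> D i) {..<n}"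
    using D(4) by (auto simp: disjoint_family_on_def)
  have "B \<subseteq> topspace X" using sets.sets_into_space[OF B] by (simp add: space_BM)
  then have UB: "(\<Union>i<n. B \<inter> D i) = B" using D(5) by auto
  have "emeasure \<rho> B = (\<Sum>i<n. emeasure (chart_measure (c i)) (B \<inter> D i))" if "is_area \<rho>" for \<rho>
  proof -
    have "(\<Sum>i<n. emeasure \<rho> (B \<inter> D i)) = emeasure \<rho> (\<Union>i<n. B \<inter> D i)"
      using that B D(2) dis by (intro sum_emeasure) (auto simp: is_area_def)
    moreover have "emeasure \<rho> (B \<inter> D i) = emeasure (chart_measure (c i)) (B \<inter> D i)" if "i < n" for i
      using D(3)[OF that] B D(2)[OF that] by (intro is_area_chart[OF \<open>is_area \<rho>\<close> D(1)[OF that]]) auto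
    ultimately show ?thesis unfolding UB by simp
  qed
  then show "emeasure \<mu> B = emeasure \<nu> B" using assms by simp
qed

text \<open>The chart measures are summed over the pieces of \<open>chart_partition\<close>. That
  the sum obeys the formula of every chart, and not only of the finitely many chosen ones, is
  \<open>chart_measure_eq\<close> on each piece.\<close>

lemma is_area_exists: "\<exists>\<mu>. is_area \<mu>"
proof -
  obtain n :: nat and c D where nD: "\<forall>i<n. c i \<in> \<A> \<and> D i \<in> sets BM \<and> D i \<subseteq> fst (c i)"
    "disjoint_family_on D {..<n}" "(\<Union>i<n. D i) = topspace X"
    using chart_partition by auto
  then have D: "\<And>i. i < n \<Longrightarrow> c i \<in> \<A>" "\<And>i. i < n \<Longrightarrow> D i \<in> sets BM"
    "\<And>i. i < n \<Longrightarrow> D i \<subseteq> fst (c i)" "disjoint_family_on D {..<n}" "(\<Union>i<n. D i) = topspace X"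
    by auto
  define m where "m B = (\<Sum>i<n. emeasure (chart_measure (c i)) (B \<inter> D i))" for B
  define \<mu> where "\<mu> = measure_of (topspace X) (sets BM) m"
  have sets_cm: "sets (chart_measure d) = sets BM" for d by (simp add: chart_measure_def)
  have alg: "sigma_algebra (topspace X) (sets BM)"
    using sets.sigma_algebra_axioms[of BM] by (simp add: space_BM)
  have sets: "sets \<mu> = sets BM"
    unfolding \<mu>_def using sigma_algebra.sets_measure_of_eq[OF alg] by simp
  have em: "emeasure \<mu> B = m B" if "B \<in> sets BM" for B
    unfolding \<mu>_def
  proof (rule emeasure_measure_of_sigma[OF alg _ _ that])
    show "positive (sets BM) m" by (simp add: positive_def m_def)
    show "countably_additive (sets BM) m"
      unfolding countably_additive_def
    proof (intro allI impI)
      fix F :: "nat \<Rightarrow> 'a set"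
      assume F: "range F \<subseteq> sets BM" "disjoint_family F" "\<Union> (range F) \<in> sets BM"
      have "(\<Sum>k. m (F k)) = (\<Sum>i<n. \<Sum>k. emeasure (chart_measure (c i)) (F k \<inter> D i))"
        unfolding m_def by (rule suminf_sum) simp
      also have "\<dots> = m (\<Union> (range F))"
        unfolding m_def
      proof (rule sum.cong)
        fix i assume "i \<in> {..<n}"
        then have i: "D i \<in> sets BM" using D(2) by simp
        have "(\<Sum>k. emeasure (chart_measure (c i)) (F k \<inter> D i)) = emeasure (chart_measure (c i)) (\<Union>k. F k \<inter> D i)"
          using F i by (intro suminf_emeasure) (auto simp: sets_cm disjoint_family_on_def)
        then show "(\<Sum>k. emeasure (chart_measure (c i)) (F k \<inter> D i)) = emeasure (chart_measure (c i)) (\<Union> (range F) \<inter> D i)"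
          by simp
      qed simp
      finally show "(\<Sum>k. m (F k)) = m (\<Union> (range F))" .
    qed
  qed
  have "emeasure \<mu> B = emeasure (chart_measure d) B" if d: "d \<in> \<A>" and B: "B \<in> sets BM" "B \<subseteq> fst d" for d B
  proof -
    have dis: "disjoint_family_on (\<lambda>i. B \<inter> D i) {..<n}"
      using D(4) by (auto simp: disjoint_family_on_def)
    have "m B = (\<Sum>i<n. emeasure (chart_measure d) (B \<inter> D i))"
      unfolding m_def
    proof (rule sum.cong)
      fix i assume "i \<in> {..<n}"
      then have i: "i < n" by simp
      show "emeasure (chart_measure (c i)) (B \<inter> D i) = emeasure (chart_measure d) (B \<inter> D i)"
        using B D(2,3)[OF i] by (intro chart_measure_eq[OF D(1)[OF i] d]) auto
    qed simp
    also have "\<dots> = emeasure (chart_measure d) (\<Union>i<n. B \<inter> D i)"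
      using B D(2) dis by (intro sum_emeasure) (auto simp: sets_cm)
    also have "(\<Union>i<n. B \<inter> D i) = B"
      using D(5) sets.sets_into_space[OF B(1)] by (auto simp: space_BM)
    finally show ?thesis using em B by simp
  qed
  then have "is_area \<mu>"
    by (simp add: is_area_def sets emeasure_chart_measure Int_absorb2)
  then show ?thesis ..
qed

abbreviation \<mu> :: "'a measure" where "\<mu> \<equiv> area_measure X \<A> \<phi>"

lemma is_area_measure: "is_area \<mu>"
proof -
  have "area_measure X \<A> \<phi> = (THE \<mu>. is_area \<mu>)"
    by (simp add: area_measure_def is_area_def)
  then show ?thesis using theI'[of is_area] is_area_exists is_area_unique by metis
qed

lemma sets_area: "sets \<mu> = sets BM"
  using is_area_measure by (simp add: is_area_def)

lemma space_area: "space \<mu> = topspace X"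
  using sets_eq_imp_space_eq[OF sets_area] by (simp add: space_BM)

lemma continuous_map_measurable: "continuous_map X euclidean h \<Longrightarrow> h \<in> borel_measurable \<mu>"
  using continuous_map_BM measurable_cong_sets[OF sets_area refl] by blast

lemma emeasure_area:
  "c \<in> \<A> \<Longrightarrow> B \<in> sets BM \<Longrightarrow> B \<subseteq> fst c \<Longrightarrow>
    emeasure \<mu> B = (\<integral>\<^sup>+x. ennreal (dens c x) * indicator (snd c ` B) x \<partial>lborel)"
  using is_area_measure sets_area by (simp add: is_area_def)

lemma chart_measure_density:
  assumes c: "c \<in> \<A>"
  shows "chart_measure c = density \<mu> (indicator (fst c))"
proof (rule measure_eqI)
  show s: "sets (chart_measure c) = sets (density \<mu> (indicator (fst c)))"
    by (simp add: sets_area chart_measure_def)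
  fix B assume "B \<in> sets (chart_measure c)"
  then have B: "B \<in> sets BM" by (simp add: chart_measure_def)
  have "emeasure (density \<mu> (indicator (fst c))) B = (\<integral>\<^sup>+x. indicator (fst c) x * indicator B x \<partial>\<mu>)"
    using fst_BM[OF c] B by (intro emeasure_density borel_measurable_indicator) (auto simp: sets_area)
  also have "\<dots> = (\<integral>\<^sup>+x. indicator (B \<inter> fst c) x \<partial>\<mu>)"
    by (intro nn_integral_cong) (auto simp: indicator_def)
  also have "\<dots> = emeasure \<mu> (B \<inter> fst c)"
    using fst_BM[OF c] B by (intro nn_integral_indicator) (auto simp: sets_area)
  also have "\<dots> = emeasure (chart_measure c) B"
    using emeasure_area[OF c, of "B \<inter> fst c"] fst_BM[OF c] B emeasure_chart_measure[OF c B] by auto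
  finally show "emeasure (chart_measure c) B = emeasure (density \<mu> (indicator (fst c))) B" ..
qed

lemma integral_chart:
  fixes h :: "'a \<Rightarrow> real"
  assumes c: "c \<in> \<A>" and h: "h \<in> borel_measurable \<mu>" "\<And>p. p \<in> topspace X - fst c \<Longrightarrow> h p = 0"
  shows "(\<integral>p. h p \<partial>\<mu>) = (\<integral>x. indicator (snd c ` fst c) x * (dens c x * in_chart c h x) \<partial>lborel)"
proof -
  let ?R = "restrict_space lborel (snd c ` fst c)"
  have hB: "h \<in> borel_measurable BM" using h(1) measurable_cong_sets[OF sets_area refl] by blast
  have o: "snd c ` fst c \<in> sets borel" using chart_open[OF chart[OF c]] by (rule borel_open)
  have "(\<integral>p. h p \<partial>\<mu>) = (\<integral>p. indicator (fst c) p *\<^sub>R h p \<partial>\<mu>)"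
    using h(2) by (intro Bochner_Integration.integral_cong) (auto simp: indicator_def space_area)
  also have "\<dots> = (\<integral>p. h p \<partial>density \<mu> (\<lambda>p. ennreal (indicator (fst c) p)))"
    using fst_BM[OF c] h(1) by (intro integral_density[symmetric] borel_measurable_indicator) (auto simp: sets_area)
  also have "\<dots> = (\<integral>p. h p \<partial>chart_measure c)"
    by (simp add: chart_measure_density[OF c] ennreal_indicator)
  also have "\<dots> = (\<integral>x. in_chart c h x \<partial>density ?R (\<lambda>x. ennreal (dens c x)))"
    unfolding chart_measure_def in_chart_def o_def using inv_measurable[OF c] hB by (intro integral_distr) auto
  also have "\<dots> = (\<integral>x. dens c x *\<^sub>R in_chart c h x \<partial>?R)"
  proof (rule integral_density)
    show "in_chart c h \<in> borel_measurable ?R"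
      unfolding in_chart_def by (rule measurable_comp[OF inv_measurable[OF c] hB])
    show "AE x in ?R. 0 \<le> dens c x"
      using det_metric_pos[OF c] by (intro AE_I2) (auto simp: space_restrict_space less_imp_le)
  qed (rule dens_measurable_restrict[OF c])
  also have "\<dots> = (\<integral>x. indicator (snd c ` fst c) x *\<^sub>R (dens c x *\<^sub>R in_chart c h x) \<partial>lborel)"
    using o by (intro integral_restrict_space) auto
  finally show ?thesis by simp
qed

section \<open>Finiteness of the area and positivity on open sets\<close>

lemma finite_area_nbhd:
  assumes p: "p \<in> topspace X"
  shows "\<exists>V. openin X V \<and> p \<in> V \<and> emeasure \<mu> V < \<infinity>"
proof -
  obtain c where c: "c \<in> \<A>" "p \<in> fst c" using chart_exists[OF p] by blast
  have o: "open (snd c ` fst c)" using chart_open[OF chart[OF c(1)]] .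
  then obtain r where r: "r > 0" "cball (snd c p) r \<subseteq> snd c ` fst c"
    using c(2) open_contains_cball by blast
  define V where "V = {q \<in> fst c. snd c q \<in> ball (snd c p) r}"
  have V: "openin X V" unfolding V_def by (rule chart_openin_preimage[OF chart[OF c(1)]]) simp
  have "compact (dens c ` cball (snd c p) r)"
    using continuous_on_dens[OF c(1)] r(2) by (intro compact_continuous_image) (auto intro: continuous_on_subset)
  then have "bounded (dens c ` cball (snd c p) r)" by (rule compact_imp_bounded)
  then obtain M where "\<And>y. y \<in> dens c ` cball (snd c p) r \<Longrightarrow> norm y \<le> M"
    unfolding bounded_iff by blast
  then have M: "dens c x \<le> M" if "x \<in> cball (snd c p) r" for x
    using that by fastforce
  have "emeasure \<mu> V = (\<integral>\<^sup>+x. ennreal (dens c x) * indicator (snd c ` V) x \<partial>lborel)"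
    using V by (intro emeasure_area[OF c(1)] openin_BM) (auto simp: V_def)
  also have "\<dots> \<le> (\<integral>\<^sup>+x. ennreal M * indicator (cball (snd c p) r) x \<partial>lborel)"
    using M by (intro nn_integral_mono) (auto simp: indicator_def V_def intro!: ennreal_leI)
  also have "\<dots> = ennreal M * emeasure lborel (cball (snd c p) r)"
    by (rule nn_integral_cmult_indicator) simp
  also have "\<dots> < \<infinity>"
    using emeasure_lborel_cball_finite[of "snd c p" r] by (simp add: ennreal_mult_less_top)
  finally show ?thesis using V c(2) r(1) by (intro exI[of _ V]) (auto simp: V_def)
qed

text \<open>The density is bounded on closed coordinate balls, so the area is locally finite, hence
  finite by compactness. This makes every continuous function integrable.\<close>

lemma finite_area: "finite_measure \<mu>"
proof
  have "compactin X (topspace X)" using compact by (simp add: compact_space_def)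
  then obtain \<F> where \<F>: "finite \<F>" "\<F> \<subseteq> {V. openin X V \<and> emeasure \<mu> V < \<infinity>}" "topspace X \<subseteq> \<Union>\<F>"
    unfolding compactin_def using finite_area_nbhd
    by (elim conjE allE[of _ "{V. openin X V \<and> emeasure \<mu> V < \<infinity>}"]) blast
  have "emeasure \<mu> (\<Union>\<F>) \<le> (\<Sum>V\<in>\<F>. emeasure \<mu> V)"
    using emeasure_subadditive_finite[OF \<F>(1), of "\<lambda>V. V" \<mu>] \<F>(2) openin_BM by (auto simp: sets_area)
  also have "\<dots> < \<infinity>" using \<F>(1,2) by auto
  finally have "emeasure \<mu> (\<Union>\<F>) < \<infinity>" .
  moreover have "\<Union>\<F> = topspace X" using \<F>(2,3) openin_subset by blast
  ultimately show "emeasure \<mu> (space \<mu>) \<noteq> \<infinity>" by (simp add: space_area)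
qed

lemma continuous_integrable:
  fixes h :: "'a \<Rightarrow> real"
  assumes "continuous_map X euclidean h"
  shows "integrable \<mu> h"
proof -
  have "compactin euclidean (h ` topspace X)"
    using compact assms by (intro image_compactin) (auto simp: compact_space_def)
  then have "bounded (h ` topspace X)" by (simp add: compact_imp_bounded)
  then obtain B where "\<And>p. p \<in> topspace X \<Longrightarrow> norm (h p) \<le> B" by (auto simp: bounded_iff)
  then show ?thesis
    by (intro finite_measure.integrable_const_bound[OF finite_area, of _ B] continuous_map_measurable[OF assms])
       (auto simp: space_area)
qed

lemma emeasure_open_pos:
  assumes V: "openin X V" "V \<noteq> {}"
  shows "emeasure \<mu> V > 0"
proof -
  obtain p where p: "p \<in> V" using V(2) by blast
  then have "p \<in> topspace X" using openin_subset[OF V(1)] by blast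
  then obtain c where c: "c \<in> \<A>" "p \<in> fst c" using chart_exists by blast
  define B where "B = V \<inter> fst c"
  have B: "openin X B" "p \<in> B" "B \<subseteq> fst c" using V p c chart_openin[OF chart[OF c(1)]] by (auto simp: B_def)
  have oB: "open (snd c ` B)" by (rule chart_open_image[OF chart[OF c(1)] B(1,3)])
  have "emeasure \<mu> B \<noteq> 0"
  proof
    assume "emeasure \<mu> B = 0"
    then have "(\<integral>\<^sup>+x. ennreal (dens c x) * indicator (snd c ` B) x \<partial>lborel) = 0"
      using emeasure_area[OF c(1) openin_BM[OF B(1)] B(3)] by simp
    moreover have "(\<lambda>x. ennreal (dens c x * indicator (snd c ` B) x)) \<in> borel_measurable lborel"
      using dens_measurable[OF c(1) borel_open[OF oB]] B(3) by (intro measurable_compose[OF _ measurable_ennreal]) auto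
    moreover have "(\<lambda>x. ennreal (dens c x * indicator (snd c ` B) x)) = (\<lambda>x. ennreal (dens c x) * indicator (snd c ` B) x)"
      by (auto simp: indicator_def)
    ultimately have "AE x in lborel. ennreal (dens c x) * indicator (snd c ` B) x = 0"
      by (simp add: nn_integral_0_iff_AE)
    then have "AE x in lborel. x \<notin> snd c ` B"
    proof (rule AE_mp, intro AE_I2 impI notI)
      fix x assume "ennreal (dens c x) * indicator (snd c ` B) x = 0" "x \<in> snd c ` B"
      then show False using det_metric_pos[OF c(1), of x] B(3) by (auto simp: indicator_def ennreal_eq_0_iff)
    qed
    then have "snd c ` B \<in> null_sets lborel"
      using borel_open[OF oB] by (subst AE_iff_null_sets) auto
    then have "negligible (snd c ` B)"
      using null_sets_completionI negligible_iff_null_sets by blast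
    then show False using open_not_negligible[OF oB] B(2) by blast
  qed
  moreover have "emeasure \<mu> B \<le> emeasure \<mu> V"
    using V(1) openin_BM by (intro emeasure_mono) (auto simp: B_def sets_area)
  ultimately show ?thesis by (metis le_zero_eq not_gr_zero)
qed

text \<open>Nonempty open sets have positive area, since the density is positive and open plane sets
  are not negligible; so an almost everywhere identity between continuous functions holds at every
  point.\<close>

lemma AE_continuous_zero:
  fixes h :: "'a \<Rightarrow> real"
  assumes h: "continuous_map X euclidean h" and AE: "AE p in \<mu>. h p = 0" and p: "p \<in> topspace X"
  shows "h p = 0"
proof (rule ccontr)
  assume "h p \<noteq> 0"
  define V where "V = h -` (- {0}) \<inter> topspace X"
  have V: "openin X V"
    using h unfolding V_def continuous_map_alt by (auto intro: open_Compl)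
  have "p \<in> V" using p \<open>h p \<noteq> 0\<close> by (simp add: V_def)
  have "AE p in \<mu>. p \<notin> V" using AE by eventually_elim (simp add: V_def)
  then have "V \<in> null_sets \<mu>"
    using openin_BM[OF V] openin_subset[OF V] by (subst AE_iff_null_sets) (auto simp: sets_area)
  then have "emeasure \<mu> V = 0" by (rule null_setsD1)
  moreover have "V \<noteq> {}" using \<open>p \<in> V\<close> by blast
  ultimately show False using emeasure_open_pos[OF V] by simp
qed

end

section \<open>Green's formula\<close>

lemma integrable_compact_support:
  fixes g :: "'a::euclidean_space \<Rightarrow> real"
  assumes "continuous_on S g" "compact K" "K \<subseteq> S" "\<And>x. x \<in> S - K \<Longrightarrow> g x = 0"
  shows "integrable lborel (\<lambda>x. indicator S x * g x)"
proof -
  have "integrable lborel (\<lambda>x. indicator K x *\<^sub>R g x)"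
    using assms by (intro borel_integrable_compact) (auto intro: continuous_on_subset)
  moreover have "(\<lambda>x. indicator K x *\<^sub>R g x) = (\<lambda>x. indicator S x * g x)"
    using assms(3,4) by (auto simp: indicator_def fun_eq_iff)
  ultimately show ?thesis by simp
qed

text \<open>By translation invariance of Lebesgue measure each difference quotient of F in direction
  v has integral 0; dominated convergence passes to the derivative.\<close>

lemma integral_derivative_compact_support:
  fixes F :: "'a::euclidean_space \<Rightarrow> real"
  assumes F: "\<And>x. (F has_derivative F' x) (at x)" and cont: "continuous_on UNIV (\<lambda>x. F' x v)"
    and K: "compact K" "\<And>x. x \<notin> K \<Longrightarrow> F x = 0"
  shows "(\<integral>x. F' x v \<partial>lborel) = 0"
proof -
  define h where "h x = F' x v" for x
  have h0: "h x = 0" if "x \<notin> K" for x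
  proof -
    have "(F has_derivative (\<lambda>v. 0)) (at x)"
      using K that by (intro has_derivative_transform_within_open[of "\<lambda>x. 0" _ x UNIV "- K" F])
        (auto simp: open_Compl compact_imp_closed)
    then show ?thesis using has_derivative_unique[OF F[of x]] by (simp add: h_def)
  qed
  have "compact (h ` K)"
    using cont K(1) by (intro compact_continuous_image) (auto simp: h_def intro: continuous_on_subset)
  then have "bounded (h ` K)" by (rule compact_imp_bounded)
  then obtain B0 where B0: "\<And>x. x \<in> K \<Longrightarrow> \<bar>h x\<bar> \<le> B0"
    unfolding bounded_iff by auto
  define B where "B = max B0 0"
  have B: "\<bar>h x\<bar> \<le> B" "B \<ge> 0" for x
  proof -
    show "B \<ge> 0" by (simp add: B_def)
    show "\<bar>h x\<bar> \<le> B"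
    proof (cases "x \<in> K")
      case True
      show ?thesis using B0[OF True] unfolding B_def by (simp add: le_max_iff_disj)
    qed (simp add: h0 B_def)
  qed
  obtain R where R: "\<And>x. x \<in> K \<Longrightarrow> norm x \<le> R"
    using compact_imp_bounded[OF K(1)] unfolding bounded_iff by auto
  \<comment> \<open>The margin \<open>norm v\<close> guarantees, since t n is at most 1, that for x
    outside K' neither x nor x + t n v lies in K, so all quotients vanish there.\<close>
  define K' where "K' = cball (0::'a) (R + norm v)"
  define t where "t n = 1 / (real n + 1)" for n
  have t: "0 < t n" "t n \<le> 1" for n by (auto simp: t_def)
  define s where "s n x = (F (x + t n *\<^sub>R v) - F x) / t n" for n x
  have contF: "continuous_on UNIV F"
    using F by (meson continuous_at_imp_continuous_on has_derivative_continuous)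
  have intF: "integrable lborel F"
  proof -
    have "integrable lborel (\<lambda>x. indicator UNIV x * F x)"
      using contF K by (intro integrable_compact_support) auto
    then show ?thesis by simp
  qed
  have intFt: "integrable lborel (\<lambda>x. F (x + a))" "(\<integral>x. F (x + a) \<partial>lborel) = (\<integral>x. F x \<partial>lborel)" for a
  proof -
    have d: "lborel = distr lborel borel ((+) a)" by (rule lborel_distr_plus[symmetric])
    have "integrable (distr lborel borel ((+) a)) F" using intF d by simp
    then show "integrable lborel (\<lambda>x. F (x + a))"
      by (subst (asm) integrable_distr_eq) (use contF in \<open>auto simp: add.commute intro: borel_measurable_continuous_onI\<close>)
    have "(\<integral>x. F x \<partial>distr lborel borel ((+) a)) = (\<integral>x. F (x + a) \<partial>lborel)"
      by (subst integral_distr) (use contF in \<open>auto simp: add.commute intro: borel_measurable_continuous_onI\<close>)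
    then show "(\<integral>x. F (x + a) \<partial>lborel) = (\<integral>x. F x \<partial>lborel)" using d by simp
  qed
  have s0: "(\<integral>x. s n x \<partial>lborel) = 0" for n
    unfolding s_def using intF intFt by simp
  have line: "((\<lambda>r. F (x + r *\<^sub>R v)) has_real_derivative h (x + r *\<^sub>R v)) (at r)" for x r
  proof -
    have "((\<lambda>r. x + r *\<^sub>R v) has_derivative (\<lambda>k. k *\<^sub>R v)) (at r)"
      by (auto intro!: derivative_eq_intros)
    from diff_chain_at[OF this F] have "((\<lambda>r. F (x + r *\<^sub>R v)) has_derivative (\<lambda>k. F' (x + r *\<^sub>R v) (k *\<^sub>R v))) (at r)"
      by (simp add: o_def)
    moreover have "F' (x + r *\<^sub>R v) (k *\<^sub>R v) = h (x + r *\<^sub>R v) * k" for k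
      using linear_scale[OF has_derivative_linear[OF F]] by (simp add: h_def)
    ultimately show ?thesis by (simp add: has_field_derivative_def)
  qed
  have bound: "norm (s n x) \<le> B * indicator K' x" for n x
  proof (cases "x \<in> K'")
    case True
    \<comment> \<open>The mean value theorem on the segment makes the quotient a value of h, so the
      bound does not depend on n.\<close>
    obtain \<xi> where "F (x + t n *\<^sub>R v) - F (x + 0 *\<^sub>R v) = (t n - 0) * h (x + \<xi> *\<^sub>R v)"
      using MVT2[of 0 "t n" "\<lambda>r. F (x + r *\<^sub>R v)" "\<lambda>r. h (x + r *\<^sub>R v)"] line t by blast
    then have "s n x = h (x + \<xi> *\<^sub>R v)" using t[of n] by (simp add: s_def)
    then show ?thesis using B True by simp
  next
    case False
    then have nx: "norm x > R + norm v" by (simp add: K'_def)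
    have "norm (t n *\<^sub>R v) \<le> norm v" using t[of n] mult_right_mono[of "t n" 1 "norm v"] by simp
    then have "norm (x + t n *\<^sub>R v) > R"
      using nx norm_diff_ineq[of x "t n *\<^sub>R v"] by linarith
    then have "x + t n *\<^sub>R v \<notin> K" "x \<notin> K" using R[of x] R[of "x + t n *\<^sub>R v"] nx norm_ge_zero[of v] by auto
    then show ?thesis using K(2) B by (simp add: s_def)
  qed
  have lim: "(\<lambda>n. s n x) \<longlonglongrightarrow> h x" for x
  proof -
    have "((\<lambda>r. (F (x + r *\<^sub>R v) - F x) / r) \<longlongrightarrow> h x) (at 0)"
      using line[of x 0] by (simp add: DERIV_def)
    moreover have "filterlim t (at 0) sequentially"
      unfolding filterlim_at
    proof
      show "\<forall>\<^sub>F n in sequentially. t n \<in> UNIV \<and> t n \<noteq> 0" using t by (simp add: less_imp_neq[symmetric])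
      show "t \<longlonglongrightarrow> 0"
        unfolding t_def using LIMSEQ_inverse_real_of_nat by (simp add: inverse_eq_divide add.commute)
    qed
    ultimately show ?thesis unfolding s_def by (rule filterlim_compose)
  qed
  have "(\<lambda>n. \<integral>x. s n x \<partial>lborel) \<longlonglongrightarrow> (\<integral>x. h x \<partial>lborel)"
  proof (rule integral_dominated_convergence[where w="\<lambda>x. B * indicator K' x"])
    show "h \<in> borel_measurable lborel"
      using cont by (auto simp: h_def intro: borel_measurable_continuous_onI)
    show "s n \<in> borel_measurable lborel" for n
      using intF intFt[of "t n *\<^sub>R v"] unfolding s_def by auto
    show "integrable lborel (\<lambda>x. B * indicator K' x)"
      using emeasure_lborel_cball_finite[of "0::'a" "R + norm v"]
      by (intro integrable_mult_right integrable_real_indicator) (auto simp: K'_def)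
  qed (use lim bound in auto)
  then show ?thesis using s0 LIMSEQ_unique[OF _ tendsto_const[of 0]] by (simp add: h_def)
qed

text \<open>Outside S the function G is arbitrary. Its extension by zero is C^1 on S and on the
  complement of K, and these two open sets cover the whole space.\<close>

lemma integral_frechet_compact_support:
  fixes G :: "'a::euclidean_space \<Rightarrow> real"
  assumes S: "open S" and G: "Ck_on (Suc 0) S G" and K: "compact K" "K \<subseteq> S" "\<And>x. x \<in> S - K \<Longrightarrow> G x = 0"
  shows "(\<integral>x. indicator S x * frechet_derivative G (at x) v \<partial>lborel) = 0"
    "\<And>x. x \<in> S - K \<Longrightarrow> frechet_derivative G (at x) v = 0"
proof -
  define F where "F x = (if x \<in> S then G x else 0)" for x
  have oK: "open (- K)" using K(1) by (simp add: open_Compl compact_imp_closed)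
  have F0: "F x = 0" if "x \<in> - K" for x using that K(3) by (auto simp: F_def)
  have "Ck_on (Suc 0) S F"
    using Ck_on_cong[OF S, of F G "Suc 0"] G by (simp add: F_def del: Ck_on.simps)
  moreover have "Ck_on (Suc 0) (- K) F"
    by (rule Ck_on_cong[OF oK, of F "\<lambda>x. 0", THEN iffD2]) (simp_all only: F0 Ck_on_const)
  ultimately have "Ck_on (Suc 0) (S \<union> - K) F" by (rule Ck_on_Un) (rule S oK)+
  moreover have "S \<union> - K = UNIV" using K(2) by blast
  ultimately have C: "Ck_on (Suc 0) UNIV F" by simp
  have D0: "frechet_derivative F (at x) = (\<lambda>v. 0)" if "x \<in> - K" for x
    using frechet_derivative_cong[OF oK that F0] frechet_derivative_eq[OF has_derivative_const, of x 0] by simp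
  have DS: "frechet_derivative F (at x) = frechet_derivative G (at x)" if "x \<in> S" for x
    by (rule frechet_derivative_cong[OF S that]) (simp add: F_def)
  have "(\<integral>x. frechet_derivative F (at x) v \<partial>lborel) = 0"
    using C F0 K(1) by (intro integral_derivative_compact_support[of F _ v K])
      (auto simp: differentiable_has_frechet)
  moreover have "frechet_derivative F (at x) v = indicator S x * frechet_derivative G (at x) v" for x
  proof (cases "x \<in> S")
    case False
    then have "x \<notin> K" using K(2) by blast
    then show ?thesis using False D0[of x] by simp
  qed (simp add: DS)
  ultimately show "(\<integral>x. indicator S x * frechet_derivative G (at x) v \<partial>lborel) = 0" by simp
  show "frechet_derivative G (at x) v = 0" if "x \<in> S - K" for x
    using that D0[of x] DS[of x] by auto
qed

lemma continuous_on_gram_trace: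
  assumes "\<And>x. x \<in> S \<Longrightarrow> gram_det (\<Phi> x) > 0" "\<And>v. continuous_on S (\<lambda>x. \<Phi> x v)"
    "\<And>v. continuous_on S (\<lambda>x. \<alpha> x v)" "\<And>v. continuous_on S (\<lambda>x. \<beta> x v)"
  shows "continuous_on S (\<lambda>x. gram_trace (\<Phi> x) (\<alpha> x) (\<beta> x))"
proof -
  have "continuous_on S (\<lambda>x. gram_det (\<Phi> x))"
    unfolding gram_det_def using assms(2) by (intro continuous_intros)
  then show ?thesis
    unfolding gram_trace_def using assms by (intro continuous_intros) (auto dest: assms(1))
qed

text \<open>A C^1 profile vanishing on a half line, for the bump functions. Its derivative is 2
  max(0, t); only t = 0 requires the difference quotient.\<close>

lemma Ck_on_max_0_square: "Ck_on (Suc 0) UNIV (\<lambda>t::real. (max 0 t)\<^sup>2)"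
proof (rule Ck_on_SucI[OF open_UNIV])
  fix t :: real
  have "((\<lambda>t. (max 0 t)\<^sup>2) has_real_derivative 2 * max 0 t) (at t)"
  proof (cases "t = 0")
    case False
    show ?thesis
    proof (cases "t > 0")
      case True
      have "((\<lambda>t::real. t\<^sup>2) has_real_derivative 2 * t) (at t)" by (auto intro!: derivative_eq_intros)
      then show ?thesis
        using True has_field_derivative_transform_within_open[of "\<lambda>t. t\<^sup>2" "2 * t" t "{0<..}" "\<lambda>t. (max 0 t)\<^sup>2"] by simp
    next
      case nt: False
      have "((\<lambda>t::real. 0) has_real_derivative 0) (at t)" by simp
      then show ?thesis
        using nt False has_field_derivative_transform_within_open[of "\<lambda>t. 0" "0" t "{..<0}" "\<lambda>t. (max 0 t)\<^sup>2"] by simp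
    qed
  next
    case True
    have "(\<lambda>h::real. (max 0 h)\<^sup>2 / h) \<midarrow>0\<rightarrow> 0"
    proof (rule Lim_null_comparison)
      show "\<forall>\<^sub>F h in at 0. norm ((max 0 h)\<^sup>2 / h) \<le> \<bar>h::real\<bar>"
        by (rule always_eventually) (auto simp: max_def power2_eq_square)
      show "(\<lambda>h::real. \<bar>h\<bar>) \<midarrow>0\<rightarrow> 0" using tendsto_rabs_zero[OF tendsto_ident_at] .
    qed
    then show ?thesis using True by (simp add: DERIV_def)
  qed
  then show "((\<lambda>t. (max 0 t)\<^sup>2) has_derivative (\<lambda>v. 2 * max 0 t * v)) (at t)"
    by (simp add: has_field_derivative_def)
  show "Ck_on 0 UNIV (\<lambda>t. 2 * max 0 t * v)" for v :: real
    by (auto intro!: continuous_intros)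
qed

section \<open>The Laplacian\<close>

context immersed
begin

text \<open>The inner product of the gradients of u and f. The gradients themselves are never
  formed, since it is the metric trace of the two differentials.\<close>

definition grad_prod :: "('a \<Rightarrow> real) \<Rightarrow> ('a \<Rightarrow> real) \<Rightarrow> 'a \<Rightarrow> real" where
  "grad_prod u f p = (let c = chart_at \<A> p in gram_trace (dmap c \<phi> p) (dmap c u p) (dmap c f p))"

lemma gram_trace_change_chart:
  assumes "c \<in> \<A>" "d \<in> \<A>" "p \<in> fst c" "p \<in> fst d" "linear \<alpha>" "linear \<beta>"
  shows "gram_trace (dmap c \<phi> p) (\<alpha> \<circ> dmap c (snd d) p) (\<beta> \<circ> dmap c (snd d) p) = gram_trace (dmap d \<phi> p) \<alpha> \<beta>"
proof -
  have "det (matrix (dmap c (snd d) p)) \<noteq> 0"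
    using linear_transition[OF assms(1-4)] inj_transition[OF assms(1-4)]
    by (simp add: det_nz_iff_inj)
  then show ?thesis
    unfolding dmap_change_chart[OF assms(1-4) Ck]
    by (intro gram_trace_compose linear_dmap[OF assms(2,4) Ck] assms)
qed

lemma grad_prod_chart:
  assumes c: "c \<in> \<A>" "p \<in> fst c" and u: "Ck_map (Suc 0) \<A> u" and f: "Ck_map (Suc 0) \<A> f"
  shows "grad_prod u f p = gram_trace (dmap c \<phi> p) (dmap c u p) (dmap c f p)"
proof -
  have "p \<in> topspace X" using c chart_subset by blast
  note d = chart_at[OF this, THEN conjunct1] chart_at[OF this, THEN conjunct2]
  show ?thesis
    unfolding grad_prod_def Let_def dmap_change_chart[OF d(1) c(1) d(2) c(2) u] dmap_change_chart[OF d(1) c(1) d(2) c(2) f]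
    by (rule gram_trace_change_chart[OF d(1) c(1) d(2) c(2) linear_dmap[OF c u] linear_dmap[OF c f]])
qed

text \<open>Serves both \<open>grad_prod\<close> and |A|^2. The formula is required in every chart
  and not just in \<open>chart_at\<close>, because the chosen chart may jump from point to
  point.\<close>

lemma continuous_gram_trace:
  assumes "\<And>c p. c \<in> \<A> \<Longrightarrow> p \<in> fst c \<Longrightarrow> h p = gram_trace (dmap c \<phi> p) (\<alpha> c (snd c p)) (\<beta> c (snd c p))"
    and "\<And>c v. c \<in> \<A> \<Longrightarrow> continuous_on (snd c ` fst c) (\<lambda>x. \<alpha> c x v)"
    and "\<And>c v. c \<in> \<A> \<Longrightarrow> continuous_on (snd c ` fst c) (\<lambda>x. \<beta> c x v)"
  shows "continuous_map X euclidean h"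
proof (rule continuous_mapI)
  fix c assume c: "c \<in> \<A>"
  let ?\<Phi> = "\<lambda>x. frechet_derivative (in_chart c \<phi>) (at x)"
  have "continuous_on (snd c ` fst c) (\<lambda>x. gram_trace (?\<Phi> x) (\<alpha> c x) (\<beta> c x))"
  proof (rule continuous_on_gram_trace)
    show "gram_det (?\<Phi> x) > 0" if "x \<in> snd c ` fst c" for x
      using det_metric_pos[OF c that] by (simp add: det_metric)
    show "continuous_on (snd c ` fst c) (\<lambda>x. ?\<Phi> x v)" for v
      using Ck_partial[OF c Ck] by (rule Ck_on_imp_continuous_on)
  qed (use assms(2,3) c in auto)
  moreover have "gram_trace (?\<Phi> x) (\<alpha> c x) (\<beta> c x) = in_chart c h x" if x: "x \<in> snd c ` fst c" for x
  proof -
    obtain p where p: "p \<in> fst c" "x = snd c p" using x by blast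
    show ?thesis
      using assms(1)[OF c p(1)] in_chart_apply[OF chart[OF c] p(1), of h] by (simp add: dmap_def p(2))
  qed
  ultimately show "continuous_on (snd c ` fst c) (in_chart c h)"
    by (rule continuous_on_eq)
qed

lemma continuous_grad_prod:
  assumes u: "Ck_map (Suc 0) \<A> u" and f: "Ck_map (Suc 0) \<A> f"
  shows "continuous_map X euclidean (grad_prod u f)"
proof (rule continuous_gram_trace)
  show "grad_prod u f p = gram_trace (dmap c \<phi> p) (frechet_derivative (in_chart c u) (at (snd c p)))
      (frechet_derivative (in_chart c f) (at (snd c p)))" if "c \<in> \<A>" "p \<in> fst c" for c p
    using grad_prod_chart[OF that u f] by (simp add: dmap_def)
qed (use Ck_partial[OF _ u] Ck_partial[OF _ f] Ck_on_imp_continuous_on in blast)+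

lemma grad_prod_self_nonneg:
  assumes "p \<in> topspace X"
  shows "grad_prod f f p \<ge> 0"
  unfolding grad_prod_def Let_def using chart_at[OF assms] by (intro gram_trace_nonneg gram_pos) auto

text \<open>The i-th coordinate component of the vector density (det g)^(1/2) grad f, whose
  coordinate divergence is (det g)^(1/2) times the Laplacian of f.\<close>

definition flux :: "'a chart \<Rightarrow> ('a \<Rightarrow> real) \<Rightarrow> 2 \<Rightarrow> real^2 \<Rightarrow> real" where
  "flux c f i y = dens c y * (\<Sum>j\<in>UNIV. matrix_inv (metric c \<phi> y) $ i $ j * partial_deriv j (in_chart c f) y)"

definition lap :: "'a chart \<Rightarrow> ('a \<Rightarrow> real) \<Rightarrow> real^2 \<Rightarrow> real" where
  "lap c f x = (\<Sum>i\<in>UNIV. partial_deriv i (flux c f i) x) / dens c x"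

lemma laplacian_eq: "laplacian \<A> \<phi> f p = lap (chart_at \<A> p) f (snd (chart_at \<A> p) p)"
  by (simp add: laplacian_def lap_def flux_def[abs_def] Let_def)

lemma Ck_matrix_inv:
  assumes c: "c \<in> \<A>"
  shows "Ck_on n (snd c ` fst c) (\<lambda>y. matrix_inv (metric c \<phi> y) $ i $ j)"
proof -
  let ?S = "snd c ` fst c"
  have o: "open ?S" by (rule chart_open[OF chart[OF c]])
  have nz: "det (metric c \<phi> y) \<noteq> 0" if "y \<in> ?S" for y using det_metric_pos[OF c that] by simp
  have q: "Ck_on n ?S (\<lambda>y. s * (metric c \<phi> y $ k $ l * inverse (det (metric c \<phi> y))))" for s k l
    by (intro Ck_on_mult Ck_on_inverse Ck_on_const o Ck_metric[OF c] Ck_det_metric[OF c] nz)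
  have "\<exists>s k l. \<forall>y\<in>?S. matrix_inv (metric c \<phi> y) $ i $ j = s * (metric c \<phi> y $ k $ l * inverse (det (metric c \<phi> y)))"
  proof -
    consider "i = 1" "j = 1" | "i = 1" "j = 2" | "i = 2" "j = 1" | "i = 2" "j = 2" using exhaust_2 by metis
    then show ?thesis
    proof cases
      case 1 then show ?thesis by (intro exI[of _ 1] exI[of _ 2]) (simp add: matrix_inv_2 nz divide_inverse)
    next
      case 2 then show ?thesis by (intro exI[of _ "-1"] exI[of _ 1] exI[of _ 2]) (simp add: matrix_inv_2 nz divide_inverse)
    next
      case 3 then show ?thesis by (intro exI[of _ "-1"] exI[of _ 2] exI[of _ 1]) (simp add: matrix_inv_2 nz divide_inverse)
    next
      case 4 then show ?thesis by (intro exI[of _ 1]) (simp add: matrix_inv_2 nz divide_inverse)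
    qed
  qed
  then obtain s k l where "\<And>y. y \<in> ?S \<Longrightarrow> matrix_inv (metric c \<phi> y) $ i $ j = s * (metric c \<phi> y $ k $ l * inverse (det (metric c \<phi> y)))"
    by blast
  then show ?thesis by (rule Ck_on_cong[OF o, THEN iffD2]) (simp_all add: q)
qed

lemma Ck_flux:
  assumes c: "c \<in> \<A>" and f: "Ck_map (Suc n) \<A> f"
  shows "Ck_on n (snd c ` fst c) (flux c f i)"
  unfolding flux_def[abs_def] partial_deriv_def
  by (intro Ck_on_mult Ck_on_sum chart_open[OF chart[OF c]] Ck_dens[OF c] Ck_matrix_inv[OF c] Ck_partial[OF c f])

lemma continuous_lap:
  assumes c: "c \<in> \<A>" and f: "Ck_map (Suc (Suc 0)) \<A> f"
  shows "continuous_on (snd c ` fst c) (lap c f)"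
proof -
  have "continuous_on (snd c ` fst c) (\<lambda>x. partial_deriv i (flux c f i) x)" for i
    using Ck_flux[OF c f, of i] by (simp add: partial_deriv_def)
  moreover have "\<forall>x\<in>snd c ` fst c. dens c x \<noteq> 0"
    using det_metric_pos[OF c] by (intro ballI) (simp add: less_imp_neq[symmetric])
  ultimately show ?thesis
    unfolding lap_def[abs_def] using continuous_on_dens[OF c]
    by (intro continuous_on_divide continuous_on_sum)
qed

text \<open>The coordinate Laplacian of one fixed chart, transported to X. With the default 0 its
  product with a function supported in the chart is continuous on all of X.\<close>

definition lapc :: "'a chart \<Rightarrow> ('a \<Rightarrow> real) \<Rightarrow> 'a \<Rightarrow> real" where
  "lapc c f p = (if p \<in> fst c then lap c f (snd c p) else 0)"

lemma in_chart_mult: "in_chart c (\<lambda>p. u p * f p) x = in_chart c u x * in_chart c f x"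
  by (simp add: in_chart_def)

lemma in_chart_lapc: "c \<in> \<A> \<Longrightarrow> x \<in> snd c ` fst c \<Longrightarrow> in_chart c (lapc c f) x = lap c f x"
  by (auto simp: in_chart_apply[OF chart] lapc_def)

lemma compactin_closedin: "compactin X K \<Longrightarrow> closedin X K"
  using compactin_imp_closedin Hausdorff by blast

lemma compact_chart_image:
  assumes "c \<in> \<A>" "compactin X K" "K \<subseteq> fst c"
  shows "compact (snd c ` K)"
proof -
  have "compactin (subtopology X (fst c)) K" using assms by (simp add: compactin_subtopology)
  then have "compactin (top_of_set (snd c ` fst c)) (snd c ` K)"
    using image_compactin homeomorphic_imp_continuous_map[OF chart_homeo[OF chart[OF assms(1)]]] by blast
  then show ?thesis by (simp add: compactin_subtopology)
qed

lemma continuous_mult_lapc: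
  assumes c: "c \<in> \<A>" and f: "Ck_map (Suc (Suc 0)) \<A> f" and u: "Ck_map n \<A> u"
    and K: "compactin X K" "K \<subseteq> fst c" "\<And>p. p \<in> topspace X - K \<Longrightarrow> u p = 0"
  shows "continuous_map X euclidean (\<lambda>p. u p * lapc c f p)"
proof (rule Ck_map_continuous[OF Ck_map_zero_extension[OF c _ compactin_closedin[OF K(1)] K(2)]])
  have "continuous_on (snd c ` fst c) (in_chart c u)"
    using u c by (auto simp: Ck_map_def intro: Ck_on_imp_continuous_on)
  then have "continuous_on (snd c ` fst c) (\<lambda>x. in_chart c u x * lap c f x)"
    using continuous_lap[OF c f] by (intro continuous_intros)
  then show "Ck_on 0 (snd c ` fst c) (in_chart c (\<lambda>p. u p * lapc c f p))"
    unfolding Ck_on.simps by (rule continuous_on_eq) (simp add: in_chart_mult in_chart_lapc[OF c])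
qed (simp add: K(3))

text \<open>By the product rule, the coordinate divergence of u times the flux of f is (det g)^(1/2)
  times the sum of u \<Delta>f and the gradient product; its integral vanishes by compact
  support.\<close>

lemma weak_laplacian:
  assumes c: "c \<in> \<A>" and f: "Ck_map (Suc (Suc 0)) \<A> f" and u: "Ck_map (Suc 0) \<A> u"
    and K: "compactin X K" "K \<subseteq> fst c" "\<And>p. p \<in> topspace X - K \<Longrightarrow> u p = 0"
  shows "(\<integral>p. u p * lapc c f p \<partial>\<mu>) = - (\<integral>p. grad_prod u f p \<partial>\<mu>)"
proof -
  let ?S = "snd c ` fst c" and ?u = "in_chart c u" and ?K = "snd c ` K"
  let ?I = "indicator ?S :: real^2 \<Rightarrow> real"
  have o: "open ?S" by (rule chart_open[OF chart[OF c]])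
  have cK: "compact ?K" "?K \<subseteq> ?S" using compact_chart_image[OF c K(1,2)] K(2) by auto
  have f1: "Ck_map (Suc 0) \<A> f" by (rule Ck_map_mono[OF f]) simp
  have Cu: "Ck_on (Suc 0) ?S ?u" using u c by (simp add: Ck_map_def)
  have u0: "?u x = 0" if x: "x \<in> ?S - ?K" for x
  proof -
    obtain q where q: "q \<in> fst c" "x = snd c q" using x by blast
    then have "q \<in> topspace X - K" using x chart_subset[OF c] by blast
    then show ?thesis using K(3)[of q] in_chart_apply[OF chart[OF c] q(1), of u] q(2) by simp
  qed
  have Du0: "frechet_derivative ?u (at x) v = 0" if "x \<in> ?S - ?K" for x v
    by (rule integral_frechet_compact_support(2)[OF o Cu cK u0 that])
  define g where "g x = in_chart c (grad_prod u f) x" for x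
  have g: "g x = gram_trace (frechet_derivative (in_chart c \<phi>) (at x)) (frechet_derivative ?u (at x)) (frechet_derivative (in_chart c f) (at x))"
    if "x \<in> ?S" for x
    using that grad_prod_chart[OF c _ u f1] by (auto simp: g_def in_chart_apply[OF chart[OF c]] dmap_def)
  have g0: "g x = 0" if "x \<in> ?S - ?K" for x
    using that g[of x] Du0[OF that] by (simp add: gram_trace_def)
  have cont_g: "continuous_on ?S g"
    unfolding g_def using in_chart_continuous_on[OF chart[OF c] continuous_grad_prod[OF u f1]] by simp
  \<comment> \<open>At p \<open>grad_prod\<close> is evaluated in a chart other than c. As K is
    closed, u vanishes in that chart near p, and so does its differential.\<close>
  have grad0: "grad_prod u f p = 0" if "p \<in> topspace X - fst c" for p
  proof -
    note d = chart_at[of p, THEN conjunct1] chart_at[of p, THEN conjunct2]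
    have p: "p \<in> topspace X" "p \<notin> K" using that K(2) by auto
    let ?d = "chart_at \<A> p"
    have "open (snd ?d ` (fst ?d - K))"
      using chart_openin[OF chart[OF d(1)[OF p(1)]]] compactin_closedin[OF K(1)]
      by (intro chart_open_image[OF chart[OF d(1)[OF p(1)]]] openin_diff) auto
    moreover have "in_chart ?d u y = 0" if "y \<in> snd ?d ` (fst ?d - K)" for y
      using that K(3) chart_subset[OF d(1)[OF p(1)]] by (auto simp: in_chart_apply[OF chart[OF d(1)[OF p(1)]]])
    ultimately have "dmap ?d u p = frechet_derivative (\<lambda>y. 0) (at (snd ?d p))"
      unfolding dmap_def using d(2)[OF p(1)] p(2) by (intro frechet_derivative_cong) auto
    then have "dmap ?d u p = (\<lambda>v. 0)" using frechet_derivative_eq[OF has_derivative_const] by simp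
    then show ?thesis by (simp add: grad_prod_def gram_trace_zero)
  qed
  have W: "flux c f i differentiable (at x)" if "x \<in> ?S" for i x
    using Ck_flux[OF c f, of i] that unfolding Ck_on.simps by blast
  have Du: "?u differentiable (at x)" if "x \<in> ?S" for x
    using Cu that unfolding Ck_on.simps by blast
  have CuW: "Ck_on (Suc 0) ?S (\<lambda>x. ?u x * flux c f i x)" for i
    by (intro Ck_on_mult o Cu Ck_flux[OF c f])
  have div: "(\<integral>x. ?I x * frechet_derivative (\<lambda>x. ?u x * flux c f i x) (at x) (axis i 1) \<partial>lborel) = 0" for i
    by (rule integral_frechet_compact_support(1)[OF o CuW cK]) (simp add: u0)
  have split: "dens c x * (?u x * lap c f x) + dens c x * g x =
      (\<Sum>i\<in>UNIV. frechet_derivative (\<lambda>x. ?u x * flux c f i x) (at x) (axis i 1))" if x: "x \<in> ?S" for x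
  proof -
    have "frechet_derivative (\<lambda>x. ?u x * flux c f i x) (at x) (axis i 1)
        = ?u x * partial_deriv i (flux c f i) x + partial_deriv i ?u x * flux c f i x" for i
      using frechet_derivative_eq[OF has_derivative_mult[OF differentiable_has_frechet[OF Du[OF x]] differentiable_has_frechet[OF W[OF x]]], of i]
      by (simp add: partial_deriv_def)
    then have "(\<Sum>i\<in>UNIV. frechet_derivative (\<lambda>x. ?u x * flux c f i x) (at x) (axis i 1))
      = ?u x * (\<Sum>i\<in>UNIV. partial_deriv i (flux c f i) x) + (\<Sum>i\<in>UNIV. partial_deriv i ?u x * flux c f i x)"
      by (simp add: sum.distrib sum_distrib_left)
    moreover have "(\<Sum>i\<in>UNIV. partial_deriv i (flux c f i) x) = dens c x * lap c f x"
      using det_metric_pos[OF c x] by (simp add: lap_def)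
    moreover have "(\<Sum>i\<in>UNIV. partial_deriv i ?u x * flux c f i x) = dens c x * g x"
    proof -
      have "gram_det (frechet_derivative (in_chart c \<phi>) (at x)) \<noteq> 0"
        using det_metric_pos[OF c x] by (simp add: det_metric)
      note m = metric_inv_trace[OF this, of "frechet_derivative ?u (at x)" "frechet_derivative (in_chart c f) (at x)"]
      show ?thesis
        unfolding g[OF x] m[symmetric] flux_def partial_deriv_def
        by (simp add: sum_distrib_left mult_ac)
    qed
    ultimately show ?thesis by (simp add: mult_ac)
  qed
  have cD: "continuous_on ?S (\<lambda>x. frechet_derivative (\<lambda>x. ?u x * flux c f i x) (at x) (axis i 1))" for i
    using CuW[of i] by simp
  have iD: "integrable lborel (\<lambda>x. ?I x * frechet_derivative (\<lambda>x. ?u x * flux c f i x) (at x) (axis i 1))" for i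
    by (rule integrable_compact_support[OF cD cK])
       (rule integral_frechet_compact_support(2)[OF o CuW cK], simp_all add: u0)
  have iA: "integrable lborel (\<lambda>x. ?I x * (dens c x * (?u x * lap c f x)))"
    using continuous_on_dens[OF c] continuous_lap[OF c f] Ck_on_imp_continuous_on[OF Cu]
    by (intro integrable_compact_support[OF _ cK] continuous_on_mult) (simp_all add: u0)
  have iB: "integrable lborel (\<lambda>x. ?I x * (dens c x * g x))"
    using continuous_on_dens[OF c] cont_g by (intro integrable_compact_support[OF _ cK] continuous_on_mult) (simp_all add: g0)
  have "(\<integral>x. ?I x * (dens c x * (?u x * lap c f x)) \<partial>lborel) + (\<integral>x. ?I x * (dens c x * g x) \<partial>lborel)
      = (\<integral>x. ?I x * (dens c x * (?u x * lap c f x)) + ?I x * (dens c x * g x) \<partial>lborel)"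
    by (rule Bochner_Integration.integral_add[OF iA iB, symmetric])
  also have "\<dots> = (\<integral>x. (\<Sum>i\<in>UNIV. ?I x * frechet_derivative (\<lambda>x. ?u x * flux c f i x) (at x) (axis i 1)) \<partial>lborel)"
  proof (rule Bochner_Integration.integral_cong[OF refl])
    show "?I x * (dens c x * (?u x * lap c f x)) + ?I x * (dens c x * g x)
        = (\<Sum>i\<in>UNIV. ?I x * frechet_derivative (\<lambda>x. ?u x * flux c f i x) (at x) (axis i 1))" for x
      using split[of x] by (cases "x \<in> ?S") simp_all
  qed
  also have "\<dots> = (\<Sum>i\<in>UNIV. \<integral>x. ?I x * frechet_derivative (\<lambda>x. ?u x * flux c f i x) (at x) (axis i 1) \<partial>lborel)"
    using iD by (intro Bochner_Integration.integral_sum) auto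
  also have "\<dots> = 0" by (simp add: div)
  finally have eq: "(\<integral>x. ?I x * (dens c x * (?u x * lap c f x)) \<partial>lborel) = - (\<integral>x. ?I x * (dens c x * g x) \<partial>lborel)"
    by simp
  have "(\<integral>p. u p * lapc c f p \<partial>\<mu>) = (\<integral>x. ?I x * (dens c x * in_chart c (\<lambda>p. u p * lapc c f p) x) \<partial>lborel)"
    using continuous_mult_lapc[OF c f u K]
    by (intro integral_chart[OF c] continuous_map_measurable) (auto simp: lapc_def)
  also have "\<dots> = (\<integral>x. ?I x * (dens c x * (?u x * lap c f x)) \<partial>lborel)"
    by (intro Bochner_Integration.integral_cong) (auto simp: indicator_def in_chart_mult in_chart_lapc[OF c])
  also have "\<dots> = - (\<integral>p. grad_prod u f p \<partial>\<mu>)"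
    unfolding eq g_def using integral_chart[OF c continuous_map_measurable[OF continuous_grad_prod[OF u f1]] grad0] by simp
  finally show ?thesis .
qed

section \<open>Test functions and chart independence of the Laplacian\<close>

lemma bump_exists:
  assumes c: "c \<in> \<A>" and V: "openin X V" "V \<subseteq> fst c" and p: "p \<in> V"
  shows "\<exists>u K. Ck_map (Suc 0) \<A> u \<and> compactin X K \<and> K \<subseteq> V \<and>
    (\<forall>q\<in>topspace X - K. u q = 0) \<and> (\<forall>q. u q \<ge> (0::real)) \<and> u p > 0"
proof -
  let ?S = "snd c ` fst c"
  have "open (snd c ` V)" by (rule chart_open_image[OF chart[OF c] V])
  then obtain r where r: "r > 0" "cball (snd c p) r \<subseteq> snd c ` V"
    using p open_contains_cball by blast
  define K where "K = {q \<in> fst c. snd c q \<in> cball (snd c p) r}"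
  \<comment> \<open>Positive exactly on the open ball of radius r around the coordinates of p. The
    closed ball lies in the image of V, which makes K a compact subset of V.\<close>
  define b where "b x = (max 0 (r\<^sup>2 - (x - snd c p) \<bullet> (x - snd c p)))\<^sup>2" for x
  define u where "u q = (if q \<in> fst c then b (snd c q) else 0)" for q
  have K: "compactin X K" "K \<subseteq> fst c"
    unfolding K_def using r(2) V(2) chart_compactin[OF chart[OF c] compact_cball, of "snd c p" r] by blast+
  have KV: "K \<subseteq> V"
  proof
    fix q assume "q \<in> K"
    then have q: "q \<in> fst c" "snd c q \<in> snd c ` V" using r(2) by (auto simp: K_def)
    then show "q \<in> V" using inj_on_image_mem_iff[OF chart_inj[OF chart[OF c]] q(1) V(2)] by simp
  qed
  have u0: "u q = 0" if "q \<notin> K" for q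
  proof (cases "q \<in> fst c")
    case True
    then have "dist (snd c q) (snd c p) > r" using that by (simp add: K_def dist_commute)
    then have "r\<^sup>2 < (dist (snd c q) (snd c p))\<^sup>2" using r(1) by (intro power_strict_mono) auto
    then have "r\<^sup>2 < (snd c q - snd c p) \<bullet> (snd c q - snd c p)"
      by (simp add: dist_norm power2_norm_eq_inner)
    then show ?thesis by (simp add: u_def b_def)
  qed (simp add: u_def)
  have "Ck_on (Suc 0) UNIV (\<lambda>x::real^2. x + - snd c p)"
    by (intro Ck_on_add Ck_on_const Ck_on_linear bounded_linear_ident open_UNIV)
  then have d: "Ck_on (Suc 0) UNIV (\<lambda>x. x - snd c p)" by simp
  have "Ck_on (Suc 0) UNIV (\<lambda>x. r\<^sup>2 - (x - snd c p) \<bullet> (x - snd c p))"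
    by (intro Ck_on_diff Ck_on_const Ck_on_inner d open_UNIV)
  then have "Ck_on (Suc 0) UNIV b"
    unfolding b_def[abs_def]
    by (rule Ck_on_compose[where T=UNIV and g="\<lambda>t::real. (max 0 t)\<^sup>2", OF open_UNIV open_UNIV subset_UNIV _ Ck_on_max_0_square])
  then have bS: "Ck_on (Suc 0) ?S b" by (rule Ck_on_subset) simp
  have "in_chart c u x = b x" if x: "x \<in> ?S" for x
  proof -
    obtain q where q: "q \<in> fst c" "x = snd c q" using x by blast
    then show ?thesis using in_chart_apply[OF chart[OF c] q(1), of u] by (simp add: u_def)
  qed
  then have "Ck_on (Suc 0) ?S (in_chart c u)"
    using bS by (rule Ck_on_cong[OF chart_open[OF chart[OF c]], THEN iffD2])
  then have "Ck_map (Suc 0) \<A> u"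
    using u0 by (intro Ck_map_zero_extension[OF c _ compactin_closedin[OF K(1)] K(2)]) auto
  moreover have "u p > 0" using p V(2) r(1) by (auto simp: u_def b_def)
  moreover have "u q \<ge> 0" for q by (simp add: u_def b_def)
  ultimately show ?thesis using K(1) KV u0 by (intro exI[of _ u] exI[of _ K]) auto
qed

text \<open>Both sides have the same integral against every bump function, by the weak formula
  weak_laplacian, whose right-hand side is independent of the chart.\<close>

lemma lap_le:
  assumes c: "c \<in> \<A>" "p \<in> fst c" and d: "d \<in> \<A>" "p \<in> fst d" and f: "Ck_map (Suc (Suc 0)) \<A> f"
  shows "lapc c f p \<le> lapc d f p"
proof (rule ccontr)
  assume neg: "\<not> lapc c f p \<le> lapc d f p"
  \<comment> \<open>V is open and contains p. For a bump u supported in V the difference of the two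
    products with u is continuous, nonnegative and of integral zero, yet positive at p.\<close>
  define V where "V = {q \<in> fst c \<inter> fst d. lapc c f q > lapc d f q}"
  let ?S = "snd c ` (fst c \<inter> fst d)"
  have o: "open ?S" by (rule open_overlap[OF c(1) d(1)])
  have "continuous_on ?S (\<lambda>x. lap c f x - lap d f (in_chart c (snd d) x))"
  proof (rule continuous_on_diff)
    show "continuous_on ?S (lap c f)"
      by (rule continuous_on_subset[OF continuous_lap[OF c(1) f]]) auto
    show "continuous_on ?S (\<lambda>x. lap d f (in_chart c (snd d) x))"
    proof (rule continuous_on_compose2[OF continuous_lap[OF d(1) f]])
      show "continuous_on ?S (in_chart c (snd d))"
        using Ck_on_imp_continuous_on[OF Ck_transition[OF c(1) d(1)]] by blast
      show "in_chart c (snd d) ` ?S \<subseteq> snd d ` fst d"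
        using in_chart_image[OF chart[OF c(1)], of "fst c \<inter> fst d" "snd d"] by auto
    qed
  qed
  then have "open ((\<lambda>x. lap c f x - lap d f (in_chart c (snd d) x)) -` {0<..} \<inter> ?S)"
    using o by (simp add: continuous_on_open_vimage)
  then have "openin X {q \<in> fst c. snd c q \<in> (\<lambda>x. lap c f x - lap d f (in_chart c (snd d) x)) -` {0<..} \<inter> ?S}"
    by (rule chart_openin_preimage[OF chart[OF c(1)]])
  moreover have "{q \<in> fst c. snd c q \<in> (\<lambda>x. lap c f x - lap d f (in_chart c (snd d) x)) -` {0<..} \<inter> ?S} = V"
  proof -
    have "snd c q \<in> (\<lambda>x. lap c f x - lap d f (in_chart c (snd d) x)) -` {0<..} \<inter> ?S \<longleftrightarrow> q \<in> V" if q: "q \<in> fst c" for q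
      using inj_on_image_mem_iff[OF chart_inj[OF chart[OF c(1)]] q, of "fst c \<inter> fst d"] q
        in_chart_apply[OF chart[OF c(1)] q, of "snd d"] by (auto simp: V_def lapc_def)
    then show ?thesis by (auto simp: V_def)
  qed
  ultimately have V: "openin X V" by simp
  have Vc: "V \<subseteq> fst c" "V \<subseteq> fst d" by (auto simp: V_def)
  have "p \<in> V" using neg c d by (simp add: V_def)
  from bump_exists[OF c(1) V Vc(1) this] obtain u K where uK: "Ck_map (Suc 0) \<A> u \<and> compactin X K \<and> K \<subseteq> V \<and>
    (\<forall>q\<in>topspace X - K. u q = 0) \<and> (\<forall>q. u q \<ge> (0::real)) \<and> u p > 0" by blast
  then have u: "Ck_map (Suc 0) \<A> u"
    and K: "compactin X K" "K \<subseteq> V" "\<And>q. q \<in> topspace X - K \<Longrightarrow> u q = 0"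
    and pos: "\<And>q. u q \<ge> 0" "u p > 0" by simp_all
  have Kc: "K \<subseteq> fst c" "K \<subseteq> fst d" using K(2) Vc by auto
  let ?hc = "\<lambda>q. u q * lapc c f q" and ?hd = "\<lambda>q. u q * lapc d f q"
  have cont: "continuous_map X euclidean ?hc" "continuous_map X euclidean ?hd"
    using continuous_mult_lapc[OF c(1) f u K(1) Kc(1) K(3)] continuous_mult_lapc[OF d(1) f u K(1) Kc(2) K(3)] by auto
  then have cdiff: "continuous_map X euclidean (\<lambda>q. ?hc q - ?hd q)"
    using continuous_map_diff by blast
  have "(\<integral>q. ?hc q - ?hd q \<partial>\<mu>) = 0"
    using weak_laplacian[OF c(1) f u K(1) Kc(1) K(3)] weak_laplacian[OF d(1) f u K(1) Kc(2) K(3)]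
      Bochner_Integration.integral_diff[OF continuous_integrable[OF cont(1)] continuous_integrable[OF cont(2)]] by simp
  moreover have "?hc q - ?hd q \<ge> 0" if "q \<in> topspace X" for q
  proof (cases "q \<in> K")
    case True
    then have "lapc c f q > lapc d f q" using K(2) by (auto simp: V_def)
    then show ?thesis using pos(1)[of q] by (simp add: mult_left_mono)
  qed (use that K(3) in simp)
  then have "AE q in \<mu>. 0 \<le> ?hc q - ?hd q" by (intro AE_I2) (simp add: space_area)
  ultimately have "AE q in \<mu>. ?hc q - ?hd q = 0"
    using integral_nonneg_eq_0_iff_AE[OF continuous_integrable[OF cdiff]] by blast
  then have "?hc p - ?hd p = 0"
    using subsetD[OF chart_subset[OF c(1)] c(2)] by (intro AE_continuous_zero[OF cdiff])
  then have "u p * (lapc c f p - lapc d f p) = 0" by (simp add: right_diff_distrib)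
  then show False using pos(2) neg by simp
qed

lemma laplacian_chart:
  assumes "c \<in> \<A>" "p \<in> fst c" "Ck_map (Suc (Suc 0)) \<A> f"
  shows "laplacian \<A> \<phi> f p = lapc c f p"
proof -
  have "p \<in> topspace X" using assms chart_subset by blast
  note d = chart_at[OF this, THEN conjunct1] chart_at[OF this, THEN conjunct2]
  have "laplacian \<A> \<phi> f p = lapc (chart_at \<A> p) f p" using d by (simp add: laplacian_eq lapc_def)
  then show ?thesis
    using lap_le[OF d assms] lap_le[OF assms(1,2) d assms(3)] by simp
qed

text \<open>Chart independence replaces the pointwise choice \<open>chart_at\<close> by one chart on
  its whole domain, where the coordinate formula is continuous.\<close>

lemma continuous_laplacian:
  assumes f: "Ck_map (Suc (Suc 0)) \<A> f"
  shows "continuous_map X euclidean (laplacian \<A> \<phi> f)"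
proof (rule continuous_mapI)
  fix c assume c: "c \<in> \<A>"
  have "lap c f x = in_chart c (laplacian \<A> \<phi> f) x" if x: "x \<in> snd c ` fst c" for x
  proof -
    obtain q where q: "q \<in> fst c" "x = snd c q" using x by blast
    show ?thesis
      using in_chart_apply[OF chart[OF c] q(1), of "laplacian \<A> \<phi> f"] laplacian_chart[OF c q(1) f] by (simp add: q lapc_def)
  qed
  then show "continuous_on (snd c ` fst c) (in_chart c (laplacian \<A> \<phi> f))"
    by (rule continuous_on_eq[OF continuous_lap[OF c f]])
qed

section \<open>Partition of unity and the global Green formula\<close>

lemma partition_of_unity:
  "\<exists>(n::nat) \<rho> c K. (\<forall>i<n. c i \<in> \<A> \<and> Ck_map (Suc 0) \<A> (\<rho> i) \<and> compactin X (K i) \<and> K i \<subseteq> fst (c i) \<and>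
      (\<forall>q\<in>topspace X - K i. \<rho> i q = (0::real))) \<and> (\<forall>q\<in>topspace X. (\<Sum>i<n. \<rho> i q) = 1)"
proof -
  define P where "P u c K \<longleftrightarrow> c \<in> \<A> \<and> Ck_map (Suc 0) \<A> u \<and> compactin X K \<and> K \<subseteq> fst c \<and>
      (\<forall>q\<in>topspace X - K. u q = 0) \<and> (\<forall>q. u q \<ge> (0::real))" for u :: "'a \<Rightarrow> real" and c K
  define \<U> where "\<U> = {u. \<exists>c K. P u c K}"
  define W where "W u = {q \<in> topspace X. u q > 0}" for u :: "'a \<Rightarrow> real"
  have cov: "\<exists>u\<in>\<U>. p \<in> W u" if p: "p \<in> topspace X" for p
  proof -
    obtain c where c: "c \<in> \<A>" "p \<in> fst c" using chart_exists[OF p] by blast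
    from bump_exists[OF c(1) chart_openin[OF chart[OF c(1)]] subset_refl c(2)] obtain u K
      where "P u c K" "u p > 0" using c(1) unfolding P_def by blast
    then show ?thesis using p unfolding \<U>_def W_def by blast
  qed
  have op: "openin X (W u)" if "u \<in> \<U>" for u
  proof -
    have "continuous_map X euclidean u" using that Ck_map_continuous by (auto simp: \<U>_def P_def)
    then have "openin X (u -` {0<..} \<inter> topspace X)" unfolding continuous_map_alt by simp
    moreover have "u -` {0<..} \<inter> topspace X = W u" by (auto simp: W_def)
    ultimately show ?thesis by simp
  qed
  have "compactin X (topspace X)" using compact by (simp add: compact_space_def)
  moreover have "\<forall>U\<in>W ` \<U>. openin X U" "topspace X \<subseteq> \<Union>(W ` \<U>)" using op cov by auto
  ultimately obtain \<F> where "finite \<F>" "\<F> \<subseteq> W ` \<U>" "topspace X \<subseteq> \<Union>\<F>"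
    unfolding compactin_def by meson
  then obtain C where C: "finite C" "C \<subseteq> \<U>" "topspace X \<subseteq> \<Union>(W ` C)"
    using finite_subset_image by metis
  obtain n :: nat and u where u: "C = u ` {i. i < n}" "inj_on u {i. i < n}"
    using C(1) finite_imp_nat_seg_image_inj_on by metis
  have "\<exists>c K. P (u i) c K" if "i < n" for i using that u C by (auto simp: \<U>_def)
  then obtain c K where P: "P (u i) (c i) (K i)" if "i < n" for i by metis
  \<comment> \<open>All bumps are nonnegative and their positivity sets cover X, so s is positive on
    X and division by it preserves C^1.\<close>
  define s where "s q = (\<Sum>i<n. u i q)" for q
  have spos: "s q > 0" if q: "q \<in> topspace X" for q
  proof -
    obtain i where "i < n" "u i q > 0" using q C(3) u by (auto simp: W_def)
    then show ?thesis
      unfolding s_def using P by (intro sum_pos2[of _ i]) (auto simp: P_def)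
  qed
  define \<rho> where "\<rho> i q = u i q * inverse (s q)" for i q
  have "Ck_map (Suc 0) \<A> (\<rho> i)" if i: "i < n" for i
    unfolding Ck_map_def
  proof
    fix d assume d: "d \<in> \<A>"
    let ?S = "snd d ` fst d"
    have o: "open ?S" by (rule chart_open[OF chart[OF d]])
    have ui: "Ck_on (Suc 0) ?S (in_chart d (u j))" if "j < n" for j
      using P[OF that] d by (simp add: P_def Ck_map_def)
    have "in_chart d s x \<noteq> 0" if x: "x \<in> ?S" for x
    proof -
      obtain q where q: "q \<in> fst d" "x = snd d q" using x by blast
      then show ?thesis using spos[of q] chart_subset[OF d] in_chart_apply[OF chart[OF d] q(1), of s] by auto
    qed
    moreover have "in_chart d s = (\<lambda>x. \<Sum>i<n. in_chart d (u i) x)" by (simp add: in_chart_def s_def o_def)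
    ultimately have "Ck_on (Suc 0) ?S (\<lambda>x. in_chart d (u i) x * inverse (\<Sum>i<n. in_chart d (u i) x))"
      by (intro Ck_on_mult Ck_on_inverse Ck_on_sum o ui i) auto
    then show "Ck_on (Suc 0) ?S (in_chart d (\<rho> i))"
      by (simp add: in_chart_def \<rho>_def[abs_def] s_def o_def del: Ck_on.simps)
  qed
  moreover have "(\<Sum>i<n. \<rho> i q) = 1" if "q \<in> topspace X" for q
    using spos[OF that] by (simp add: \<rho>_def sum_distrib_right[symmetric] s_def[symmetric])
  moreover have "\<rho> i q = 0" if "i < n" "q \<in> topspace X - K i" for i q
    using P[OF that(1)] that(2) by (simp add: P_def \<rho>_def)
  ultimately show ?thesis
    using P by (intro exI[of _ n] exI[of _ \<rho>] exI[of _ c] exI[of _ K]) (simp add: P_def)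
qed

lemma Ck_map_mult:
  fixes u f :: "'a \<Rightarrow> real"
  assumes "Ck_map n \<A> u" "Ck_map n \<A> f"
  shows "Ck_map n \<A> (\<lambda>q. u q * f q)"
  unfolding Ck_map_def
proof
  fix c assume c: "c \<in> \<A>"
  have "Ck_on n (snd c ` fst c) (\<lambda>x. in_chart c u x * in_chart c f x)"
    using assms c by (intro Ck_on_mult chart_open[OF chart[OF c]]) (auto simp: Ck_map_def)
  then show "Ck_on n (snd c ` fst c) (in_chart c (\<lambda>q. u q * f q))"
    by (simp add: in_chart_def o_def)
qed

text \<open>f is split into the summands \<open>\<rho> i * f\<close>, each supported in one chart.
  They are only C^1, but they enter the weak formula as test functions, while f in the other slot
  keeps its two derivatives.\<close>

lemma dirichlet_form:
  assumes f: "Ck_map (Suc (Suc 0)) \<A> f"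
  shows "(\<integral>p. f p * laplacian \<A> \<phi> f p \<partial>\<mu>) = - (\<integral>p. grad_prod f f p \<partial>\<mu>)"
proof -
  have f1: "Ck_map (Suc 0) \<A> f" by (rule Ck_map_mono[OF f]) simp
  obtain n :: nat and \<rho> c K where \<rho>: "\<forall>i<n. c i \<in> \<A> \<and> Ck_map (Suc 0) \<A> (\<rho> i) \<and> compactin X (K i) \<and> K i \<subseteq> fst (c i) \<and>
      (\<forall>q\<in>topspace X - K i. \<rho> i q = (0::real))" and one: "\<forall>q\<in>topspace X. (\<Sum>i<n. \<rho> i q) = 1"
    using partition_of_unity by blast
  define g where "g i q = \<rho> i q * f q" for i q
  have g: "Ck_map (Suc 0) \<A> (g i)" if "i < n" for i
    unfolding g_def[abs_def] using \<rho> that f1 by (intro Ck_map_mult) auto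
  have gf: "(\<Sum>i<n. g i q) = f q" if "q \<in> topspace X" for q
    using one that by (simp add: g_def sum_distrib_right[symmetric])
  have part: "(\<integral>p. g i p * laplacian \<A> \<phi> f p \<partial>\<mu>) = - (\<integral>p. grad_prod (g i) f p \<partial>\<mu>)" if i: "i < n" for i
  proof -
    have K: "c i \<in> \<A>" "compactin X (K i)" "K i \<subseteq> fst (c i)" "\<And>q. q \<in> topspace X - K i \<Longrightarrow> g i q = 0"
      using \<rho> i by (auto simp: g_def)
    have "(\<integral>p. g i p * laplacian \<A> \<phi> f p \<partial>\<mu>) = (\<integral>p. g i p * lapc (c i) f p \<partial>\<mu>)"
    proof (rule Bochner_Integration.integral_cong[OF refl])
      fix p assume "p \<in> space \<mu>"
      then have p: "p \<in> topspace X" by (simp add: space_area)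
      show "g i p * laplacian \<A> \<phi> f p = g i p * lapc (c i) f p"
        using K(3,4) p laplacian_chart[OF K(1) _ f, of p] by (cases "p \<in> K i") auto
    qed
    then show ?thesis using weak_laplacian[OF K(1) f g[OF i] K(2,3)] K(4) by simp
  qed
  have cL: "continuous_map X euclidean (laplacian \<A> \<phi> f)" by (rule continuous_laplacian[OF f])
  have "(\<integral>p. f p * laplacian \<A> \<phi> f p \<partial>\<mu>) = (\<integral>p. (\<Sum>i<n. g i p * laplacian \<A> \<phi> f p) \<partial>\<mu>)"
    using gf by (intro Bochner_Integration.integral_cong) (auto simp: sum_distrib_right[symmetric] space_area)
  also have "\<dots> = (\<Sum>i<n. \<integral>p. g i p * laplacian \<A> \<phi> f p \<partial>\<mu>)"
    using cL by (intro Bochner_Integration.integral_sum continuous_integrable continuous_map_real_mult Ck_map_continuous[OF g]) auto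
  also have "\<dots> = - (\<Sum>i<n. \<integral>p. grad_prod (g i) f p \<partial>\<mu>)"
    by (simp add: part sum_negf)
  also have "(\<Sum>i<n. \<integral>p. grad_prod (g i) f p \<partial>\<mu>) = (\<integral>p. (\<Sum>i<n. grad_prod (g i) f p) \<partial>\<mu>)"
    by (intro Bochner_Integration.integral_sum[symmetric] continuous_integrable continuous_grad_prod g f1) auto
  \<comment> \<open>The differentials of the summands add up to that of f, so by linearity in the
    first argument no derivative of the partition functions remains.\<close>
  also have "\<dots> = (\<integral>p. grad_prod f f p \<partial>\<mu>)"
  proof (rule Bochner_Integration.integral_cong[OF refl])
    fix p assume "p \<in> space \<mu>"
    then have p: "p \<in> topspace X" by (simp add: space_area)
    obtain d where d: "d \<in> \<A>" "p \<in> fst d" using chart_exists[OF p] by blast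
    have "((\<lambda>x. \<Sum>i<n. in_chart d (g i) x) has_derivative (\<lambda>v. \<Sum>i<n. dmap d (g i) p v)) (at (snd d p))"
      using Ck_map_has_derivative[OF g d] by (intro has_derivative_sum) auto
    moreover have "(\<Sum>i<n. in_chart d (g i) x) = in_chart d f x" if x: "x \<in> snd d ` fst d" for x
      using x gf chart_subset[OF d(1)] by (auto simp: in_chart_apply[OF chart[OF d(1)]])
    ultimately have "(in_chart d f has_derivative (\<lambda>v. \<Sum>i<n. dmap d (g i) p v)) (at (snd d p))"
      using has_derivative_transform_within_open[OF _ chart_open[OF chart[OF d(1)]] imageI[OF d(2)]] by blast
    then have "dmap d f p = (\<lambda>v. \<Sum>i<n. dmap d (g i) p v)"
      unfolding dmap_def[of d f] by (rule frechet_derivative_eq)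
    then have "gram_trace (dmap d \<phi> p) (dmap d f p) (dmap d f p)
        = gram_trace (dmap d \<phi> p) (\<lambda>v. \<Sum>i<n. dmap d (g i) p v) (dmap d f p)"
      by (rule arg_cong[where f="\<lambda>\<alpha>. gram_trace (dmap d \<phi> p) \<alpha> (dmap d f p)"])
    then show "(\<Sum>i<n. grad_prod (g i) f p) = grad_prod f f p"
      by (simp add: grad_prod_chart[OF d g f1] grad_prod_chart[OF d f1 f1] gram_trace_sum)
  qed
  finally show ?thesis .
qed

lemma dirichlet_nonneg:
  assumes "smooth_map \<A> f"
  shows "- (\<integral>p. f p * laplacian \<A> \<phi> f p \<partial>\<mu>) \<ge> 0"
  unfolding dirichlet_form[OF smooth_map_imp_Ck_map[OF assms]] minus_minus
  by (intro Bochner_Integration.integral_nonneg_AE AE_I2) (simp add: space_area grad_prod_self_nonneg)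

end

section \<open>Geometry of the ambient space\<close>

lemma ambient_norm:
  assumes "\<kappa> > 0" "q \<in> ambient \<kappa>"
  shows "\<kappa> * (fst q \<bullet> fst q) = 1"
proof -
  have "norm (fst q) = 1 / sqrt \<kappa>" using assms(2) by (auto simp: ambient_def)
  then have "fst q \<bullet> fst q = (1 / sqrt \<kappa>)\<^sup>2" by (metis power2_norm_eq_inner)
  then show ?thesis using assms(1) by (simp add: power_divide)
qed

lemma linear_tproj: "linear (tproj \<kappa> q)"
  by (rule linearI) (simp_all add: tproj_def inner_add_right algebra_simps)

lemma has_derivative_tproj:
  "((\<lambda>x. tproj \<kappa> x w) has_derivative
     (\<lambda>h. (- (\<kappa> * (fst h \<bullet> fst w)) *\<^sub>R fst q - (\<kappa> * (fst q \<bullet> fst w)) *\<^sub>R fst h, 0))) (at q)"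
  unfolding tproj_def
  by (rule derivative_eq_intros refl | simp)+ (auto simp: fun_eq_iff algebra_simps)

lemma has_derivative_conn_aux:
  fixes y :: "E4 \<Rightarrow> real^3"
  assumes "(y has_derivative y') (at q)"
  shows "((\<lambda>x. (y x - (\<kappa> * (fst x \<bullet> y x)) *\<^sub>R fst x, 0::real)) has_derivative
    (\<lambda>h. (y' h - (\<kappa> * (fst h \<bullet> y q + fst q \<bullet> y' h)) *\<^sub>R fst q - (\<kappa> * (fst q \<bullet> y q)) *\<^sub>R fst h, 0))) (at q)"
  by (rule derivative_eq_intros refl assms | simp)+ (auto simp: fun_eq_iff algebra_simps)

lemma has_derivative_conn_aux2:
  fixes a :: "E4 \<Rightarrow> real^3"
  assumes "(a has_derivative a') (at q)"
  shows "((\<lambda>x. - (\<kappa> * (a x \<bullet> w)) *\<^sub>R fst x - (\<kappa> * (fst x \<bullet> w)) *\<^sub>R a x) has_derivative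
    (\<lambda>h. - (\<kappa> * (a' h \<bullet> w)) *\<^sub>R fst q - (\<kappa> * (a q \<bullet> w)) *\<^sub>R fst h
       - (\<kappa> * (fst h \<bullet> w)) *\<^sub>R a q - (\<kappa> * (fst q \<bullet> w)) *\<^sub>R a' h)) (at q)"
  by (rule derivative_eq_intros refl assms | simp)+ (auto simp: fun_eq_iff algebra_simps)

lemma conn_tproj:
  "conn \<kappa> (\<lambda>x. tproj \<kappa> x v) (\<lambda>x. tproj \<kappa> x w) =
    (\<lambda>x. let y = - (\<kappa> * (fst (tproj \<kappa> x v) \<bullet> fst w)) *\<^sub>R fst x - (\<kappa> * (fst x \<bullet> fst w)) *\<^sub>R fst (tproj \<kappa> x v)
     in (y - (\<kappa> * (fst x \<bullet> y)) *\<^sub>R fst x, 0))"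
  unfolding conn_def frechet_derivative_eq[OF has_derivative_tproj] tproj_def[of \<kappa> _ "(_, _)"]
  by (simp add: Let_def)

text \<open>The second covariant derivative, at a point where n is tangent, of the field that
  extends n by projection. In the proof X is the radial vector and P the projection that kills it,
  so only terms along the projections of u and v survive.\<close>

lemma conn_conn_tproj:
  assumes q: "\<kappa> * (fst q \<bullet> fst q) = 1" and n: "fst q \<bullet> fst n = 0"
  shows "conn \<kappa> (\<lambda>x. tproj \<kappa> x u) (conn \<kappa> (\<lambda>x. tproj \<kappa> x v) (\<lambda>x. tproj \<kappa> x n)) q =
     (- (\<kappa> * (fst (tproj \<kappa> q u) \<bullet> fst n)) *\<^sub>R fst (tproj \<kappa> q v), 0)"
proof -
  define X where "X = fst q"
  define w where "w = fst n"
  define a where "a x = fst (tproj \<kappa> x v)" for x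
  define a' where "a' h = - (\<kappa> * (fst h \<bullet> fst v)) *\<^sub>R X - (\<kappa> * (X \<bullet> fst v)) *\<^sub>R fst h" for h :: E4
  define y where "y x = - (\<kappa> * (a x \<bullet> w)) *\<^sub>R fst x - (\<kappa> * (fst x \<bullet> w)) *\<^sub>R a x" for x
  define y' where "y' h = - (\<kappa> * (a' h \<bullet> w)) *\<^sub>R X - (\<kappa> * (a q \<bullet> w)) *\<^sub>R fst h
       - (\<kappa> * (fst h \<bullet> w)) *\<^sub>R a q - (\<kappa> * (X \<bullet> w)) *\<^sub>R a' h" for h
  define H where "H = fst (tproj \<kappa> q u)"
  define P where "P z = z - (\<kappa> * (X \<bullet> z)) *\<^sub>R X" for z
  have a: "(a has_derivative a') (at q)"
    using has_derivative_fst[OF has_derivative_tproj[of \<kappa> v q]] by (simp add: a_def[abs_def] a'_def[abs_def] X_def)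
  have "(y has_derivative y') (at q)"
    using has_derivative_conn_aux2[OF a, of \<kappa> w] by (simp add: y_def[abs_def] y'_def[abs_def] X_def)
  note D = frechet_derivative_eq[OF has_derivative_conn_aux[OF this, of \<kappa>]]
  have C: "conn \<kappa> (\<lambda>x. tproj \<kappa> x v) (\<lambda>x. tproj \<kappa> x n) = (\<lambda>x. (y x - (\<kappa> * (fst x \<bullet> y x)) *\<^sub>R fst x, 0))"
    by (simp add: conn_tproj Let_def y_def a_def w_def)
  have X1: "\<kappa> * (X \<bullet> X) = 1" and Xw: "X \<bullet> w = 0" using assms by (simp_all add: X_def w_def)
  have Pscale: "P (r *\<^sub>R z) = r *\<^sub>R P z" and Padd: "P (z + z') = P z + P z'" and Pdiff: "P (z - z') = P z - P z'" for r z z'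
    by (simp_all add: P_def inner_add_right inner_diff_right algebra_simps)
  have PX: "P X = 0" using X1 by (simp add: P_def)
  have tan: "X \<bullet> P z = 0" for z using X1 by (simp add: P_def inner_diff_right)
  have PP: "P (P z) = P z" for z using tan[of z] unfolding P_def[of "P z"] by simp
  have H: "H = P (fst u)" and aq: "a q = P (fst v)" by (simp_all add: H_def a_def P_def X_def tproj_def)
  have PH: "P H = H" and Pa: "P (a q) = a q" by (simp_all add: H aq PP)
  have Hu: "fst (tproj \<kappa> q u) = H" by (simp add: H_def)
  have "X \<bullet> y q = - (a q \<bullet> w) * (\<kappa> * (X \<bullet> X))"
    using Xw by (simp add: y_def X_def[symmetric] inner_diff_right algebra_simps)
  \<comment> \<open>Differentiating the projection of y turns this radial part into \<kappa> (a q .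
    w) H, which cancels the H term of \<open>Py\<close>; only the multiple of a q remains.\<close>
  then have Xy: "X \<bullet> y q = - (a q \<bullet> w)" using X1 by simp
  have "y' (tproj \<kappa> q u) = - (\<kappa> * (a' (tproj \<kappa> q u) \<bullet> w)) *\<^sub>R X - (\<kappa> * (a q \<bullet> w)) *\<^sub>R H - (\<kappa> * (H \<bullet> w)) *\<^sub>R a q"
    using Xw by (simp add: y'_def H_def)
  then have Py: "P (y' (tproj \<kappa> q u)) = - (\<kappa> * (a q \<bullet> w)) *\<^sub>R H - (\<kappa> * (H \<bullet> w)) *\<^sub>R a q"
    by (simp only: Pdiff Pscale PX PH Pa) simp
  have "conn \<kappa> (\<lambda>x. tproj \<kappa> x u) (conn \<kappa> (\<lambda>x. tproj \<kappa> x v) (\<lambda>x. tproj \<kappa> x n)) q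
     = (P (y' (tproj \<kappa> q u) - (\<kappa> * (fst (tproj \<kappa> q u) \<bullet> y q + X \<bullet> y' (tproj \<kappa> q u))) *\<^sub>R X - (\<kappa> * (X \<bullet> y q)) *\<^sub>R fst (tproj \<kappa> q u)), 0)"
    unfolding C conn_def[of \<kappa> "\<lambda>x. tproj \<kappa> x u"] D by (simp add: tproj_def[of \<kappa> _ "(_, _)"] P_def X_def)
  also have "P (y' (tproj \<kappa> q u) - (\<kappa> * (fst (tproj \<kappa> q u) \<bullet> y q + X \<bullet> y' (tproj \<kappa> q u))) *\<^sub>R X - (\<kappa> * (X \<bullet> y q)) *\<^sub>R fst (tproj \<kappa> q u))
     = - (\<kappa> * (H \<bullet> w)) *\<^sub>R a q"
    unfolding Hu Pdiff Pscale Py PX PH Xy by (simp add: algebra_simps)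
  finally show ?thesis by (simp add: H_def a_def w_def)
qed

text \<open>At q the projected extension of n has radial derivative in every direction, so it is
  parallel there and the bracket term of the curvature drops out; the two second derivatives
  remain.\<close>

lemma riemann_normal:
  assumes q: "\<kappa> * (fst q \<bullet> fst q) = 1" and n: "fst q \<bullet> fst n = 0"
  shows "riemann \<kappa> q b n n = ((\<kappa> * (fst n \<bullet> fst n)) *\<^sub>R fst (tproj \<kappa> q b) - (\<kappa> * (fst b \<bullet> fst n)) *\<^sub>R fst n, 0)"
proof -
  have n': "fst (tproj \<kappa> q n) = fst n" using n by (simp add: tproj_def)
  have b: "fst (tproj \<kappa> q b) \<bullet> fst n = fst b \<bullet> fst n" using n by (simp add: tproj_def inner_diff_left)
  have "conn \<kappa> L (\<lambda>x. tproj \<kappa> x n) q = 0" for L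
  proof -
    have "frechet_derivative (\<lambda>x. tproj \<kappa> x n) (at q) (L q) = (- (\<kappa> * (fst (L q) \<bullet> fst n)) *\<^sub>R fst q, 0)"
      using n by (simp add: frechet_derivative_eq[OF has_derivative_tproj])
    then show ?thesis
      using q by (simp add: conn_def tproj_def zero_prod_def mult.left_commute)
  qed
  then show ?thesis
    unfolding riemann_def curvature_op_def conn_conn_tproj[OF assms] n' b by simp
qed

text \<open>With w the spherical component of n, the trace is \<kappa> |w|^2 (3 - 1 - 1): 3 for the
  identity of R^3, 1 for the radial direction removed by the projection, and 1 for the direction of
  w.\<close>

lemma ambient_ric_normal:
  assumes q: "\<kappa> * (fst q \<bullet> fst q) = 1" and n: "fst q \<bullet> fst n = 0"
  shows "ambient_ric \<kappa> q n n = \<kappa> * (fst n \<bullet> fst n)"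
proof -
  define X w where "X = fst q" and "w = fst n"
  have q': "\<kappa> * (X \<bullet> X) = 1" using q by (simp add: X_def)
  have tm: "riemann \<kappa> q b n n \<bullet> b = \<kappa> * (w \<bullet> w) * (fst b \<bullet> fst b) - \<kappa> * (w \<bullet> w) * \<kappa> * (X \<bullet> fst b)\<^sup>2 - \<kappa> * (w \<bullet> fst b)\<^sup>2" for b
    unfolding riemann_normal[OF assms] X_def w_def
    by (simp add: tproj_def inner_prod_def inner_diff_left inner_commute power2_eq_square algebra_simps)
  have sq: "(\<Sum>b\<in>(Basis :: E4 set). (v \<bullet> fst b)\<^sup>2) = v \<bullet> v" for v :: "real^3"
  proof -
    \<comment> \<open>Parseval's identity for the vector (v, 0) of \<open>E4\<close>.\<close>
    have "(\<Sum>b\<in>(Basis :: E4 set). (v \<bullet> fst b)\<^sup>2) = (\<Sum>b\<in>(Basis :: E4 set). ((v, 0::real) \<bullet> b) * ((v, 0) \<bullet> b))"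
      by (simp add: inner_prod_def power2_eq_square)
    also have "\<dots> = (v, 0::real) \<bullet> (v, 0)" by (rule euclidean_inner[symmetric])
    finally show ?thesis by simp
  qed
  have "(\<Sum>b\<in>(Basis :: E4 set). snd b * snd b) = (\<Sum>b\<in>(Basis :: E4 set). ((0, 1) \<bullet> b) * ((0, 1) \<bullet> b))"
    by (simp add: inner_prod_def)
  also have "\<dots> = (0 :: real^3, 1::real) \<bullet> (0, 1)" by (rule euclidean_inner[symmetric])
  finally have "(\<Sum>b\<in>(Basis :: E4 set). snd b * snd b) = 1" by simp
  moreover have "(\<Sum>b\<in>(Basis :: E4 set). fst b \<bullet> fst b) = (\<Sum>b\<in>(Basis :: E4 set). 1 - snd b * snd b)"
  proof (rule sum.cong[OF refl])
    fix b :: E4 assume "b \<in> Basis"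
    then have "b \<bullet> b = 1" by simp
    then show "fst b \<bullet> fst b = 1 - snd b * snd b" by (simp add: inner_prod_def)
  qed
  ultimately have three: "(\<Sum>b\<in>(Basis :: E4 set). fst b \<bullet> fst b) = 3"
    by (simp add: sum_subtractf)
  have "ambient_ric \<kappa> q n n = \<kappa> * (w \<bullet> w) * (\<Sum>b\<in>(Basis :: E4 set). fst b \<bullet> fst b)
      - \<kappa> * (w \<bullet> w) * \<kappa> * (\<Sum>b\<in>(Basis :: E4 set). (X \<bullet> fst b)\<^sup>2) - \<kappa> * (\<Sum>b\<in>(Basis :: E4 set). (w \<bullet> fst b)\<^sup>2)"
    unfolding ambient_ric_def tm sum_subtractf sum_distrib_left[symmetric] ..
  also have "\<dots> = \<kappa> * (w \<bullet> w) * 3 - \<kappa> * (w \<bullet> w) * (\<kappa> * (X \<bullet> X)) - \<kappa> * (w \<bullet> w)"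
    unfolding three sq by simp
  finally show ?thesis unfolding q' by (simp add: w_def)
qed

section \<open>Linear algebra of tangent planes\<close>

lemma linear_inj_surj:
  fixes L :: "'a::euclidean_space \<Rightarrow> 'b::euclidean_space"
  assumes "linear L" "inj L" "DIM('a) = DIM('b)"
  shows "surj L"
proof -
  have "dim (range L) = DIM('b)" using dim_image_eq[OF assms(1), of UNIV] assms(2,3) by simp
  then have "span (range L) = UNIV" by (simp add: dim_eq_full)
  then show ?thesis using span_eq_iff linear_subspace_image[OF assms(1) subspace_UNIV] by blast
qed

text \<open>Adding the normal directions (x, 0) and N to the plane gives an injective, hence
  surjective, map onto \<open>E4\<close>; the two normal coefficients of z are read off by inner
  products and vanish.\<close>

lemma tangent_plane:
  fixes \<alpha> :: "real^2 \<Rightarrow> E4"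
  assumes \<alpha>: "linear \<alpha>" "inj \<alpha>" and x: "x \<noteq> 0" "\<And>v. x \<bullet> fst (\<alpha> v) = 0"
    and N: "N \<noteq> 0" "x \<bullet> fst N = 0" "\<And>v. N \<bullet> \<alpha> v = 0"
    and z: "x \<bullet> fst z = 0" "N \<bullet> z = 0"
  shows "\<exists>v. \<alpha> v = z"
proof -
  define L where "L p = \<alpha> (fst p) + fst (snd p) *\<^sub>R (x, 0) + snd (snd p) *\<^sub>R N" for p :: "(real^2) \<times> real \<times> real"
  have lin: "linear L"
    by (rule linearI)
       (simp_all add: L_def linear_add[OF \<alpha>(1)] linear_scale[OF \<alpha>(1)] scaleR_add_left scaleR_add_right del: scaleR_Pair)
  have x0: "(x, 0) \<bullet> \<alpha> v = 0" "(x, 0) \<bullet> N = 0" for v using x(2) N(2) by (simp_all add: inner_prod_def)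
  have c1: "(x, 0) \<bullet> L p = fst (snd p) * (x \<bullet> x)" for p
    unfolding L_def inner_add_right inner_scaleR_right x0 by (simp add: inner_prod_def)
  have c2: "N \<bullet> L p = snd (snd p) * (N \<bullet> N)" for p
    unfolding L_def inner_add_right inner_scaleR_right N(3) inner_commute[of N "(x, 0)"] x0 by simp
  have "p = 0" if "L p = 0" for p
  proof -
    have "fst (snd p) = 0" "snd (snd p) = 0" using c1[of p] c2[of p] that x(1) N(1) by auto
    then have "\<alpha> (fst p) = 0" using that by (simp add: L_def zero_prod_def[symmetric])
    then have "fst p = 0" using \<alpha> linear_injective_0 by blast
    then show ?thesis using \<open>fst (snd p) = 0\<close> \<open>snd (snd p) = 0\<close> by (simp add: prod_eq_iff)
  qed
  then have "inj L" using linear_injective_0[OF lin] by blast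
  then have "surj L" using lin by (intro linear_inj_surj) auto
  then obtain p where p: "z = L p" by blast
  have "(x, 0) \<bullet> L p = 0" "N \<bullet> L p = 0" using z unfolding p by (simp_all add: inner_prod_def)
  then have "fst (snd p) = 0" "snd (snd p) = 0"
    unfolding c1 c2 using x(1) N(1) by simp_all
  then show ?thesis using p by (auto simp: L_def zero_prod_def[symmetric])
qed

text \<open>The tangent plane of the sphere and the radial line fill R^3. This serves the open
  mapping argument and shows that over a slice N has no horizontal component.\<close>

lemma sphere_tangent_decomposition:
  fixes \<alpha> :: "real^2 \<Rightarrow> real^3"
  assumes \<alpha>: "linear \<alpha>" "inj \<alpha>" and x: "x \<noteq> 0" "\<And>v. x \<bullet> \<alpha> v = 0"
  defines "L \<equiv> \<lambda>p :: (real^2) \<times> real. \<alpha> (fst p) + snd p *\<^sub>R x"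
  shows "linear L" "surj L"
proof -
  show lin: "linear L"
    unfolding L_def
    by (rule linearI) (simp_all add: linear_add[OF \<alpha>(1)] linear_scale[OF \<alpha>(1)] scaleR_add_left scaleR_add_right)
  have c: "x \<bullet> L p = snd p * (x \<bullet> x)" for p
    unfolding L_def inner_add_right inner_scaleR_right x(2) by simp
  have "p = 0" if "L p = 0" for p
  proof -
    have s: "snd p = 0" using c[of p] that x(1) by auto
    then have "\<alpha> (fst p) = 0" using that by (simp add: L_def)
    then have "fst p = 0" using \<alpha> linear_injective_0 by blast
    then show ?thesis using s by (simp add: prod_eq_iff)
  qed
  then have "inj L" using linear_injective_0[OF lin] by blast
  then show "surj L" using lin by (intro linear_inj_surj) auto
qed

section \<open>Two-sided surfaces\<close>

lemma inner_has_derivative_const: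
  fixes g :: "'a::real_normed_vector \<Rightarrow> 'b::real_inner"
  assumes g: "(g has_derivative g') (at x)" and S: "open S" "x \<in> S" "\<And>y. y \<in> S \<Longrightarrow> g y \<bullet> g y = k"
  shows "g x \<bullet> g' v = 0"
proof -
  have "((\<lambda>y. g y \<bullet> g y) has_derivative (\<lambda>v. g x \<bullet> g' v + g' v \<bullet> g x)) (at x)"
    by (rule has_derivative_inner[OF g g])
  moreover have "((\<lambda>y. g y \<bullet> g y) has_derivative (\<lambda>v. 0)) (at x)"
    by (rule has_derivative_transform_within_open[of "\<lambda>y. k" _ _ _ S]) (use S in auto)
  ultimately have "(\<lambda>v. g x \<bullet> g' v + g' v \<bullet> g x) = (\<lambda>v. 0)" by (rule has_derivative_unique)
  then have "g x \<bullet> g' v + g' v \<bullet> g x = 0" by (rule fun_cong)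
  then show ?thesis by (simp add: inner_commute)
qed

locale two_sided =
  fixes \<kappa> :: real and X :: "'a topology" and \<A> :: "'a chart set" and \<phi> N :: "'a \<Rightarrow> E4"
  assumes kappa: "\<kappa> > 0" and two_sided: "two_sided_surface \<kappa> X \<A> \<phi> N" and compact_X: "compact_space X"

sublocale two_sided \<subseteq> immersed X \<A> \<phi>
  using two_sided compact_X
  by unfold_locales (auto simp: two_sided_surface_def surface_def immersion_def)

context two_sided
begin

lemma phi_ambient: "p \<in> topspace X \<Longrightarrow> \<phi> p \<in> ambient \<kappa>"
  using two_sided by (auto simp: two_sided_surface_def immersion_def)

lemma phi_norm: "p \<in> topspace X \<Longrightarrow> \<kappa> * (fst (\<phi> p) \<bullet> fst (\<phi> p)) = 1"
  by (rule ambient_norm[OF kappa phi_ambient])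

lemma phi_nonzero: "p \<in> topspace X \<Longrightarrow> fst (\<phi> p) \<noteq> 0"
  using phi_norm by fastforce

lemma CkN: "Ck_map n \<A> N"
  using two_sided smooth_map_imp_Ck_map by (auto simp: two_sided_surface_def unit_normal_field_def)

lemma N_unit: "p \<in> topspace X \<Longrightarrow> N p \<bullet> N p = 1"
  using two_sided by (simp add: two_sided_surface_def unit_normal_field_def power2_norm_eq_inner[symmetric])

lemma N_tangent:
  assumes p: "p \<in> topspace X"
  shows "fst (\<phi> p) \<bullet> fst (N p) = 0"
proof -
  have "tproj \<kappa> (\<phi> p) (N p) = N p"
    using two_sided p by (simp add: two_sided_surface_def unit_normal_field_def)
  then have "fst (N p) - (\<kappa> * (fst (\<phi> p) \<bullet> fst (N p))) *\<^sub>R fst (\<phi> p) = fst (N p)"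
    by (metis tproj_def fst_conv)
  then show ?thesis using phi_nonzero[OF p] kappa by simp
qed

lemma N_normal: "c \<in> \<A> \<Longrightarrow> p \<in> fst c \<Longrightarrow> N p \<bullet> dmap c \<phi> p v = 0"
  using two_sided by (simp add: two_sided_surface_def unit_normal_field_def dmap_def)

lemma topspaceI: "c \<in> \<A> \<Longrightarrow> p \<in> fst c \<Longrightarrow> p \<in> topspace X"
  using chart_subset by blast

lemma in_chart_ball: "c \<in> \<A> \<Longrightarrow> (\<And>q. q \<in> fst c \<Longrightarrow> P (f q)) \<Longrightarrow> x \<in> snd c ` fst c \<Longrightarrow> P (in_chart c f x)"
  by (elim imageE) (simp add: in_chart_apply[OF chart])

lemma phi_deriv:
  assumes c: "c \<in> \<A>" "p \<in> fst c"
  shows "fst (\<phi> p) \<bullet> fst (dmap c \<phi> p v) = 0"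
proof -
  have "fst (in_chart c \<phi> y) \<bullet> fst (in_chart c \<phi> y) = 1 / \<kappa>" if y: "y \<in> snd c ` fst c" for y
  proof -
    obtain q where q: "q \<in> fst c" "y = snd c q" using y by blast
    then show ?thesis
      using phi_norm[OF topspaceI[OF c(1) q(1)]] kappa in_chart_apply[OF chart[OF c(1)] q(1), of \<phi>]
      by (simp add: field_simps)
  qed
  from inner_has_derivative_const[OF has_derivative_fst[OF Ck_map_has_derivative[OF Ck c]]
      chart_open[OF chart[OF c(1)]] imageI[OF c(2)] this]
  show ?thesis using in_chart_apply[OF chart[OF c(1)] c(2), of \<phi>] by simp
qed

lemma N_deriv:
  assumes c: "c \<in> \<A>" "p \<in> fst c"
  shows "N p \<bullet> dmap c N p v = 0"
proof -
  have "in_chart c N y \<bullet> in_chart c N y = 1" if y: "y \<in> snd c ` fst c" for y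
  proof -
    obtain q where q: "q \<in> fst c" "y = snd c q" using y by blast
    then show ?thesis
      using N_unit[OF topspaceI[OF c(1) q(1)]] in_chart_apply[OF chart[OF c(1)] q(1), of N] by simp
  qed
  from inner_has_derivative_const[OF Ck_map_has_derivative[OF CkN c]
      chart_open[OF chart[OF c(1)]] imageI[OF c(2)] this]
  show ?thesis using in_chart_apply[OF chart[OF c(1)] c(2), of N] by simp
qed

text \<open>The covariant derivative of N as a vector of \<open>E4\<close>. Up to sign it is the
  image of the shape operator, so |A|^2 becomes a Gram trace free of the definite description in
  \<open>shape_operator\<close>.\<close>

definition covN :: "'a chart \<Rightarrow> 'a \<Rightarrow> real^2 \<Rightarrow> E4" where
  "covN c p v = tproj \<kappa> (\<phi> p) (dmap c N p v)"

lemma linear_covN: "c \<in> \<A> \<Longrightarrow> p \<in> fst c \<Longrightarrow> linear (covN c p)"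
  using linear_compose[OF linear_dmap[OF _ _ CkN] linear_tproj] by (simp add: covN_def[abs_def] o_def)

text \<open>The definite description is meaningful: \<open>- covN c p v\<close> is orthogonal to the
  radial direction by projection and to N because |N| = 1, hence lies in the tangent plane;
  injectivity of the differential gives uniqueness.\<close>

lemma shape_operator_deriv:
  assumes c: "c \<in> \<A>" "p \<in> fst c"
  shows "dmap c \<phi> p (shape_operator \<kappa> c \<phi> N (snd c p) v) = - covN c p v"
proof -
  have p: "p \<in> topspace X" by (rule topspaceI[OF c])
  let ?z = "- covN c p v"
  have z1: "fst (\<phi> p) \<bullet> fst ?z = 0"
    using phi_norm[OF p] by (simp add: covN_def tproj_def inner_diff_right)
  have "N p \<bullet> covN c p v = N p \<bullet> dmap c N p v - \<kappa> * (fst (\<phi> p) \<bullet> fst (dmap c N p v)) * (fst (\<phi> p) \<bullet> fst (N p))"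
    by (simp add: covN_def tproj_def inner_prod_def inner_diff_right inner_commute)
  then have z2: "N p \<bullet> ?z = 0" using N_deriv[OF c] N_tangent[OF p] by simp
  have "N p \<noteq> 0" using N_unit[OF p] by auto
  then obtain w where "dmap c \<phi> p w = ?z"
    using tangent_plane[OF linear_dmap[OF c Ck] inj_dmap[OF c] phi_nonzero[OF p] phi_deriv[OF c] _ N_tangent[OF p] N_normal[OF c] z1 z2]
    by blast
  then have "\<exists>!w. dmap c \<phi> p w = ?z" using inj_dmap[OF c] by (metis injD)
  moreover have "shape_operator \<kappa> c \<phi> N (snd c p) v = (THE w. dmap c \<phi> p w = ?z)"
    using in_chart_apply[OF chart[OF c(1)] c(2), of \<phi>] by (simp add: shape_operator_def dmap_def covN_def)
  ultimately show ?thesis using theI'[of "\<lambda>w. dmap c \<phi> p w = ?z"] by simp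
qed

lemma inner_metric:
  assumes c: "c \<in> \<A>" "p \<in> fst c"
  shows "a \<bullet> (metric c \<phi> (snd c p) *v b) = dmap c \<phi> p a \<bullet> dmap c \<phi> p b"
  unfolding linear_real2[OF linear_dmap[OF c Ck], of a] linear_real2[OF linear_dmap[OF c Ck], of b]
  by (simp add: inner_vec_def matrix_vector_mult_def sum_2 metric_nth dmap_def inner_add_left inner_add_right
      inner_commute algebra_simps)

lemma shape_norm_sq_chart:
  assumes c: "c \<in> \<A>" "p \<in> fst c"
  shows "shape_norm_sq \<kappa> \<A> \<phi> N p = gram_trace (dmap c \<phi> p) (covN c p) (covN c p)"
proof -
  have p: "p \<in> topspace X" by (rule topspaceI[OF c])
  let ?d = "chart_at \<A> p"
  have d: "?d \<in> \<A>" "p \<in> fst ?d" using chart_at[OF p] by auto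
  have "gram_det (frechet_derivative (in_chart ?d \<phi>) (at (snd ?d p))) \<noteq> 0"
    using gram_pos[OF d] by (simp add: dmap_def)
  then have "shape_norm_sq \<kappa> \<A> \<phi> N p = gram_trace (dmap ?d \<phi> p) (covN ?d p) (covN ?d p)"
    unfolding shape_norm_sq_def Let_def inner_metric[OF d] shape_operator_deriv[OF d] inner_minus_left inner_minus_right minus_minus
    using metric_inv_trace[of ?d \<phi> "snd ?d p" "covN ?d p" "covN ?d p"] by (simp add: dmap_def)
  also have "covN ?d p = covN c p \<circ> dmap ?d (snd c) p"
    by (simp add: covN_def[abs_def] o_def dmap_change_chart[OF d(1) c(1) d(2) c(2) CkN])
  also have "gram_trace (dmap ?d \<phi> p) (covN c p \<circ> dmap ?d (snd c) p) (covN c p \<circ> dmap ?d (snd c) p)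
      = gram_trace (dmap c \<phi> p) (covN c p) (covN c p)"
    by (rule gram_trace_change_chart[OF d(1) c(1) d(2) c(2) linear_covN[OF c] linear_covN[OF c]])
  finally show ?thesis .
qed

lemma shape_norm_sq_nonneg:
  assumes "p \<in> topspace X"
  shows "shape_norm_sq \<kappa> \<A> \<phi> N p \<ge> 0"
proof -
  obtain c where c: "c \<in> \<A>" "p \<in> fst c" using chart_exists[OF assms] by blast
  show ?thesis unfolding shape_norm_sq_chart[OF c] by (rule gram_trace_nonneg[OF gram_pos[OF c]])
qed

lemma continuous_shape_norm_sq: "continuous_map X euclidean (shape_norm_sq \<kappa> \<A> \<phi> N)"
proof -
  let ?\<alpha> = "\<lambda>c x v. tproj \<kappa> (in_chart c \<phi> x) (frechet_derivative (in_chart c N) (at x) v)"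
  have cont: "continuous_on (snd c ` fst c) (\<lambda>x. ?\<alpha> c x v)" if c: "c \<in> \<A>" for c v
  proof -
    have "continuous_on (snd c ` fst c) (in_chart c \<phi>)"
      "continuous_on (snd c ` fst c) (\<lambda>x. frechet_derivative (in_chart c N) (at x) v)"
      by (rule in_chart_continuous_on[OF chart[OF c] Ck_map_continuous[OF Ck]],
          rule Ck_on_imp_continuous_on[OF Ck_partial[OF c CkN]])
    then show ?thesis unfolding tproj_def by (intro continuous_intros)
  qed
  show ?thesis
  proof (rule continuous_gram_trace[of _ ?\<alpha> ?\<alpha>])
    show "shape_norm_sq \<kappa> \<A> \<phi> N p = gram_trace (dmap c \<phi> p) (?\<alpha> c (snd c p)) (?\<alpha> c (snd c p))"
      if c: "c \<in> \<A>" "p \<in> fst c" for c p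
      using shape_norm_sq_chart[OF c] in_chart_apply[OF chart[OF c(1)] c(2), of \<phi>]
      by (simp add: covN_def[abs_def] dmap_def)
  qed (use cont in auto)
qed

lemma ric_N: "p \<in> topspace X \<Longrightarrow> ambient_ric \<kappa> (\<phi> p) (N p) (N p) = \<kappa> * (fst (N p) \<bullet> fst (N p))"
  by (rule ambient_ric_normal[OF phi_norm N_tangent])

lemma laplacian_const: "laplacian \<A> \<phi> (\<lambda>p. k) p = 0"
proof -
  have 0: "partial_deriv i (\<lambda>x. r) x = 0" for i :: 2 and r :: real and x
    by (simp add: partial_deriv_def frechet_derivative_eq[OF has_derivative_const])
  have "in_chart c (\<lambda>p. k) = (\<lambda>x. k)" for c :: "'a chart" by (simp add: in_chart_def o_def)
  then have "flux c (\<lambda>p. k) i = (\<lambda>y. 0)" for c i by (simp add: flux_def[abs_def] 0)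
  then show ?thesis by (simp add: laplacian_eq lap_def 0)
qed

section \<open>From stability to slices\<close>

lemma stable_imp_normal_vertical:
  assumes stable: "strongly_stable \<kappa> X \<A> \<phi> N" and p: "p \<in> topspace X"
  shows "fst (N p) = 0"
proof -
  define r where "r p = \<kappa> * (fst (N p) \<bullet> fst (N p))" for p
  define s where "s p = shape_norm_sq \<kappa> \<A> \<phi> N p + r p" for p
  have "continuous_map euclidean euclidean (\<lambda>y::E4. \<kappa> * (fst y \<bullet> fst y))"
    by (simp, intro continuous_intros)
  from continuous_map_compose[OF Ck_map_continuous[OF CkN[of 0]] this]
  have "continuous_map X euclidean r" by (simp only: o_def r_def[abs_def])
  then have cs: "continuous_map X euclidean s"
    unfolding s_def[abs_def] by (intro continuous_map_add continuous_shape_norm_sq)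
  have r0: "r p \<ge> 0" for p using kappa by (simp add: r_def)
  have s0: "s p \<ge> 0" if "p \<in> topspace X" for p
    using shape_norm_sq_nonneg[OF that] r0[of p] by (simp add: s_def)
  have "smooth_map \<A> (\<lambda>p. 1::real)"
    by (simp add: smooth_map_def smooth_on_def in_chart_def o_def Ck_on_const)
  then have "- (\<integral>p. 1 * jacobi_op \<kappa> \<A> \<phi> N (\<lambda>p. 1) p \<partial>\<mu>) \<ge> 0"
    using stable unfolding strongly_stable_def by blast
  also have "(\<integral>p. 1 * jacobi_op \<kappa> \<A> \<phi> N (\<lambda>p. 1) p \<partial>\<mu>) = (\<integral>p. s p \<partial>\<mu>)"
    by (intro Bochner_Integration.integral_cong)
       (simp_all add: jacobi_op_def laplacian_const s_def r_def ric_N space_area)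
  finally have "(\<integral>p. s p \<partial>\<mu>) \<le> 0" by simp
  moreover have AE: "AE p in \<mu>. 0 \<le> s p" using s0 by (intro AE_I2) (simp add: space_area)
  ultimately have "(\<integral>p. s p \<partial>\<mu>) = 0"
    using integral_nonneg_AE[OF AE] by simp
  then have "AE p in \<mu>. s p = 0"
    using integral_nonneg_eq_0_iff_AE[OF continuous_integrable[OF cs] AE] by simp
  then have "s p = 0" by (rule AE_continuous_zero[OF cs _ p])
  then have "r p = 0" using r0[of p] shape_norm_sq_nonneg[OF p] by (simp add: s_def)
  then show ?thesis using kappa by (simp add: r_def)
qed

lemma height_deriv:
  assumes vert: "\<And>p. p \<in> topspace X \<Longrightarrow> fst (N p) = 0" and c: "c \<in> \<A>" "p \<in> fst c"
  shows "snd (dmap c \<phi> p v) = 0"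
proof -
  have p: "p \<in> topspace X" by (rule topspaceI[OF c])
  have "snd (N p) * snd (dmap c \<phi> p v) = 0" "snd (N p) \<noteq> 0"
    using N_normal[OF c, of v] N_unit[OF p] vert[OF p] by (auto simp: inner_prod_def)
  then show ?thesis by simp
qed

lemma height_constant:
  assumes vert: "\<And>p. p \<in> topspace X \<Longrightarrow> fst (N p) = 0"
  shows "\<exists>t. \<forall>p\<in>topspace X. snd (\<phi> p) = t"
proof -
  have conn: "connected_space X" and "topspace X \<noteq> {}"
    using two_sided by (auto simp: two_sided_surface_def surface_def)
  then obtain p0 where p0: "p0 \<in> topspace X" by blast
  have loc: "\<exists>V. openin X V \<and> p \<in> V \<and> (\<forall>q\<in>V. snd (\<phi> q) = snd (\<phi> p))" if p: "p \<in> topspace X" for p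
  proof -
    obtain c where c: "c \<in> \<A>" "p \<in> fst c" using chart_exists[OF p] by blast
    obtain r where r: "r > 0" "ball (snd c p) r \<subseteq> snd c ` fst c"
      using chart_open[OF chart[OF c(1)]] c(2) open_contains_ball by blast
    have "((\<lambda>x. snd (in_chart c \<phi> x)) has_derivative (\<lambda>v. 0)) (at x within ball (snd c p) r)"
      if x: "x \<in> ball (snd c p) r" for x
    proof -
      obtain q where q: "q \<in> fst c" "x = snd c q" using x r(2) by blast
      show ?thesis
        using has_derivative_snd[OF Ck_map_has_derivative[OF Ck c(1) q(1)]] height_deriv[OF vert c(1) q(1)]
        by (auto simp: q(2) intro: has_derivative_at_withinI)
    qed
    then obtain k where k: "\<And>x. x \<in> ball (snd c p) r \<Longrightarrow> snd (in_chart c \<phi> x) = k"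
      using has_derivative_zero_constant[OF convex_ball, of "snd c p" r "\<lambda>x. snd (in_chart c \<phi> x)"] by blast
    define V where "V = {q \<in> fst c. snd c q \<in> ball (snd c p) r}"
    have h: "snd (\<phi> q) = k" if "q \<in> V" for q
      using k[of "snd c q"] that in_chart_apply[OF chart[OF c(1)], of q \<phi>] by (simp add: V_def)
    have "openin X V" unfolding V_def by (rule chart_openin_preimage[OF chart[OF c(1)]]) simp
    moreover have "p \<in> V" using c r by (simp add: V_def)
    ultimately show ?thesis using h by (intro exI[of _ V]) simp
  qed
  define Z where "Z = {p \<in> topspace X. snd (\<phi> p) = snd (\<phi> p0)}"
  have "openin X Z"
  proof (subst openin_subopen, intro ballI)
    fix p assume "p \<in> Z"
    then have p: "p \<in> topspace X" "snd (\<phi> p) = snd (\<phi> p0)" by (auto simp: Z_def)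
    from loc[OF p(1)] obtain V where V: "openin X V" "p \<in> V" "\<forall>q\<in>V. snd (\<phi> q) = snd (\<phi> p)" by blast
    have "V \<subseteq> Z"
    proof
      fix q assume q: "q \<in> V"
      then have "snd (\<phi> q) = snd (\<phi> p)" "q \<in> topspace X" using V(3) openin_subset[OF V(1)] by (blast, blast)
      then show "q \<in> Z" using p(2) by (simp add: Z_def)
    qed
    then show "\<exists>T. openin X T \<and> p \<in> T \<and> T \<subseteq> Z" using V(1,2) by blast
  qed
  moreover have "openin X (topspace X - Z)"
  proof (subst openin_subopen, intro ballI)
    fix p assume "p \<in> topspace X - Z"
    then have p: "p \<in> topspace X" "snd (\<phi> p) \<noteq> snd (\<phi> p0)" by (auto simp: Z_def)
    from loc[OF p(1)] obtain V where V: "openin X V" "p \<in> V" "\<forall>q\<in>V. snd (\<phi> q) = snd (\<phi> p)" by blast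
    have "V \<subseteq> topspace X - Z"
    proof
      fix q assume q: "q \<in> V"
      then have "snd (\<phi> q) = snd (\<phi> p)" "q \<in> topspace X" using V(3) openin_subset[OF V(1)] by (blast, blast)
      then show "q \<in> topspace X - Z" using p(2) by (simp add: Z_def)
    qed
    then show "\<exists>T. openin X T \<and> p \<in> T \<and> T \<subseteq> topspace X - Z" using V(1,2) by blast
  qed
  ultimately have "Z = {} \<or> Z = topspace X"
    using conn by (auto simp: connected_space_clopen_in closedin_def Z_def)
  then have "Z = topspace X" using p0 by (auto simp: Z_def)
  then show ?thesis by (auto simp: Z_def)
qed

text \<open>The cone map G scales the spherical component of the immersion by s > 0, from a
  three-dimensional parameter domain into R^3. Its differential at s = 1 is onto, so it covers a
  neighbourhood of the spherical component of \<phi> p; a point of the sphere covered by the cone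
  has s = 1 and hence comes from the surface.\<close>

lemma slice_open_image:
  assumes t: "\<And>p. p \<in> topspace X \<Longrightarrow> snd (\<phi> p) = t" and p: "p \<in> topspace X"
    and vert: "\<And>c v. c \<in> \<A> \<Longrightarrow> p \<in> fst c \<Longrightarrow> snd (dmap c \<phi> p v) = 0"
  shows "\<exists>W. open W \<and> \<phi> p \<in> W \<and> W \<inter> slice \<kappa> t \<subseteq> \<phi> ` topspace X"
proof -
  obtain c where c: "c \<in> \<A>" "p \<in> fst c" using chart_exists[OF p] by blast
  let ?S = "snd c ` fst c" and ?F = "in_chart c \<phi>"
  have o: "open ?S" by (rule chart_open[OF chart[OF c(1)]])
  define \<alpha> where "\<alpha> v = fst (dmap c \<phi> p v)" for v
  have lin: "linear \<alpha>"
    using linear_compose[OF linear_dmap[OF c Ck] linear_fst] by (simp add: \<alpha>_def[abs_def] o_def)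
  have inj: "inj \<alpha>"
  proof (rule injI)
    fix v w assume "\<alpha> v = \<alpha> w"
    then have "dmap c \<phi> p v = dmap c \<phi> p w" using vert[OF c] by (simp add: \<alpha>_def prod_eq_iff)
    then show "v = w" using inj_dmap[OF c] by (simp add: inj_eq)
  qed
  define L where "L = (\<lambda>z :: (real^2) \<times> real. \<alpha> (fst z) + snd z *\<^sub>R fst (\<phi> p))"
  have L: "linear L" "surj L"
    unfolding L_def using sphere_tangent_decomposition[OF lin inj phi_nonzero[OF p]] phi_deriv[OF c] by (auto simp: \<alpha>_def)
  obtain g' where g': "linear g'" "L \<circ> g' = id" using linear_surjective_right_inverse[OF L] by blast
  define G where "G z = snd z *\<^sub>R fst (?F (fst z))" for z :: "(real^2) \<times> real"
  let ?T = "?S \<times> {0<..}"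
  have Fp: "?F (snd c p) = \<phi> p" by (rule in_chart_apply[OF chart[OF c(1)] c(2)])
  have "continuous_on (?S \<times> UNIV) G"
  proof -
    have "continuous_on ?S ?F" using Ck[of 0] c(1) by (simp add: Ck_map_def)
    then have "continuous_on (?S \<times> UNIV) (\<lambda>z. ?F (fst z))"
      by (rule continuous_on_compose2[where f=fst]) (auto intro: continuous_on_fst continuous_on_id)
    then show ?thesis unfolding G_def by (intro continuous_intros)
  qed
  moreover have "(G has_derivative L) (at (snd c p, 1))"
  proof -
    have "(?F has_derivative dmap c \<phi> p) (at (fst (snd c p, 1::real)))"
      using Ck_map_has_derivative[OF Ck c] by simp
    from has_derivative_compose[OF has_derivative_fst[OF has_derivative_ident] this]
    have "((\<lambda>z :: (real^2) \<times> real. ?F (fst z)) has_derivative (\<lambda>z. dmap c \<phi> p (fst z))) (at (snd c p, 1))" .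
    from has_derivative_scaleR[OF has_derivative_snd[OF has_derivative_ident] has_derivative_fst[OF this]]
    show ?thesis by (simp add: G_def[abs_def] L_def \<alpha>_def Fp)
  qed
  \<comment> \<open>For this open mapping theorem continuity of G and a right inverse of its
    differential at this one point suffice.\<close>
  ultimately have "G (snd c p, 1) \<in> interior (G ` ?T)"
    using c(2) o g'
    by (intro sussmann_open_mapping[where S="?S \<times> UNIV" and f'=L and g'=g'])
       (auto simp: open_Times interior_open linear_conv_bounded_linear)
  then have in_W: "\<phi> p \<in> interior (G ` ?T) \<times> UNIV" by (simp add: G_def Fp mem_Times_iff)
  have "y \<in> \<phi> ` topspace X" if y: "y \<in> interior (G ` ?T) \<times> UNIV" "y \<in> slice \<kappa> t" for y
  proof -
    have "fst y \<in> G ` ?T" using y(1) subsetD[OF interior_subset, of "fst y" "G ` ?T"] by (simp add: mem_Times_iff)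
    then obtain x s where xs: "x \<in> ?S" "s > 0" "fst y = G (x, s)" by auto
    then obtain q where q: "q \<in> fst c" "x = snd c q" by blast
    then have Fq: "?F x = \<phi> q" using in_chart_apply[OF chart[OF c(1)]] by simp
    have qX: "q \<in> topspace X" by (rule topspaceI[OF c(1) q(1)])
    have "norm (fst y) = 1 / sqrt \<kappa>" "norm (fst (\<phi> q)) = 1 / sqrt \<kappa>"
      using y(2) phi_ambient[OF qX] by (auto simp: slice_def ambient_def)
    moreover have "norm (fst y) = s * norm (fst (\<phi> q))" using xs by (simp add: G_def Fq)
    ultimately have "s = 1" using kappa by simp
    then have "fst y = fst (\<phi> q)" using xs by (simp add: G_def Fq)
    moreover have "snd y = snd (\<phi> q)" using y(2) t[OF qX] by (auto simp: slice_def)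
    ultimately show ?thesis using qX by (simp add: prod_eq_iff image_iff) blast
  qed
  then show ?thesis
    using in_W by (intro exI[of _ "interior (G ` ?T) \<times> UNIV"]) (auto simp: open_Times)
qed

lemma normal_vertical_imp_slice:
  assumes vert: "\<And>p. p \<in> topspace X \<Longrightarrow> fst (N p) = 0"
  shows "\<exists>t. \<phi> ` topspace X = slice \<kappa> t"
proof -
  obtain t where t: "\<And>p. p \<in> topspace X \<Longrightarrow> snd (\<phi> p) = t" using height_constant[OF vert] by blast
  let ?I = "\<phi> ` topspace X"
  have sub: "?I \<subseteq> slice \<kappa> t"
    using phi_ambient t by (force simp: slice_def ambient_def)
  have "openin (top_of_set (slice \<kappa> t)) ?I"
  proof (subst openin_subopen, intro ballI)
    fix y assume "y \<in> ?I"
    then obtain p where p: "p \<in> topspace X" "y = \<phi> p" by blast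
    from slice_open_image[OF t p(1) height_deriv[OF vert]] obtain W
      where W: "open W" "\<phi> p \<in> W" "W \<inter> slice \<kappa> t \<subseteq> ?I" by blast
    then show "\<exists>T. openin (top_of_set (slice \<kappa> t)) T \<and> y \<in> T \<and> T \<subseteq> ?I"
      using p sub by (intro exI[of _ "slice \<kappa> t \<inter> W"]) auto
  qed
  moreover have "closedin (top_of_set (slice \<kappa> t)) ?I"
  proof (rule closed_subset[OF sub])
    have "compactin euclidean ?I"
      using compact_X Ck_map_continuous[OF Ck] by (intro image_compactin) (auto simp: compact_space_def)
    then show "closed ?I" by (simp add: compact_imp_closed)
  qed
  moreover have "connected (slice \<kappa> t)"
    unfolding slice_def by (intro connected_Times connected_sphere) auto
  moreover have "?I \<noteq> {}" using two_sided by (simp add: two_sided_surface_def surface_def)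
  ultimately have "?I = slice \<kappa> t" unfolding connected_clopen by blast
  then show ?thesis by blast
qed

section \<open>From slices to stability\<close>

lemma slice_imp_normal_vertical:
  assumes sl: "\<phi> ` topspace X = slice \<kappa> t" and p: "p \<in> topspace X"
  shows "fst (N p) = 0"
proof -
  obtain c where c: "c \<in> \<A>" "p \<in> fst c" using chart_exists[OF p] by blast
  have ht: "snd (\<phi> q) = t" if "q \<in> topspace X" for q
  proof -
    have "\<phi> q \<in> slice \<kappa> t" using imageI[OF that, of \<phi>] sl by simp
    then show ?thesis by (simp add: slice_def mem_Times_iff)
  qed
  have "((\<lambda>x. snd (in_chart c \<phi> x)) has_derivative (\<lambda>v. 0)) (at (snd c p))"
    by (rule has_derivative_transform_within_open[of "\<lambda>x. t" _ _ _ "snd c ` fst c"])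
       (use c ht topspaceI in_chart_ball[OF c(1), of "\<lambda>y. snd y = t" \<phi>] chart_open[OF chart[OF c(1)]] in auto)
  then have vert: "snd (dmap c \<phi> p v) = 0" for v
    using has_derivative_unique[OF has_derivative_snd[OF Ck_map_has_derivative[OF Ck c]]] by metis
  define \<alpha> where "\<alpha> v = fst (dmap c \<phi> p v)" for v
  have lin: "linear \<alpha>"
    using linear_compose[OF linear_dmap[OF c Ck] linear_fst] by (simp add: \<alpha>_def[abs_def] o_def)
  have inj: "inj \<alpha>"
  proof (rule injI)
    fix v w assume "\<alpha> v = \<alpha> w"
    then have "dmap c \<phi> p v = dmap c \<phi> p w" using vert by (simp add: \<alpha>_def prod_eq_iff)
    then show "v = w" using inj_dmap[OF c] by (simp add: inj_eq)
  qed
  \<comment> \<open>The horizontal part of N is orthogonal to the tangent plane and to the radial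
    vector; since these span R^3, it is orthogonal to itself.\<close>
  have "surj (\<lambda>z :: (real^2) \<times> real. \<alpha> (fst z) + snd z *\<^sub>R fst (\<phi> p))"
    using sphere_tangent_decomposition(2)[OF lin inj phi_nonzero[OF p]] phi_deriv[OF c] by (auto simp: \<alpha>_def)
  then obtain z :: "(real^2) \<times> real" where z: "fst (N p) = \<alpha> (fst z) + snd z *\<^sub>R fst (\<phi> p)" by (rule surjE)
  have "fst (N p) \<bullet> \<alpha> v = 0" for v
    using N_normal[OF c, of v] vert[of v] by (simp add: inner_prod_def \<alpha>_def)
  then have "fst (N p) \<bullet> (\<alpha> (fst z) + snd z *\<^sub>R fst (\<phi> p)) = 0"
    using N_tangent[OF p] by (simp add: inner_add_right inner_commute[of "fst (N p)" "fst (\<phi> p)"])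
  then show ?thesis unfolding z[symmetric] by simp
qed

text \<open>The horizontal part of N is identically 0 and the square of its vertical part is 1, so
  both derivatives vanish.\<close>

lemma slice_imp_covN_zero:
  assumes sl: "\<phi> ` topspace X = slice \<kappa> t" and c: "c \<in> \<A>" "p \<in> fst c"
  shows "covN c p v = 0"
proof -
  have p: "p \<in> topspace X" by (rule topspaceI[OF c])
  note vert = slice_imp_normal_vertical[OF sl]
  have "((\<lambda>x. fst (in_chart c N x)) has_derivative (\<lambda>v. 0)) (at (snd c p))"
    by (rule has_derivative_transform_within_open[of "\<lambda>x. 0" _ _ _ "snd c ` fst c"])
       (use c vert topspaceI in_chart_ball[OF c(1), of "\<lambda>y. fst y = 0" N] chart_open[OF chart[OF c(1)]] in auto)
  then have "(\<lambda>v. fst (dmap c N p v)) = (\<lambda>v. 0)"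
    by (rule has_derivative_unique[OF has_derivative_fst[OF Ck_map_has_derivative[OF CkN c]]])
  then have 1: "fst (dmap c N p v) = 0" by (rule fun_cong)
  have "snd (N p) * snd (dmap c N p v) = 0" "snd (N p) \<noteq> 0"
    using N_deriv[OF c, of v] N_unit[OF p] vert[OF p] by (auto simp: inner_prod_def)
  then have "dmap c N p v = 0" using 1 by (simp add: prod_eq_iff)
  then show ?thesis by (simp add: covN_def linear_0[OF linear_tproj])
qed

lemma slice_imp_mean_curvature_zero:
  assumes sl: "\<phi> ` topspace X = slice \<kappa> t" and p: "p \<in> topspace X"
  shows "mean_curvature \<kappa> \<A> \<phi> N p = 0"
proof -
  let ?d = "chart_at \<A> p"
  have d: "?d \<in> \<A>" "p \<in> fst ?d" using chart_at[OF p] by auto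
  have "dmap ?d \<phi> p (shape_operator \<kappa> ?d \<phi> N (snd ?d p) v) = 0" for v
    using shape_operator_deriv[OF d] slice_imp_covN_zero[OF sl d] by simp
  then have "shape_operator \<kappa> ?d \<phi> N (snd ?d p) v = 0" for v
    using linear_injective_0[OF linear_dmap[OF d Ck]] inj_dmap[OF d] by blast
  then show ?thesis by (simp add: mean_curvature_def Let_def matrix_def trace_def)
qed

lemma slice_imp_stable:
  assumes sl: "\<phi> ` topspace X = slice \<kappa> t"
  shows "strongly_stable \<kappa> X \<A> \<phi> N"
  unfolding strongly_stable_def
proof (intro allI impI)
  fix f :: "'a \<Rightarrow> real" assume f: "smooth_map \<A> f"
  have "(\<integral>p. f p * jacobi_op \<kappa> \<A> \<phi> N f p \<partial>\<mu>) = (\<integral>p. f p * laplacian \<A> \<phi> f p \<partial>\<mu>)"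
  proof (rule Bochner_Integration.integral_cong[OF refl])
    fix p assume "p \<in> space \<mu>"
    then have p: "p \<in> topspace X" by (simp add: space_area)
    obtain c where c: "c \<in> \<A>" "p \<in> fst c" using chart_exists[OF p] by blast
    have "shape_norm_sq \<kappa> \<A> \<phi> N p = 0"
      unfolding shape_norm_sq_chart[OF c] by (simp add: gram_trace_def slice_imp_covN_zero[OF sl c])
    then show "f p * jacobi_op \<kappa> \<A> \<phi> N f p = f p * laplacian \<A> \<phi> f p"
      by (simp add: jacobi_op_def ric_N[OF p] slice_imp_normal_vertical[OF sl p])
  qed
  then show "- (\<integral>p. f p * jacobi_op \<kappa> \<A> \<phi> N f p \<partial>\<mu>) \<ge> 0" using dirichlet_nonneg[OF f] by simp
qed

lemma stable_iff_slice:
  "constant_mean_curvature \<kappa> X \<A> \<phi> N \<and> strongly_stable \<kappa> X \<A> \<phi> N \<longleftrightarrow> (\<exists>t. \<phi> ` topspace X = slice \<kappa> t)"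
  using normal_vertical_imp_slice stable_imp_normal_vertical slice_imp_stable slice_imp_mean_curvature_zero
  unfolding constant_mean_curvature_def by blast

end

section \<open>Stereographic charts\<close>

text \<open>The sign \<open>s = 1\<close> or \<open>s = -1\<close> selects the pole \<open>(0, 0, s R)\<close> of projection. For \<open>s = -1\<close> the
  second coordinate is reflected as well, which makes the transition maps orientation preserving.\<close>

definition stereo :: "real \<Rightarrow> real \<Rightarrow> E4 \<Rightarrow> real^2" where
  "stereo R s p = (fst p $ 1 * inverse (R - s * (fst p $ 3))) *\<^sub>R axis 1 1
     + (s * (fst p $ 2 * inverse (R - s * (fst p $ 3)))) *\<^sub>R axis 2 1"

text \<open>Written as scalars times fixed vectors, with \<open>inverse\<close> in place of
  division, so that the \<open>Ck_on\<close> rules apply directly. The origin goes to the pole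
  opposite to the centre of projection.\<close>

definition stereo_inv :: "real \<Rightarrow> real \<Rightarrow> real \<Rightarrow> real^2 \<Rightarrow> E4" where
  "stereo_inv R t s y = (2 * R * (y$1 * inverse (y \<bullet> y + 1))) *\<^sub>R (axis 1 1, 0)
     + (2 * R * s * (y$2 * inverse (y \<bullet> y + 1))) *\<^sub>R (axis 2 1, 0)
     + (R * s * ((y \<bullet> y - 1) * inverse (y \<bullet> y + 1))) *\<^sub>R (axis 3 1, 0) + (0, t)"

definition stereo_dom :: "real \<Rightarrow> real \<Rightarrow> real \<Rightarrow> E4 set" where
  "stereo_dom R t s = {p \<in> sphere 0 R \<times> {t}. fst p $ 3 \<noteq> s * R}"

lemma stereo_nth: "stereo R s p $ 1 = fst p $ 1 / (R - s * (fst p $ 3))"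
  "stereo R s p $ 2 = s * (fst p $ 2) / (R - s * (fst p $ 3))"
  by (simp_all add: stereo_def axis_def divide_inverse)

lemma stereo_inv_nth: "fst (stereo_inv R t s y) $ 1 = 2 * R * (y$1) / (y \<bullet> y + 1)"
  "fst (stereo_inv R t s y) $ 2 = 2 * R * s * (y$2) / (y \<bullet> y + 1)"
  "fst (stereo_inv R t s y) $ 3 = R * s * (y \<bullet> y - 1) / (y \<bullet> y + 1)"
  "snd (stereo_inv R t s y) = t"
  by (simp_all add: stereo_inv_def axis_def divide_inverse)

lemma inner2: "(y::real^2) \<bullet> y = (y$1)\<^sup>2 + (y$2)\<^sup>2"
  by (simp add: inner_vec_def sum_2 power2_eq_square)

lemma inner2_pos: "(y::real^2) \<bullet> y + 1 > 0"
  by (simp add: add_nonneg_pos)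

lemma mem_sphere_iff:
  assumes "R > 0"
  shows "(x::real^3) \<in> sphere 0 R \<longleftrightarrow> (x$1)\<^sup>2 + (x$2)\<^sup>2 + (x$3)\<^sup>2 = R\<^sup>2"
proof -
  have "x \<in> sphere 0 R \<longleftrightarrow> (norm x)\<^sup>2 = R\<^sup>2" using assms power2_eq_iff_nonneg[of "norm x" R] by simp
  moreover have "(norm x)\<^sup>2 = (x$1)\<^sup>2 + (x$2)\<^sup>2 + (x$3)\<^sup>2"
    unfolding power2_norm_eq_inner by (simp add: inner_vec_def sum_3 power2_eq_square)
  ultimately show ?thesis by simp
qed

lemma stereo_denom: "s * s = 1 \<Longrightarrow> R - s * z = 0 \<longleftrightarrow> z = s * R" for R s z :: real
  by (metis eq_iff_diff_eq_0 mult.assoc mult_1)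

lemma stereo_inv_denom:
  assumes "s * s = 1"
  shows "R - s * (fst (stereo_inv R t s y) $ 3) = 2 * R / (y \<bullet> y + 1)"
proof -
  have "s * (R * s * (y \<bullet> y - 1) / (y \<bullet> y + 1)) = (s * s) * R * (y \<bullet> y - 1) / (y \<bullet> y + 1)" by simp
  then show ?thesis
    using inner2_pos[of y] assms unfolding stereo_inv_nth by (simp add: field_simps)
qed

lemma stereo_inv_mem:
  assumes R: "R > 0" and s: "s * s = 1"
  shows "stereo_inv R t s y \<in> stereo_dom R t s"
proof -
  define w where "w = y \<bullet> y + 1"
  have w: "w > 0" "(y$1)\<^sup>2 + (y$2)\<^sup>2 = w - 1" using inner2_pos[of y] inner2[of y] by (simp_all add: w_def)
  have s2: "s\<^sup>2 = 1" using s by (simp add: power2_eq_square)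
  have "(2 * R * (y$1) / w)\<^sup>2 + (2 * R * s * (y$2) / w)\<^sup>2 + (R * s * (w - 2) / w)\<^sup>2
      = R\<^sup>2 * (4 * ((y$1)\<^sup>2 + (y$2)\<^sup>2) + (w - 2)\<^sup>2) / w\<^sup>2"
    unfolding power_divide power_mult_distrib s2 by (simp add: add_divide_distrib distrib_left mult_ac)
  also have "4 * ((y$1)\<^sup>2 + (y$2)\<^sup>2) + (w - 2)\<^sup>2 = w\<^sup>2"
    unfolding w(2) by (simp add: power2_eq_square algebra_simps)
  finally have "fst (stereo_inv R t s y) \<in> sphere 0 R"
    unfolding mem_sphere_iff[OF R] stereo_inv_nth using w(1) by (simp add: w_def)
  moreover have "R - s * (fst (stereo_inv R t s y) $ 3) \<noteq> 0"
    unfolding stereo_inv_denom[OF s] using R inner2_pos[of y] by simp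
  ultimately show ?thesis
    using stereo_denom[OF s] by (simp add: stereo_dom_def mem_Times_iff stereo_inv_nth(4))
qed

lemma stereo_stereo_inv:
  assumes R: "R > 0" and s: "s * s = 1"
  shows "stereo R s (stereo_inv R t s y) = y"
proof -
  define w where "w = y \<bullet> y + 1"
  have w: "w > 0" using inner2_pos[of y] by (simp add: w_def)
  have "2 * R * (y$1) / w / (2 * R / w) = y$1" using R w by simp
  moreover have "s * (2 * R * s * (y$2) / w) / (2 * R / w) = (s * s) * y$2" using R w by simp
  ultimately show ?thesis
    unfolding vec_eq_iff forall_2 stereo_nth stereo_inv_denom[OF s] stereo_inv_nth(1,2) w_def[symmetric]
    using s by simp
qed

lemma stereo_inv_stereo:
  assumes R: "R > 0" and s: "s * s = 1" and p: "p \<in> stereo_dom R t s"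
  shows "stereo_inv R t s (stereo R s p) = p"
proof -
  define x d where "x = fst p" and "d = R - s * (x $ 3)"
  have p': "x \<in> sphere 0 R" "snd p = t" "x $ 3 \<noteq> s * R"
    using p by (auto simp: stereo_dom_def x_def)
  have d: "d \<noteq> 0" unfolding d_def using stereo_denom[OF s] p'(3) by blast
  have s2: "s\<^sup>2 = 1" using s by (simp add: power2_eq_square)
  \<comment> \<open>On the sphere the squared distance from the axis factors as (R - s x3)(R + s
    x3); the first factor is d and cancels against the denominator of |y|^2.\<close>
  have "(x$1)\<^sup>2 + (x$2)\<^sup>2 = R\<^sup>2 - s\<^sup>2 * (x$3)\<^sup>2" using p'(1) s2 unfolding mem_sphere_iff[OF R] by simp
  also have "\<dots> = d * (R + s * (x$3))" by (simp add: d_def power2_eq_square algebra_simps)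
  finally have xx: "(x$1)\<^sup>2 + (x$2)\<^sup>2 = d * (R + s * (x$3))" .
  let ?y = "stereo R s p"
  have y: "?y $ 1 = x$1 / d" "?y $ 2 = s * (x$2) / d" by (simp_all add: stereo_nth x_def d_def)
  have "?y \<bullet> ?y = ((x$1)\<^sup>2 + (x$2)\<^sup>2) / d\<^sup>2"
    unfolding inner2 y by (simp add: power_divide power_mult_distrib s2 add_divide_distrib)
  then have yy: "?y \<bullet> ?y = (R + s * (x$3)) / d" unfolding xx using d by (simp add: power2_eq_square)
  have "?y \<bullet> ?y + 1 = (R + s * (x$3) + d) / d" unfolding yy using d by (simp add: add_divide_distrib)
  then have y1: "?y \<bullet> ?y + 1 = 2 * R / d" by (simp add: d_def)
  have "?y \<bullet> ?y - 1 = (R + s * (x$3) - d) / d" unfolding yy using d by (simp add: diff_divide_distrib)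
  then have y2: "?y \<bullet> ?y - 1 = 2 * s * (x$3) / d" by (simp add: d_def)
  have "fst (stereo_inv R t s ?y) = x"
    unfolding vec_eq_iff forall_3 stereo_inv_nth y y1 y2 using R d s by (simp add: mult.assoc[symmetric])
  then show ?thesis using p'(2) by (simp add: prod_eq_iff stereo_inv_nth(4) x_def)
qed

lemma Ck_stereo_inv: "Ck_on n UNIV (stereo_inv R t s)"
proof -
  have lin: "Ck_on n UNIV (\<lambda>y::real^2. y $ i)" for i
    by (rule Ck_on_linear) (rule bounded_linear_vec_nth)
  have id: "Ck_on n UNIV (\<lambda>y::real^2. y)" by (rule Ck_on_linear[OF bounded_linear_ident])
  have nz: "(y::real^2) \<bullet> y + 1 \<noteq> 0" for y using inner2_pos[of y] by simp
  show ?thesis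
    unfolding stereo_inv_def[abs_def]
    by (intro Ck_on_add Ck_on_scaleR Ck_on_mult Ck_on_inverse Ck_on_diff Ck_on_inner Ck_on_const lin id nz open_UNIV)
qed

lemma open_stereo: "open {p::E4. R - s * (fst p $ 3) \<noteq> 0}"
  by (intro open_Collect_neq continuous_intros)

lemma Ck_stereo: "Ck_on n {p. R - s * (fst p $ 3) \<noteq> 0} (stereo R s)"
proof -
  have lin: "Ck_on n S (\<lambda>p::E4. fst p $ i)" for i S
    by (rule Ck_on_linear) (rule bounded_linear_compose[OF bounded_linear_vec_nth bounded_linear_fst])
  show ?thesis
    unfolding stereo_def[abs_def]
    by (intro Ck_on_add Ck_on_scaleR Ck_on_mult Ck_on_inverse Ck_on_diff Ck_on_const lin open_stereo) auto
qed

definition stereo_chart :: "real \<Rightarrow> real \<Rightarrow> real \<Rightarrow> E4 chart" where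
  "stereo_chart R t s = (stereo_dom R t s, stereo R s)"

lemma stereo_image:
  assumes "R > 0" "s * s = 1"
  shows "stereo R s ` stereo_dom R t s = UNIV"
  using stereo_inv_mem[OF assms, of t] stereo_stereo_inv[OF assms, of t] by (metis UNIV_eq_I imageI)

lemma stereo_inj:
  assumes "R > 0" "s * s = 1"
  shows "inj_on (stereo R s) (stereo_dom R t s)"
  by (rule inj_on_inverseI[of _ "stereo_inv R t s"]) (rule stereo_inv_stereo[OF assms])

lemma in_stereo_chart:
  assumes "R > 0" "s * s = 1"
  shows "in_chart (stereo_chart R t s) f = (\<lambda>y. f (stereo_inv R t s y))"
proof
  fix y
  have "inv_into (stereo_dom R t s) (stereo R s) y = stereo_inv R t s y"
    by (rule inv_into_f_eq[OF stereo_inj[OF assms] stereo_inv_mem[OF assms] stereo_stereo_inv[OF assms]])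
  then show "in_chart (stereo_chart R t s) f y = f (stereo_inv R t s y)"
    by (simp add: in_chart_def stereo_chart_def)
qed

lemma stereo_dom_subset: "stereo_dom R t s \<subseteq> sphere 0 R \<times> {t}"
  by (auto simp: stereo_dom_def)

lemma is_chart_stereo:
  assumes R: "R > 0" and s: "s * s = 1"
  shows "is_chart (top_of_set (sphere 0 R \<times> {t})) (stereo_chart R t s)"
proof -
  let ?U = "stereo_dom R t s" and ?W = "{p::E4. R - s * (fst p $ 3) \<noteq> 0}"
  have U: "?U = (sphere 0 R \<times> {t}) \<inter> ?W" using stereo_denom[OF s] by (auto simp: stereo_dom_def)
  have o: "openin (top_of_set (sphere 0 R \<times> {t})) ?U"
    unfolding U by (rule openin_open_Int[OF open_stereo])
  have c: "continuous_on ?U (stereo R s)"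
    using Ck_on_imp_continuous_on[OF Ck_stereo] by (rule continuous_on_subset) (use U in blast)
  have ci: "continuous_on UNIV (stereo_inv R t s)" by (rule Ck_on_imp_continuous_on[OF Ck_stereo_inv])
  have "homeomorphic_maps (top_of_set ?U) euclidean (stereo R s) (stereo_inv R t s)"
    using c ci stereo_inv_mem[OF assms] stereo_stereo_inv[OF assms] stereo_inv_stereo[OF assms]
    by (auto simp: homeomorphic_maps_def continuous_map_in_subtopology)
  then have "homeomorphic_map (top_of_set ?U) euclidean (stereo R s)"
    using homeomorphic_map_maps by blast
  moreover have "subtopology (top_of_set (sphere 0 R \<times> {t})) ?U = top_of_set ?U"
    using stereo_dom_subset[of R t s] by (simp add: subtopology_subtopology Int_absorb1)
  ultimately show ?thesis
    using o by (simp add: is_chart_def stereo_chart_def stereo_image[OF assms])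
qed

text \<open>In complex notation this is conj(z) / |z|^2 = 1/z, a holomorphic map away from 0; hence
  the reflected second coordinate makes the atlas oriented.\<close>

definition conj_inversion :: "real^2 \<Rightarrow> real^2" where
  "conj_inversion y = (y$1 * inverse (y \<bullet> y)) *\<^sub>R axis 1 1 + (- (y$2 * inverse (y \<bullet> y))) *\<^sub>R axis 2 1"

lemma stereo_transition:
  assumes R: "R > 0" and s: "s * s = 1"
  shows "stereo R (- s) (stereo_inv R t s y) = conj_inversion y"
proof -
  define r where "r = y \<bullet> y"
  define w where "w = r + 1"
  have w: "w > 0" using inner2_pos[of y] by (simp add: w_def r_def)
  have "s * (R * s * (r - 1) / w) = (s * s) * R * (r - 1) / w" by simp
  then have e: "R - - s * (R * s * (r - 1) / w) = 2 * R * r / w"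
    using w s by (simp add: field_simps) (simp add: w_def r_def algebra_simps)
  \<comment> \<open>At y = 0 both sides are 0 by the convention for division by zero, so the
    identity with \<open>conj_inversion\<close> holds on the whole plane.\<close>
  have 1: "2 * R * (y$1) / w / (2 * R * r / w) = y$1 * inverse r"
    using R w by (cases "r = 0") (simp_all add: field_simps)
  have "- s * (2 * R * s * (y$2) / w) / (2 * R * r / w) = (s * s) * (- (y$2 * inverse r))"
    using R w by (cases "r = 0") (simp_all add: field_simps)
  then have 2: "- s * (2 * R * s * (y$2) / w) / (2 * R * r / w) = - (y$2 * inverse r)" using s by simp
  show ?thesis
    unfolding vec_eq_iff forall_2 stereo_nth stereo_inv_nth r_def[symmetric] w_def[symmetric] e 1 2 conj_inversion_def
    by (simp add: axis_def)
qed

text \<open>The origin of one chart represents the pole that the other chart omits; all other points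
  are shared.\<close>

lemma stereo_overlap:
  assumes R: "R > 0" and s: "s * s = 1"
  shows "stereo R s ` (stereo_dom R t s \<inter> stereo_dom R t (- s)) = - {0}"
proof -
  have "stereo_inv R t s y \<in> stereo_dom R t (- s) \<longleftrightarrow> y \<noteq> 0" for y
  proof -
    have "R * s * (y \<bullet> y - 1) / (y \<bullet> y + 1) = - s * R \<longleftrightarrow> R * s * (y \<bullet> y - 1) = - s * R * (y \<bullet> y + 1)"
      using inner2_pos[of y] by (simp add: divide_eq_eq)
    also have "\<dots> \<longleftrightarrow> 2 * (R * s) * (y \<bullet> y) = 0" by (auto simp: algebra_simps)
    also have "\<dots> \<longleftrightarrow> y = 0" using R s by auto
    finally have "fst (stereo_inv R t s y) $ 3 = - s * R \<longleftrightarrow> y = 0" by (simp add: stereo_inv_nth)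
    then show ?thesis using stereo_inv_mem[OF assms, of t y] by (simp add: stereo_dom_def)
  qed
  moreover have "stereo R s ` (stereo_dom R t s \<inter> stereo_dom R t (- s)) = {y. stereo_inv R t s y \<in> stereo_dom R t (- s)}"
  proof (intro equalityI subsetI)
    fix y assume "y \<in> stereo R s ` (stereo_dom R t s \<inter> stereo_dom R t (- s))"
    then show "y \<in> {y. stereo_inv R t s y \<in> stereo_dom R t (- s)}" by (auto simp: stereo_inv_stereo[OF assms])
  next
    fix y assume "y \<in> {y. stereo_inv R t s y \<in> stereo_dom R t (- s)}"
    then have "stereo_inv R t s y \<in> stereo_dom R t s \<inter> stereo_dom R t (- s)" using stereo_inv_mem[OF assms] by simp
    from imageI[OF this, of "stereo R s"]
    show "y \<in> stereo R s ` (stereo_dom R t s \<inter> stereo_dom R t (- s))" by (simp add: stereo_stereo_inv[OF assms])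
  qed
  ultimately show ?thesis by auto
qed

lemma smooth_conj_inversion: "smooth_on (- {0}) conj_inversion"
  unfolding smooth_on_def conj_inversion_def[abs_def]
proof
  fix n
  have o: "open (- {0::real^2})" by (intro open_Compl closed_singleton)
  have lin: "Ck_on n S (\<lambda>y::real^2. y $ i)" for i S
    by (rule Ck_on_linear) (rule bounded_linear_vec_nth)
  have id: "Ck_on n S (\<lambda>y::real^2. y)" for S by (rule Ck_on_linear[OF bounded_linear_ident])
  have q: "Ck_on n (- {0}) (\<lambda>y::real^2. y$i * inverse (y \<bullet> y))" for i
    by (intro Ck_on_mult Ck_on_inverse Ck_on_inner lin id o) auto
  have "Ck_on n (- {0}) (\<lambda>y::real^2. (-1) * (y$2 * inverse (y \<bullet> y)))"
    by (intro Ck_on_mult[OF o Ck_on_const] q)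
  then have "Ck_on n (- {0}) (\<lambda>y::real^2. - (y$2 * inverse (y \<bullet> y)))" by simp
  then show "Ck_on n (- {0}) (\<lambda>y::real^2. (y$1 * inverse (y \<bullet> y)) *\<^sub>R axis 1 1 + (- (y$2 * inverse (y \<bullet> y))) *\<^sub>R (axis 2 1 :: real^2))"
    by (intro Ck_on_add[OF o] Ck_on_scaleR[OF o] Ck_on_const q)
qed

text \<open>The differential of 1/z is multiplication by -1/z^2, whose real determinant is 1/|z|^4 =
  1/r^2; the computation confirms this in real coordinates.\<close>

lemma det_conj_inversion_pos:
  fixes y :: "real^2"
  assumes "y \<noteq> 0"
  shows "det (matrix (frechet_derivative conj_inversion (at y))) > 0"
proof -
  define r where "r = y \<bullet> y"
  have r: "r > 0" using assms by (simp add: r_def)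
  define D where "D v = (v$1 * inverse r - y$1 * (inverse r * (2 * (y \<bullet> v)) * inverse r)) *\<^sub>R axis 1 1
    + (- (v$2 * inverse r - y$2 * (inverse r * (2 * (y \<bullet> v)) * inverse r))) *\<^sub>R (axis 2 1 :: real^2)" for v
  have inv: "((\<lambda>y::real^2. inverse (y \<bullet> y)) has_derivative (\<lambda>v. - (inverse r * (2 * (y \<bullet> v)) * inverse r))) (at y)"
    using r unfolding r_def by (auto intro!: derivative_eq_intros simp: fun_eq_iff inner_commute)
  have q: "((\<lambda>y::real^2. y$i * inverse (y \<bullet> y)) has_derivative (\<lambda>v. v$i * inverse r - y$i * (inverse r * (2 * (y \<bullet> v)) * inverse r))) (at y)" for i
    using has_derivative_mult[OF bounded_linear_imp_has_derivative[OF bounded_linear_vec_nth] inv, of i]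
    by (simp add: r_def algebra_simps)
  have "(conj_inversion has_derivative D) (at y)"
    unfolding D_def[abs_def] conj_inversion_def[abs_def]
    by (intro has_derivative_add has_derivative_scaleR_left has_derivative_minus q)
  note D = frechet_derivative_eq[OF this]
  have "y \<bullet> axis 1 1 = y$1" "y \<bullet> axis 2 1 = y$2" by (simp_all add: inner_axis)
  then have "det (matrix D) = ((inverse r - 2 * (y$1)\<^sup>2 * (inverse r)\<^sup>2) * (- inverse r + 2 * (y$2)\<^sup>2 * (inverse r)\<^sup>2)
      + 4 * (y$1)\<^sup>2 * (y$2)\<^sup>2 * (inverse r)\<^sup>2 * (inverse r)\<^sup>2)"
    unfolding det_matrix_2 D_def by (simp add: axis_def power2_eq_square algebra_simps)
  also have "\<dots> = - (inverse r)\<^sup>2 + 2 * ((y$1)\<^sup>2 + (y$2)\<^sup>2) * inverse r * (inverse r)\<^sup>2"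
    by (simp add: power2_eq_square algebra_simps)
  also have "\<dots> = (inverse r)\<^sup>2" using r unfolding inner2[symmetric] r_def[symmetric] by simp
  finally show ?thesis unfolding D using r by simp
qed

definition stereo_atlas :: "real \<Rightarrow> real \<Rightarrow> E4 chart set" where
  "stereo_atlas R t = {stereo_chart R t 1, stereo_chart R t (-1)}"

text \<open>Lets either chart play the role of the sign s, so that only one transition has to be
  computed.\<close>

lemma stereo_atlas_cases:
  assumes "c \<in> stereo_atlas R t"
  obtains s where "s * s = 1" "c = stereo_chart R t s" "stereo_atlas R t = {stereo_chart R t s, stereo_chart R t (- s)}"
proof -
  consider "c = stereo_chart R t 1" | "c = stereo_chart R t (-1)" using assms by (auto simp: stereo_atlas_def)
  then show ?thesis
  proof cases
    case 1 then show ?thesis using that[of 1] by (simp add: stereo_atlas_def)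
  next
    case 2 then show ?thesis using that[of "-1"] by (simp add: stereo_atlas_def insert_commute)
  qed
qed

lemma stereo_atlas_transition:
  assumes R: "R > 0" and c: "c \<in> stereo_atlas R t" and d: "d \<in> stereo_atlas R t"
  shows "smooth_on (snd c ` (fst c \<inter> fst d)) (in_chart c (snd d)) \<and>
    (\<forall>x\<in>snd c ` (fst c \<inter> fst d). det (matrix (frechet_derivative (in_chart c (snd d)) (at x))) > 0)"
proof -
  obtain s where s: "s * s = 1" "c = stereo_chart R t s" "stereo_atlas R t = {stereo_chart R t s, stereo_chart R t (- s)}"
    using stereo_atlas_cases[OF c] by blast
  have d: "d = stereo_chart R t s \<or> d = stereo_chart R t (- s)" using d s(3) by simp
  have ch: "in_chart c (snd d) = (\<lambda>y. snd d (stereo_inv R t s y))" unfolding s(2) by (rule in_stereo_chart[OF R s(1)])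
  show ?thesis
  proof (cases "d = stereo_chart R t s")
    case True
    then have eq: "in_chart c (snd d) = (\<lambda>y. y)"
      unfolding ch by (simp add: stereo_chart_def stereo_stereo_inv[OF R s(1)])
    have "matrix (\<lambda>v::real^2. v) = mat 1" using matrix_id_mat_1 by (simp add: id_def)
    then show ?thesis
      unfolding eq frechet_derivative_eq[OF has_derivative_ident]
      by (simp add: smooth_on_def Ck_on_linear[OF bounded_linear_ident])
  next
    case False
    then have d: "d = stereo_chart R t (- s)" using d by blast
    have "snd c ` (fst c \<inter> fst d) = - {0}" unfolding d s(2) by (simp add: stereo_chart_def stereo_overlap[OF R s(1)])
    moreover have "in_chart c (snd d) = conj_inversion"
      unfolding ch by (simp add: d stereo_chart_def stereo_transition[OF R s(1)])
    ultimately show ?thesis using smooth_conj_inversion det_conj_inversion_pos by simp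
  qed
qed

lemma stereo_atlas_cover:
  assumes "R > 0"
  shows "\<Union> (fst ` stereo_atlas R t) = sphere 0 R \<times> {t}"
proof -
  have "R * 1 \<noteq> - (R * 1)" using assms by simp
  then show ?thesis by (auto simp: stereo_atlas_def stereo_chart_def stereo_dom_def)
qed

lemma smooth_atlas_stereo:
  assumes R: "R > 0"
  shows "smooth_atlas (top_of_set (sphere 0 R \<times> {t})) (stereo_atlas R t)"
proof -
  have "is_chart (top_of_set (sphere 0 R \<times> {t})) c" if "c \<in> stereo_atlas R t" for c
    using that is_chart_stereo[OF R, of 1 t] is_chart_stereo[OF R, of "-1" t] by (auto simp: stereo_atlas_def)
  then show ?thesis
    unfolding smooth_atlas_def using stereo_atlas_cover[OF R] stereo_atlas_transition[OF R] by auto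
qed

section \<open>The slice as a two-sided surface\<close>

lemma second_countable_top_of_set: "second_countable_space (top_of_set (S :: 'a::second_countable_topology set))"
proof -
  obtain B :: "'a set set" where B: "countable B" "topological_basis B" using ex_countable_basis by blast
  show ?thesis
    unfolding second_countable_space_def
  proof (intro exI[of _ "(\<lambda>b. S \<inter> b) ` B"] conjI ballI allI impI)
    show "countable ((\<lambda>b. S \<inter> b) ` B)" using B(1) by simp
    show "openin (top_of_set S) V" if "V \<in> (\<lambda>b. S \<inter> b) ` B" for V
      using that topological_basis_open[OF B(2)] by auto
    fix U x assume U: "openin (top_of_set S) U \<and> x \<in> U"
    then obtain W where W: "open W" "U = S \<inter> W" by (auto simp: openin_open)
    then obtain b where b: "b \<in> B" "x \<in> b" "b \<subseteq> W" using U topological_basisE[OF B(2) W(1), of x] by blast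
    have "x \<in> S \<inter> b" "S \<inter> b \<subseteq> U" using U W(2) b(2,3) by auto
    then show "\<exists>V\<in>(\<lambda>b. S \<inter> b) ` B. x \<in> V \<and> V \<subseteq> U" using imageI[OF b(1), of "\<lambda>b. S \<inter> b"] by blast
  qed
qed

lemma surface_stereo:
  assumes R: "R > 0"
  shows "surface (top_of_set (sphere 0 R \<times> {t})) (stereo_atlas R t)"
proof -
  let ?S = "sphere (0::real^3) R \<times> {t}"
  have "orientable (top_of_set ?S) (stereo_atlas R t)"
    unfolding orientable_def using smooth_atlas_stereo[OF R] stereo_atlas_transition[OF R]
    by (intro exI[of _ "stereo_atlas R t"]) simp
  moreover have "connected ?S" by (intro connected_Times connected_sphere) auto
  then have "connectedin euclidean ?S" by simp
  then have "connected_space (top_of_set ?S)" by (simp add: connectedin_def)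
  moreover have "?S \<noteq> {}" using stereo_inv_mem[OF R, of 1 t 0] stereo_dom_subset[of R t 1] by auto
  ultimately show ?thesis
    unfolding surface_def
    using smooth_atlas_stereo[OF R, of t] second_countable_top_of_set[of ?S]
      Hausdorff_space_subtopology[OF Hausdorff_space_euclidean, of ?S] by simp
qed

lemma two_sided_stereo:
  assumes k: "\<kappa> > 0" and R: "R = 1 / sqrt \<kappa>"
  shows "two_sided_surface \<kappa> (top_of_set (slice \<kappa> t)) (stereo_atlas R t) (\<lambda>q. q) (\<lambda>q. (0, 1))"
proof -
  have R0: "R > 0" using k R by simp
  have sl: "slice \<kappa> t = sphere 0 R \<times> {t}" by (simp add: slice_def R)
  have inj: "inj (frechet_derivative (in_chart c (\<lambda>q. q)) (at x)) \<and> snd (frechet_derivative (in_chart c (\<lambda>q. q)) (at x) v) = 0"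
    if c: "c \<in> stereo_atlas R t" for c x v
  proof -
    obtain s where s: "s * s = 1" "c = stereo_chart R t s" using stereo_atlas_cases[OF c] by metis
    let ?I = "stereo_inv R t s"
    have eq: "in_chart c (\<lambda>q. q) = ?I" unfolding s(2) by (rule in_stereo_chart[OF R0 s(1)])
    have I: "(?I has_derivative frechet_derivative ?I (at x)) (at x)"
      by (rule Ck_on_Suc_has_derivative[OF Ck_stereo_inv]) simp
    have "R - s * (fst (?I x) $ 3) \<noteq> 0"
      unfolding stereo_inv_denom[OF s(1)] using R0 inner2_pos[of x] by simp
    then have S: "(stereo R s has_derivative frechet_derivative (stereo R s) (at (?I x))) (at (?I x))"
      by (intro Ck_on_Suc_has_derivative[OF Ck_stereo]) simp
    \<comment> \<open>\<open>stereo\<close> is differentiable on an open subset of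
      \<open>E4\<close>, not only along the slice, so the chain rule gives the differential of the
      parametrisation a left inverse; this is the immersion condition.\<close>
    have "(stereo R s \<circ> ?I) = id" by (simp add: fun_eq_iff stereo_stereo_inv[OF R0 s(1)])
    then have "frechet_derivative (stereo R s) (at (?I x)) \<circ> frechet_derivative ?I (at x) = id"
      using diff_chain_at[OF I S] has_derivative_unique has_derivative_id by metis
    then have "inj (frechet_derivative ?I (at x))" by (metis inj_on_id inj_on_imageI2)
    moreover have "((\<lambda>y. snd (?I y)) has_derivative (\<lambda>v. snd (frechet_derivative ?I (at x) v))) (at x)"
      by (rule has_derivative_snd[OF I])
    then have "(\<lambda>v. snd (frechet_derivative ?I (at x) v)) = (\<lambda>v. 0)"
      unfolding stereo_inv_nth(4) using has_derivative_unique has_derivative_const by blast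
    then have "snd (frechet_derivative ?I (at x) v) = 0" by (rule fun_cong)
    ultimately show ?thesis unfolding eq by blast
  qed
  have sm: "smooth_map (stereo_atlas R t) (\<lambda>q. q)"
    unfolding smooth_map_def
  proof
    fix c assume c: "c \<in> stereo_atlas R t"
    obtain s where s: "s * s = 1" "c = stereo_chart R t s" using stereo_atlas_cases[OF c] by metis
    show "smooth_on (snd c ` fst c) (in_chart c (\<lambda>q. q))"
      unfolding smooth_on_def s(2) in_stereo_chart[OF R0 s(1)] using Ck_on_subset[OF Ck_stereo_inv subset_UNIV] by blast
  qed
  have N: "smooth_map (stereo_atlas R t) (\<lambda>q. (0, 1) :: E4)"
    by (simp add: smooth_map_def smooth_on_def in_chart_def o_def Ck_on_const)
  show ?thesis
    unfolding two_sided_surface_def immersion_def unit_normal_field_def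
    using surface_stereo[OF R0, of t] sm N inj
    by (auto simp: sl ambient_def R tproj_def norm_Pair inner_prod_def)
qed

text \<open>The equivalence ranges over surfaces on an arbitrary type \<open>'a\<close>, which may
  carry no compact surface at all; the second conjunct therefore exhibits every slice as a compact
  stable surface of constant mean curvature on the type \<open>E4\<close>.\<close>

theorem corollary3p2:
  fixes \<kappa> :: real
  assumes "\<kappa> > 0"
  shows "(\<forall>(X :: 'a topology) \<A> \<phi> N.
            two_sided_surface \<kappa> X \<A> \<phi> N \<and> compact_space X \<longrightarrow>
            (constant_mean_curvature \<kappa> X \<A> \<phi> N \<and> strongly_stable \<kappa> X \<A> \<phi> N \<longleftrightarrow>
             (\<exists>t. \<phi> ` topspace X = slice \<kappa> t)))
       \<and> (\<forall>t. compact_space (top_of_set (slice \<kappa> t)) \<and>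
            (\<exists>\<A> N. two_sided_surface \<kappa> (top_of_set (slice \<kappa> t)) \<A> (\<lambda>q. q) N \<and>
               constant_mean_curvature \<kappa> (top_of_set (slice \<kappa> t)) \<A> (\<lambda>q. q) N \<and>
               strongly_stable \<kappa> (top_of_set (slice \<kappa> t)) \<A> (\<lambda>q. q) N))"
proof (intro conjI allI impI)
  fix X :: "'a topology" and \<A> \<phi> N
  assume "two_sided_surface \<kappa> X \<A> \<phi> N \<and> compact_space X"
  then interpret two_sided \<kappa> X \<A> \<phi> N using assms by unfold_locales auto
  show "constant_mean_curvature \<kappa> X \<A> \<phi> N \<and> strongly_stable \<kappa> X \<A> \<phi> N \<longleftrightarrow> (\<exists>t. \<phi> ` topspace X = slice \<kappa> t)"
    by (rule stable_iff_slice)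
next
  fix t
  have "compact (slice \<kappa> t)" by (simp add: slice_def compact_Times)
  then show cpt: "compact_space (top_of_set (slice \<kappa> t))" by (simp add: compact_space_subtopology)
  let ?A = "stereo_atlas (1 / sqrt \<kappa>) t" and ?N = "\<lambda>q::E4. (0, 1) :: E4"
  have ts: "two_sided_surface \<kappa> (top_of_set (slice \<kappa> t)) ?A (\<lambda>q. q) ?N"
    by (rule two_sided_stereo[OF assms refl])
  then interpret two_sided \<kappa> "top_of_set (slice \<kappa> t)" ?A "\<lambda>q. q" ?N
    using assms cpt by unfold_locales auto
  have "(\<lambda>q. q) ` topspace (top_of_set (slice \<kappa> t)) = slice \<kappa> t" by simp
  then show "\<exists>\<A> N. two_sided_surface \<kappa> (top_of_set (slice \<kappa> t)) \<A> (\<lambda>q. q) N \<and>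
      constant_mean_curvature \<kappa> (top_of_set (slice \<kappa> t)) \<A> (\<lambda>q. q) N \<and>
      strongly_stable \<kappa> (top_of_set (slice \<kappa> t)) \<A> (\<lambda>q. q) N"
    using ts stable_iff_slice by blast
qed

end
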